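(* Let $\phi$ be a hamiltonian $2$-form on a Kähler manifold $(M,g,J,\omega)$ of real dimension $2m$, with momentum polynomial $p(t)$. Then the functions $p(t)$ on $M$ (for each $t\in\mathbb R$) are Poisson-commuting hamiltonians for Killing vector fields $K(t):=J\,\mathrm{grad}_g\,p(t)$ which preserve $\phi$. In particular, the vector fields $K(t)$ all commute.
   Context: $\omega(X,Y)=g(JX,Y)$; $\nabla$ is the Levi-Civita connection; vectors and $1$-forms are identified via $g$; $J\alpha=-\alpha\circ J$ on $1$-forms and $d^cf=Jdf$. The inner product on $2$-forms is normalized by $\langle\omega,\omega\rangle=m$, and $\mathrm{tr}\,\phi=\langle\phi,\omega\rangle$. A real $J$-invariant $2$-form $\phi$ is hamiltonian if there is a function $\sigma$ on $M$ with $\nabla_X\phi=\frac12(d\sigma\wedge JX-d^c\sigma\wedge X)$ for every vector field $X$; when $m=1$ one requires in addition that $\sigma$ is a Killing potential, i.e. that $J\,\mathrm{grad}_g\sigma$ is a Killing vector field. One may take $\sigma=\mathrm{tr}\,\phi$. The pfaffian of a $2$-form $\psi$ is $\mathrm{pf}\,\psi=\frac1{m!}{*(\psi^{\wedge m})}$, so that $\mathrm{pf}\,\omega=1$. The momentum polynomial of $\phi$ is $p(t):=(-1)^m\mathrm{pf}(\phi-t\omega)=t^m-(\mathrm{tr}\,\phi)t^{m-1}+\cdots+(-1)^m\mathrm{pf}\,\phi$, a polynomial in $t$ whose coefficients are functions on $M$. Poisson brackets are taken with respect to $\omega$. *)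

theory Defs
  imports "HOL-Analysis.Analysis"
begin

section \<open>Smooth maps between normed spaces\<close>

text \<open>\<open>Ck_on k S f\<close> is meant for open \<open>S\<close>: \<open>f\<close> is \<open>k\<close> times continuously
  differentiable on \<open>S\<close>.\<close>

fun Ck_on :: "nat \<Rightarrow> 'e::real_normed_vector set \<Rightarrow> ('e \<Rightarrow> 'f::real_normed_vector) \<Rightarrow> bool" where
  "Ck_on 0 S f \<longleftrightarrow> continuous_on S f"
| "Ck_on (Suc k) S f \<longleftrightarrow> (\<forall>x\<in>S. f differentiable (at x)) \<and>
     (\<forall>v. Ck_on k S (\<lambda>x. frechet_derivative f (at x) v))"

definition smooth_on :: "'e::real_normed_vector set \<Rightarrow> ('e \<Rightarrow> 'f::real_normed_vector) \<Rightarrow> bool" where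
  "smooth_on S f \<longleftrightarrow> (\<forall>k. Ck_on k S f)"


section \<open>Smooth manifolds\<close>

text \<open>A chart is a pair of its domain and its coordinate map; the values of the coordinate map
  outside the domain are irrelevant.\<close>

type_synonym ('a, 'e) chart = "'a set \<times> ('a \<Rightarrow> 'e)"

abbreviation cdom :: "('a, 'e) chart \<Rightarrow> 'a set" where "cdom \<equiv> fst"
abbreviation coord :: "('a, 'e) chart \<Rightarrow> 'a \<Rightarrow> 'e" where "coord \<equiv> snd"
abbreviation cinv :: "('a, 'e) chart \<Rightarrow> 'e \<Rightarrow> 'a" where "cinv c \<equiv> inv_into (cdom c) (coord c)"

definition is_chart :: "'a topology \<Rightarrow> ('a, 'e::euclidean_space) chart \<Rightarrow> bool" where
  "is_chart M c \<longleftrightarrow> openin M (cdom c) \<and> open (coord c ` cdom c) \<and>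
     homeomorphic_map (subtopology M (cdom c)) (top_of_set (coord c ` cdom c)) (coord c)"

definition compatible :: "('a, 'e::euclidean_space) chart \<Rightarrow> ('a, 'e) chart \<Rightarrow> bool" where
  "compatible c d \<longleftrightarrow>
     smooth_on (coord c ` (cdom c \<inter> cdom d)) (coord d \<circ> cinv c) \<and>
     smooth_on (coord d ` (cdom c \<inter> cdom d)) (coord c \<circ> cinv d)"

text \<open>\<open>A\<close> is a maximal smooth atlas; the dimension is \<open>DIM('e)\<close>.\<close>

definition smooth_manifold :: "'a topology \<Rightarrow> ('a, 'e::euclidean_space) chart set \<Rightarrow> bool" where
  "smooth_manifold M A \<longleftrightarrow> Hausdorff_space M \<and> second_countable M \<and>
     (\<forall>c\<in>A. is_chart M c) \<and> (\<Union>c\<in>A. cdom c) = topspace M \<and>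
     (\<forall>c\<in>A. \<forall>d\<in>A. compatible c d) \<and>
     (\<forall>c. is_chart M c \<and> (\<forall>d\<in>A. compatible c d) \<longrightarrow> c \<in> A)"

text \<open>A tangent vector at \<open>p\<close> is the family of its components in all charts around \<open>p\<close>, related
  by the derivatives of the coordinate changes. Components in all other charts are set to 0, so
  that equality of tangent vectors is equality of functions.\<close>

type_synonym ('a, 'e) tvec = "('a, 'e) chart \<Rightarrow> 'e"

definition tangent_space :: "('a, 'e::euclidean_space) chart set \<Rightarrow> 'a \<Rightarrow> ('a, 'e) tvec set" where
  "tangent_space A p = {v.
     (\<forall>c\<in>A. \<forall>d\<in>A. p \<in> cdom c \<and> p \<in> cdom d \<longrightarrow>
        v d = frechet_derivative (coord d \<circ> cinv c) (at (coord c p)) (v c)) \<and>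
     (\<forall>c. c \<notin> A \<or> p \<notin> cdom c \<longrightarrow> v c = 0)}"

definition tlin :: "real \<Rightarrow> ('a, 'e::euclidean_space) tvec \<Rightarrow> real \<Rightarrow> ('a, 'e) tvec \<Rightarrow> ('a, 'e) tvec"
  where "tlin a u b v = (\<lambda>c. a *\<^sub>R u c + b *\<^sub>R v c)"


section \<open>Functions, vector fields and tensor fields\<close>

text \<open>Fields are total functions on \<open>'a\<close>; only their values on the open set under consideration
  matter. Tensorial identities are stated for vector fields on arbitrary open subsets.\<close>

definition smooth_function ::
  "('a, 'e::euclidean_space) chart set \<Rightarrow> 'a set \<Rightarrow> ('a \<Rightarrow> real) \<Rightarrow> bool" where
  "smooth_function A U f \<longleftrightarrow> (\<forall>c\<in>A. smooth_on (coord c ` (cdom c \<inter> U)) (f \<circ> cinv c))"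

text \<open>The differential of \<open>f\<close> at \<open>p\<close>. By the chain rule the choice of the chart is immaterial.\<close>

definition dfun ::
  "('a, 'e::euclidean_space) chart set \<Rightarrow> ('a \<Rightarrow> real) \<Rightarrow> 'a \<Rightarrow> ('a, 'e) tvec \<Rightarrow> real" where
  "dfun A f p v = (let c = (SOME c. c \<in> A \<and> p \<in> cdom c)
     in frechet_derivative (f \<circ> cinv c) (at (coord c p)) (v c))"

definition vector_field ::
  "('a, 'e::euclidean_space) chart set \<Rightarrow> 'a set \<Rightarrow> ('a \<Rightarrow> ('a, 'e) tvec) \<Rightarrow> bool" where
  "vector_field A U X \<longleftrightarrow> (\<forall>p\<in>U. X p \<in> tangent_space A p) \<and>
     (\<forall>c\<in>A. smooth_on (coord c ` (cdom c \<inter> U)) (\<lambda>x. X (cinv c x) c))"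

definition lie_bracket ::
  "('a, 'e::euclidean_space) chart set \<Rightarrow> ('a \<Rightarrow> ('a, 'e) tvec) \<Rightarrow> ('a \<Rightarrow> ('a, 'e) tvec) \<Rightarrow>
   'a \<Rightarrow> ('a, 'e) tvec" where
  "lie_bracket A X Y p = (\<lambda>c. if c \<in> A \<and> p \<in> cdom c
     then frechet_derivative (\<lambda>x. Y (cinv c x) c) (at (coord c p)) (X p c)
        - frechet_derivative (\<lambda>x. X (cinv c x) c) (at (coord c p)) (Y p c)
     else 0)"

definition tensor2 ::
  "'a topology \<Rightarrow> ('a, 'e::euclidean_space) chart set \<Rightarrow>
   ('a \<Rightarrow> ('a, 'e) tvec \<Rightarrow> ('a, 'e) tvec \<Rightarrow> real) \<Rightarrow> bool" where
  "tensor2 M A B \<longleftrightarrow>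
     (\<forall>p\<in>topspace M. \<forall>u\<in>tangent_space A p. \<forall>v\<in>tangent_space A p. \<forall>w\<in>tangent_space A p. \<forall>a b.
        B p (tlin a u b v) w = a * B p u w + b * B p v w \<and>
        B p w (tlin a u b v) = a * B p w u + b * B p w v) \<and>
     (\<forall>U X Y. openin M U \<and> vector_field A U X \<and> vector_field A U Y \<longrightarrow>
        smooth_function A U (\<lambda>p. B p (X p) (Y p)))"

definition two_form ::
  "'a topology \<Rightarrow> ('a, 'e::euclidean_space) chart set \<Rightarrow>
   ('a \<Rightarrow> ('a, 'e) tvec \<Rightarrow> ('a, 'e) tvec \<Rightarrow> real) \<Rightarrow> bool" where
  "two_form M A \<psi> \<longleftrightarrow> tensor2 M A \<psi> \<and>
     (\<forall>p\<in>topspace M. \<forall>u\<in>tangent_space A p. \<forall>v\<in>tangent_space A p. \<psi> p u v = - \<psi> p v u)"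

definition riemannian_metric ::
  "'a topology \<Rightarrow> ('a, 'e::euclidean_space) chart set \<Rightarrow>
   ('a \<Rightarrow> ('a, 'e) tvec \<Rightarrow> ('a, 'e) tvec \<Rightarrow> real) \<Rightarrow> bool" where
  "riemannian_metric M A g \<longleftrightarrow> tensor2 M A g \<and>
     (\<forall>p\<in>topspace M. \<forall>u\<in>tangent_space A p. \<forall>v\<in>tangent_space A p. g p u v = g p v u) \<and>
     (\<forall>p\<in>topspace M. \<forall>u\<in>tangent_space A p. u \<noteq> (\<lambda>_. 0) \<longrightarrow> g p u u > 0)"

definition endomorphism_field ::
  "'a topology \<Rightarrow> ('a, 'e::euclidean_space) chart set \<Rightarrow>
   ('a \<Rightarrow> ('a, 'e) tvec \<Rightarrow> ('a, 'e) tvec) \<Rightarrow> bool" where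
  "endomorphism_field M A J \<longleftrightarrow>
     (\<forall>p\<in>topspace M. \<forall>u\<in>tangent_space A p. J p u \<in> tangent_space A p) \<and>
     (\<forall>p\<in>topspace M. \<forall>u\<in>tangent_space A p. \<forall>v\<in>tangent_space A p. \<forall>a b.
        J p (tlin a u b v) = tlin a (J p u) b (J p v)) \<and>
     (\<forall>U X. openin M U \<and> vector_field A U X \<longrightarrow> vector_field A U (\<lambda>p. J p (X p)))"

text \<open>The exterior derivative of a 2-form, evaluated on three vector fields.\<close>

definition d2form ::
  "('a, 'e::euclidean_space) chart set \<Rightarrow> ('a \<Rightarrow> ('a, 'e) tvec \<Rightarrow> ('a, 'e) tvec \<Rightarrow> real) \<Rightarrow>
   ('a \<Rightarrow> ('a, 'e) tvec) \<Rightarrow> ('a \<Rightarrow> ('a, 'e) tvec) \<Rightarrow> ('a \<Rightarrow> ('a, 'e) tvec) \<Rightarrow> 'a \<Rightarrow> real" where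
  "d2form A \<psi> X Y Z p =
       dfun A (\<lambda>q. \<psi> q (Y q) (Z q)) p (X p)
     + dfun A (\<lambda>q. \<psi> q (Z q) (X q)) p (Y p)
     + dfun A (\<lambda>q. \<psi> q (X q) (Y q)) p (Z p)
     - \<psi> p (lie_bracket A X Y p) (Z p)
     - \<psi> p (lie_bracket A Y Z p) (X p)
     - \<psi> p (lie_bracket A Z X p) (Y p)"

definition closed_two_form ::
  "'a topology \<Rightarrow> ('a, 'e::euclidean_space) chart set \<Rightarrow>
   ('a \<Rightarrow> ('a, 'e) tvec \<Rightarrow> ('a, 'e) tvec \<Rightarrow> real) \<Rightarrow> bool" where
  "closed_two_form M A \<psi> \<longleftrightarrow> two_form M A \<psi> \<and>
     (\<forall>U X Y Z. openin M U \<and> vector_field A U X \<and> vector_field A U Y \<and> vector_field A U Z \<longrightarrow>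
        (\<forall>p\<in>U. d2form A \<psi> X Y Z p = 0))"

definition lie_derivative ::
  "('a, 'e::euclidean_space) chart set \<Rightarrow> ('a \<Rightarrow> ('a, 'e) tvec) \<Rightarrow>
   ('a \<Rightarrow> ('a, 'e) tvec \<Rightarrow> ('a, 'e) tvec \<Rightarrow> real) \<Rightarrow>
   ('a \<Rightarrow> ('a, 'e) tvec) \<Rightarrow> ('a \<Rightarrow> ('a, 'e) tvec) \<Rightarrow> 'a \<Rightarrow> real" where
  "lie_derivative A X B Y Z p = dfun A (\<lambda>q. B q (Y q) (Z q)) p (X p)
     - B p (lie_bracket A X Y p) (Z p) - B p (Y p) (lie_bracket A X Z p)"

definition preserves ::
  "'a topology \<Rightarrow> ('a, 'e::euclidean_space) chart set \<Rightarrow> ('a \<Rightarrow> ('a, 'e) tvec) \<Rightarrow>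
   ('a \<Rightarrow> ('a, 'e) tvec \<Rightarrow> ('a, 'e) tvec \<Rightarrow> real) \<Rightarrow> bool" where
  "preserves M A X B \<longleftrightarrow>
     (\<forall>U Y Z. openin M U \<and> vector_field A U Y \<and> vector_field A U Z \<longrightarrow>
        (\<forall>p\<in>U. lie_derivative A X B Y Z p = 0))"

definition killing_field ::
  "'a topology \<Rightarrow> ('a, 'e::euclidean_space) chart set \<Rightarrow>
   ('a \<Rightarrow> ('a, 'e) tvec \<Rightarrow> ('a, 'e) tvec \<Rightarrow> real) \<Rightarrow> ('a \<Rightarrow> ('a, 'e) tvec) \<Rightarrow> bool" where
  "killing_field M A g X \<longleftrightarrow> vector_field A (topspace M) X \<and> preserves M A X g"


section \<open>The Levi-Civita connection\<close>

definition affine_connection ::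
  "'a topology \<Rightarrow> ('a, 'e::euclidean_space) chart set \<Rightarrow>
   (('a \<Rightarrow> ('a, 'e) tvec) \<Rightarrow> ('a \<Rightarrow> ('a, 'e) tvec) \<Rightarrow> 'a \<Rightarrow> ('a, 'e) tvec) \<Rightarrow> bool" where
  "affine_connection M A nabla \<longleftrightarrow> (\<forall>U X X' Y Y' f h.
     openin M U \<and> vector_field A U X \<and> vector_field A U X' \<and>
     vector_field A U Y \<and> vector_field A U Y' \<and> smooth_function A U f \<and> smooth_function A U h \<longrightarrow>
       vector_field A U (nabla X Y) \<and>
       ((\<forall>p\<in>U. X p = X' p \<and> Y p = Y' p) \<longrightarrow> (\<forall>p\<in>U. nabla X Y p = nabla X' Y' p)) \<and>
       (\<forall>p\<in>U.
          nabla (\<lambda>q. tlin (f q) (X q) (h q) (X' q)) Y p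
            = tlin (f p) (nabla X Y p) (h p) (nabla X' Y p) \<and>
          nabla X (\<lambda>q. tlin 1 (Y q) 1 (Y' q)) p = tlin 1 (nabla X Y p) 1 (nabla X Y' p) \<and>
          nabla X (\<lambda>q. tlin (f q) (Y q) 0 (Y q)) p
            = tlin (dfun A f p (X p)) (Y p) (f p) (nabla X Y p)))"

definition levi_civita ::
  "'a topology \<Rightarrow> ('a, 'e::euclidean_space) chart set \<Rightarrow>
   ('a \<Rightarrow> ('a, 'e) tvec \<Rightarrow> ('a, 'e) tvec \<Rightarrow> real) \<Rightarrow>
   (('a \<Rightarrow> ('a, 'e) tvec) \<Rightarrow> ('a \<Rightarrow> ('a, 'e) tvec) \<Rightarrow> 'a \<Rightarrow> ('a, 'e) tvec) \<Rightarrow> bool" where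
  "levi_civita M A g nabla \<longleftrightarrow> affine_connection M A nabla \<and> (\<forall>U X Y Z.
     openin M U \<and> vector_field A U X \<and> vector_field A U Y \<and> vector_field A U Z \<longrightarrow>
       (\<forall>p\<in>U. tlin 1 (nabla X Y p) (-1) (nabla Y X p) = lie_bracket A X Y p \<and>
          dfun A (\<lambda>q. g q (Y q) (Z q)) p (X p)
            = g p (nabla X Y p) (Z p) + g p (Y p) (nabla X Z p)))"

definition cov_derivative ::
  "('a, 'e::euclidean_space) chart set \<Rightarrow>
   (('a \<Rightarrow> ('a, 'e) tvec) \<Rightarrow> ('a \<Rightarrow> ('a, 'e) tvec) \<Rightarrow> 'a \<Rightarrow> ('a, 'e) tvec) \<Rightarrow>
   ('a \<Rightarrow> ('a, 'e) tvec) \<Rightarrow> ('a \<Rightarrow> ('a, 'e) tvec \<Rightarrow> ('a, 'e) tvec \<Rightarrow> real) \<Rightarrow>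
   ('a \<Rightarrow> ('a, 'e) tvec) \<Rightarrow> ('a \<Rightarrow> ('a, 'e) tvec) \<Rightarrow> 'a \<Rightarrow> real" where
  "cov_derivative A nabla X B Y Z p = dfun A (\<lambda>q. B q (Y q) (Z q)) p (X p)
     - B p (nabla X Y p) (Z p) - B p (Y p) (nabla X Z p)"


section \<open>Kaehler manifolds\<close>

definition kaehler_form ::
  "('a \<Rightarrow> ('a, 'e) tvec \<Rightarrow> ('a, 'e) tvec \<Rightarrow> real) \<Rightarrow> ('a \<Rightarrow> ('a, 'e) tvec \<Rightarrow> ('a, 'e) tvec) \<Rightarrow>
   'a \<Rightarrow> ('a, 'e::euclidean_space) tvec \<Rightarrow> ('a, 'e) tvec \<Rightarrow> real" where
  "kaehler_form g J p u v = g p (J p u) v"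

text \<open>The last clause says that \<open>J\<close> comes from a holomorphic atlas: around every point there is a
  chart of the smooth structure in which \<open>J\<close> is a constant complex structure \<open>J0\<close> of \<open>'e\<close>, that
  is, up to a linear change of coordinates, a chart with values in complex coordinate space.\<close>

definition complex_structure ::
  "'a topology \<Rightarrow> ('a, 'e::euclidean_space) chart set \<Rightarrow>
   ('a \<Rightarrow> ('a, 'e) tvec \<Rightarrow> ('a, 'e) tvec) \<Rightarrow> bool" where
  "complex_structure M A J \<longleftrightarrow> endomorphism_field M A J \<and>
     (\<forall>p\<in>topspace M. \<forall>u\<in>tangent_space A p. J p (J p u) = (\<lambda>c. - u c)) \<and>
     (\<forall>p\<in>topspace M. \<exists>c\<in>A. p \<in> cdom c \<and>
        (\<exists>J0. \<forall>q\<in>cdom c. \<forall>u\<in>tangent_space A q. J q u c = J0 (u c)))"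

definition J_invariant ::
  "'a topology \<Rightarrow> ('a, 'e::euclidean_space) chart set \<Rightarrow>
   ('a \<Rightarrow> ('a, 'e) tvec \<Rightarrow> ('a, 'e) tvec) \<Rightarrow>
   ('a \<Rightarrow> ('a, 'e) tvec \<Rightarrow> ('a, 'e) tvec \<Rightarrow> real) \<Rightarrow> bool" where
  "J_invariant M A J B \<longleftrightarrow>
     (\<forall>p\<in>topspace M. \<forall>u\<in>tangent_space A p. \<forall>v\<in>tangent_space A p. B p (J p u) (J p v) = B p u v)"

definition kaehler_manifold ::
  "'a topology \<Rightarrow> ('a, 'e::euclidean_space) chart set \<Rightarrow>
   ('a \<Rightarrow> ('a, 'e) tvec \<Rightarrow> ('a, 'e) tvec \<Rightarrow> real) \<Rightarrow>
   ('a \<Rightarrow> ('a, 'e) tvec \<Rightarrow> ('a, 'e) tvec) \<Rightarrow> bool" where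
  "kaehler_manifold M A g J \<longleftrightarrow> smooth_manifold M A \<and> riemannian_metric M A g \<and>
     complex_structure M A J \<and> J_invariant M A J g \<and> closed_two_form M A (kaehler_form g J)"

definition grad ::
  "('a, 'e::euclidean_space) chart set \<Rightarrow> ('a \<Rightarrow> ('a, 'e) tvec \<Rightarrow> ('a, 'e) tvec \<Rightarrow> real) \<Rightarrow>
   ('a \<Rightarrow> real) \<Rightarrow> 'a \<Rightarrow> ('a, 'e) tvec" where
  "grad A g f p = (THE v. v \<in> tangent_space A p \<and> (\<forall>w\<in>tangent_space A p. g p v w = dfun A f p w))"

definition J_grad ::
  "('a, 'e::euclidean_space) chart set \<Rightarrow> ('a \<Rightarrow> ('a, 'e) tvec \<Rightarrow> ('a, 'e) tvec \<Rightarrow> real) \<Rightarrow>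
   ('a \<Rightarrow> ('a, 'e) tvec \<Rightarrow> ('a, 'e) tvec) \<Rightarrow> ('a \<Rightarrow> real) \<Rightarrow> 'a \<Rightarrow> ('a, 'e) tvec" where
  "J_grad A g J f p = J p (grad A g f p)"

text \<open>The sign is the one for which \<open>J_grad A g J f\<close> is the hamiltonian vector field of \<open>f\<close>.\<close>

definition hamiltonian_vector ::
  "('a, 'e::euclidean_space) chart set \<Rightarrow> ('a \<Rightarrow> ('a, 'e) tvec \<Rightarrow> ('a, 'e) tvec \<Rightarrow> real) \<Rightarrow>
   ('a \<Rightarrow> real) \<Rightarrow> 'a \<Rightarrow> ('a, 'e) tvec" where
  "hamiltonian_vector A \<omega> f p =
     (THE v. v \<in> tangent_space A p \<and> (\<forall>w\<in>tangent_space A p. \<omega> p v w = - dfun A f p w))"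

definition hamiltonian_for ::
  "'a topology \<Rightarrow> ('a, 'e::euclidean_space) chart set \<Rightarrow>
   ('a \<Rightarrow> ('a, 'e) tvec \<Rightarrow> ('a, 'e) tvec \<Rightarrow> real) \<Rightarrow> ('a \<Rightarrow> real) \<Rightarrow>
   ('a \<Rightarrow> ('a, 'e) tvec) \<Rightarrow> bool" where
  "hamiltonian_for M A \<omega> f X \<longleftrightarrow>
     smooth_function A (topspace M) f \<and> vector_field A (topspace M) X \<and>
     (\<forall>p\<in>topspace M. \<forall>w\<in>tangent_space A p. \<omega> p (X p) w = - dfun A f p w)"

definition poisson_bracket ::
  "('a, 'e::euclidean_space) chart set \<Rightarrow> ('a \<Rightarrow> ('a, 'e) tvec \<Rightarrow> ('a, 'e) tvec \<Rightarrow> real) \<Rightarrow>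
   ('a \<Rightarrow> real) \<Rightarrow> ('a \<Rightarrow> real) \<Rightarrow> 'a \<Rightarrow> real" where
  "poisson_bracket A \<omega> f h p = \<omega> p (hamiltonian_vector A \<omega> f p) (hamiltonian_vector A \<omega> h p)"


section \<open>Hamiltonian 2-forms\<close>

definition wedge ::
  "(('a, 'e) tvec \<Rightarrow> real) \<Rightarrow> (('a, 'e) tvec \<Rightarrow> real) \<Rightarrow>
   ('a, 'e::euclidean_space) tvec \<Rightarrow> ('a, 'e) tvec \<Rightarrow> real" where
  "wedge \<alpha> \<beta> u v = \<alpha> u * \<beta> v - \<alpha> v * \<beta> u"

definition flat ::
  "('a \<Rightarrow> ('a, 'e) tvec \<Rightarrow> ('a, 'e) tvec \<Rightarrow> real) \<Rightarrow> 'a \<Rightarrow>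
   ('a, 'e::euclidean_space) tvec \<Rightarrow> ('a, 'e) tvec \<Rightarrow> real" where
  "flat g p v = (\<lambda>w. g p v w)"

definition J_oneform ::
  "('a \<Rightarrow> ('a, 'e) tvec \<Rightarrow> ('a, 'e) tvec) \<Rightarrow> 'a \<Rightarrow> (('a, 'e::euclidean_space) tvec \<Rightarrow> real) \<Rightarrow>
   ('a, 'e) tvec \<Rightarrow> real" where
  "J_oneform J p \<alpha> = (\<lambda>v. - \<alpha> (J p v))"

definition dcfun ::
  "('a, 'e::euclidean_space) chart set \<Rightarrow> ('a \<Rightarrow> ('a, 'e) tvec \<Rightarrow> ('a, 'e) tvec) \<Rightarrow>
   ('a \<Rightarrow> real) \<Rightarrow> 'a \<Rightarrow> ('a, 'e) tvec \<Rightarrow> real" where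
  "dcfun A J f p = J_oneform J p (dfun A f p)"

definition hamiltonian_two_form ::
  "'a topology \<Rightarrow> ('a, 'e::euclidean_space) chart set \<Rightarrow>
   ('a \<Rightarrow> ('a, 'e) tvec \<Rightarrow> ('a, 'e) tvec \<Rightarrow> real) \<Rightarrow> ('a \<Rightarrow> ('a, 'e) tvec \<Rightarrow> ('a, 'e) tvec) \<Rightarrow>
   (('a \<Rightarrow> ('a, 'e) tvec) \<Rightarrow> ('a \<Rightarrow> ('a, 'e) tvec) \<Rightarrow> 'a \<Rightarrow> ('a, 'e) tvec) \<Rightarrow> nat \<Rightarrow>
   ('a \<Rightarrow> ('a, 'e) tvec \<Rightarrow> ('a, 'e) tvec \<Rightarrow> real) \<Rightarrow> bool" where
  "hamiltonian_two_form M A g J nabla m \<phi> \<longleftrightarrow> two_form M A \<phi> \<and> J_invariant M A J \<phi> \<and>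
     (\<exists>\<sigma>. smooth_function A (topspace M) \<sigma> \<and>
        (\<forall>U X Y Z.
           openin M U \<and> vector_field A U X \<and> vector_field A U Y \<and> vector_field A U Z \<longrightarrow>
           (\<forall>p\<in>U. cov_derivative A nabla X \<phi> Y Z p =
              (1/2) * (wedge (dfun A \<sigma> p) (flat g p (J p (X p))) (Y p) (Z p)
                     - wedge (dcfun A J \<sigma> p) (flat g p (X p)) (Y p) (Z p)))) \<and>
        (m = 1 \<longrightarrow> killing_field M A g (J_grad A g J \<sigma>)))"

text \<open>The \<open>k\<close>-th wedge power of an alternating bilinear form, evaluated on \<open>v 0, \<dots>, v (2*k-1)\<close>;
  the normalisation is the one of \<open>wedge\<close>.\<close>

definition wedge_power ::
  "nat \<Rightarrow> (('a, 'e) tvec \<Rightarrow> ('a, 'e) tvec \<Rightarrow> real) \<Rightarrow>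
   (nat \<Rightarrow> ('a, 'e::euclidean_space) tvec) \<Rightarrow> real" where
  "wedge_power k \<psi> v = (1 / 2 ^ k) *
     (\<Sum>\<pi> | \<pi> permutes {..<2*k}. of_int (sign \<pi>) * (\<Prod>i<k. \<psi> (v (\<pi> (2*i))) (v (\<pi> (2*i+1)))))"

text \<open>Orthonormal frames \<open>(e, J e, e', J e', \<dots>)\<close>, which are positive for the orientation
  induced by \<open>J\<close>.\<close>

definition adapted_frame ::
  "('a, 'e::euclidean_space) chart set \<Rightarrow> ('a \<Rightarrow> ('a, 'e) tvec \<Rightarrow> ('a, 'e) tvec \<Rightarrow> real) \<Rightarrow>
   ('a \<Rightarrow> ('a, 'e) tvec \<Rightarrow> ('a, 'e) tvec) \<Rightarrow> nat \<Rightarrow> 'a \<Rightarrow> (nat \<Rightarrow> ('a, 'e) tvec) \<Rightarrow> bool" where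
  "adapted_frame A g J m p e \<longleftrightarrow>
     (\<forall>i<2*m. e i \<in> tangent_space A p) \<and>
     (\<forall>i<2*m. \<forall>j<2*m. g p (e i) (e j) = (if i = j then 1 else 0)) \<and>
     (\<forall>i<m. e (2*i+1) = J p (e (2*i)))"

text \<open>The Hodge star of a form \<open>\<eta>\<close> of degree \<open>2*m\<close> in dimension \<open>2*m\<close>: the value of \<open>\<eta>\<close> on a
  positively oriented orthonormal frame, which does not depend on the frame.\<close>

definition hodge_star_top ::
  "('a, 'e::euclidean_space) chart set \<Rightarrow> ('a \<Rightarrow> ('a, 'e) tvec \<Rightarrow> ('a, 'e) tvec \<Rightarrow> real) \<Rightarrow>
   ('a \<Rightarrow> ('a, 'e) tvec \<Rightarrow> ('a, 'e) tvec) \<Rightarrow> nat \<Rightarrow> 'a \<Rightarrow> ((nat \<Rightarrow> ('a, 'e) tvec) \<Rightarrow> real) \<Rightarrow> real"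
  where "hodge_star_top A g J m p \<eta> = \<eta> (SOME e. adapted_frame A g J m p e)"

definition pfaffian ::
  "('a, 'e::euclidean_space) chart set \<Rightarrow> ('a \<Rightarrow> ('a, 'e) tvec \<Rightarrow> ('a, 'e) tvec \<Rightarrow> real) \<Rightarrow>
   ('a \<Rightarrow> ('a, 'e) tvec \<Rightarrow> ('a, 'e) tvec) \<Rightarrow> nat \<Rightarrow>
   ('a \<Rightarrow> ('a, 'e) tvec \<Rightarrow> ('a, 'e) tvec \<Rightarrow> real) \<Rightarrow> 'a \<Rightarrow> real" where
  "pfaffian A g J m \<psi> p = (1 / fact m) * hodge_star_top A g J m p (wedge_power m (\<psi> p))"

definition momentum_polynomial ::
  "('a, 'e::euclidean_space) chart set \<Rightarrow> ('a \<Rightarrow> ('a, 'e) tvec \<Rightarrow> ('a, 'e) tvec \<Rightarrow> real) \<Rightarrow>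
   ('a \<Rightarrow> ('a, 'e) tvec \<Rightarrow> ('a, 'e) tvec) \<Rightarrow> nat \<Rightarrow>
   ('a \<Rightarrow> ('a, 'e) tvec \<Rightarrow> ('a, 'e) tvec \<Rightarrow> real) \<Rightarrow> real \<Rightarrow> 'a \<Rightarrow> real" where
  "momentum_polynomial A g J m \<phi> t p =
     (-1) ^ m * pfaffian A g J m (\<lambda>q u v. \<phi> q u v - t * kaehler_form g J q u v) p"

end

theory Submission
  imports Defs
begin

text \<open>Write \<open>\<phi> = g (J \<Phi> \<cdot>, \<cdot>)\<close>, where \<open>\<Phi>\<close> is symmetric and commutes with \<open>J\<close>, and let \<open>\<xi>\<close> be
the gradient of \<open>\<sigma>\<close>. In terms of \<open>\<Phi>\<close> the hamiltonian equation reads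
\<open>\<nabla>\<^sub>X \<Phi> = 1/2 (X \<otimes> \<xi> + \<xi> \<otimes> X + J X \<otimes> J \<xi> + J \<xi> \<otimes> J X)\<close> (\<open>fder_\<Phi>\<close>). Since \<open>p(t)\<close> is
the complex determinant of \<open>t - \<Phi>\<close>, differentiating it gives
\<open>dp(t) = p(t) g ((\<Phi> - t)\<inverse> \<xi>, \<cdot>)\<close>; hence the gradient \<open>\<eta>(t)\<close> of \<open>p(t)\<close> satisfies
\<open>(\<Phi> - t) \<eta>(t) = p(t) \<xi>\<close> (\<open>fder_P_resolvent\<close>, \<open>\<Phi>_\<eta>\<close>), and all assertions follow from this equation.

Poisson commutation: \<open>\<eta>(s)\<close> and \<open>\<eta>(t)\<close> are functions of \<open>\<Phi>\<close> applied to the same vector \<open>\<xi>\<close>, and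
\<open>J\<close> times a function of \<open>\<Phi>\<close> is skew, so \<open>g (\<eta>(t), J \<eta>(s)) = 0\<close> (\<open>\<eta>_J_\<eta>\<close>).
Killing fields: \<open>J\<close> times a gradient is Killing exactly if the Hessian commutes with \<open>J\<close>
(\<open>killing_iff\<close>). Differentiating \<open>(\<Phi> - t) \<eta> = p \<xi>\<close> shows that the Hessian of \<open>p(t)\<close> has this
property if that of \<open>\<sigma>\<close> has it (\<open>\<eta>_holomorphic\<close>). For \<open>m = 1\<close> the latter is assumed. For \<open>m > 1\<close>
it is an integrability condition (\<open>\<xi>_holomorphic\<close>): the \<open>(0,1)\<close>-part of the hamiltonian equation
reads \<open>dbar\<^sub>w \<Phi> y = g (w, y) \<xi> + g (J w, y) J \<xi>\<close> in a holomorphic chart, and \<open>dbar\<^sub>z dbar\<^sub>w\<close> is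
symmetric in \<open>z\<close> and \<open>w\<close>.
The derivative of \<open>(\<Phi> - t) \<eta> = p \<xi>\<close> also expresses the commutator of \<open>\<Phi>\<close> with the Hessian of
\<open>p(t)\<close>, which is what \<open>\<phi>\<close> being preserved amounts to (\<open>momentum_preserves\<close>). Finally, the derivative of
\<open>g (\<eta>(t), J \<eta>(s)) = 0\<close> is the vanishing of the bracket of the two Killing fields
(\<open>momentum_commute\<close>).

Two devices carry these arguments through. The resolvent \<open>(\<Phi> - t)\<inverse>\<close> at a given point exists only
for \<open>t\<close> outside the spectrum, for instance for large \<open>t\<close>; but at a fixed point both sides of each
identity are polynomials in \<open>t\<close>, so an identity for large \<open>t\<close> holds for all \<open>t\<close>. And the pfaffian is
taken in an arbitrary adapted frame that need not depend smoothly on the point; because alternating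
forms of top degree are proportional, it equals, up to a constant, the quotient of
the pfaffian sums of \<open>\<phi> - t \<omega>\<close> and of \<open>\<omega>\<close> in the coordinate frame, which is a smooth function.

All assertions are local. They are proved in a chart in which \<open>J\<close> is constant, for
functions on an open subset of the model space, and then transported to the manifold.\<close>

section \<open>Smooth maps\<close>

abbreviation fder :: "('e::real_normed_vector \<Rightarrow> 'f::real_normed_vector) \<Rightarrow> 'e \<Rightarrow> 'e \<Rightarrow> 'f" where
  "fder f x \<equiv> frechet_derivative f (at x)"

lemma fder_eq: "(f has_derivative f') (at x) \<Longrightarrow> fder f x = f'"
  by (metis frechet_derivative_at)

lemma fder_has: "f differentiable (at x) \<Longrightarrow> (f has_derivative fder f x) (at x)"
  using frechet_derivative_works by blast

lemma fder_linear: "f differentiable (at x) \<Longrightarrow> linear (fder f x)"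
  by (rule linear_frechet_derivative)

lemma fder_cong:
  assumes "open S" "x \<in> S" "\<And>y. y \<in> S \<Longrightarrow> f y = h y"
  shows "fder f x = fder h x"
proof -
  have "(f has_derivative f') (at x) \<longleftrightarrow> (h has_derivative f') (at x)" for f'
    using assms has_derivative_transform_within_open[of f f' x UNIV S h]
      has_derivative_transform_within_open[of h f' x UNIV S f] by auto
  then show ?thesis
    by (simp add: frechet_derivative_def)
qed

lemma differentiable_cong_open:
  assumes "open S" "x \<in> S" "\<And>y. y \<in> S \<Longrightarrow> f y = h y"
  shows "f differentiable (at x) \<longleftrightarrow> h differentiable (at x)"
  unfolding differentiable_def
  using assms has_derivative_transform_within_open[of f _ x UNIV S h]
    has_derivative_transform_within_open[of h _ x UNIV S f] by metis

lemma Ck_on_cong: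
  assumes "open S" "\<And>y. y \<in> S \<Longrightarrow> f y = h y"
  shows "Ck_on k S f = Ck_on k S h"
  using assms(2)
proof (induction k arbitrary: f h)
  case 0
  then show ?case by (auto intro: continuous_on_cong)
next
  case (Suc k)
  have "Ck_on k S (\<lambda>x. fder f x v) = Ck_on k S (\<lambda>x. fder h x v)" for v
    using Suc.IH[of "\<lambda>x. fder f x v" "\<lambda>x. fder h x v"] fder_cong[OF assms(1) _ Suc.prems] by simp
  then show ?case
    using differentiable_cong_open[OF assms(1) _ Suc.prems] by auto
qed

lemma Ck_on_subset: "Ck_on k S f \<Longrightarrow> T \<subseteq> S \<Longrightarrow> Ck_on k T f"
  by (induction k arbitrary: f) (auto intro: continuous_on_subset)

lemma Ck_on_Suc_D: "Ck_on (Suc k) S f \<Longrightarrow> Ck_on k S f"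
proof (induction k arbitrary: f)
  case 0
  then show ?case
    using differentiable_at_imp_differentiable_on[of S f]
    by (auto intro: differentiable_imp_continuous_on)
next
  case (Suc k)
  then show ?case by auto
qed

lemma Ck_on_local:
  assumes "\<And>x. x \<in> S \<Longrightarrow> \<exists>T. open T \<and> x \<in> T \<and> Ck_on k T f"
  shows "Ck_on k S f"
  using assms
proof (induction k arbitrary: f)
  case 0
  then have "continuous (at x) f" if "x \<in> S" for x
    using that continuous_on_eq_continuous_at by (metis Ck_on.simps(1))
  then show ?case
    by (simp add: continuous_at_imp_continuous_on)
next
  case (Suc k)
  have "f differentiable (at x)" if "x \<in> S" for x
    using Suc.prems[OF that] by auto
  moreover have "Ck_on k S (\<lambda>x. fder f x v)" for v
    by (rule Suc.IH) (use Suc.prems in force)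
  ultimately show ?case by auto
qed

lemma Ck_on_const: "Ck_on k S (\<lambda>x. c)"
  by (induction k arbitrary: c) auto

lemma Ck_on_SucI:
  assumes "open S" "\<And>x. x \<in> S \<Longrightarrow> (f has_derivative f' x) (at x)" "\<And>v. Ck_on k S (\<lambda>x. f' x v)"
  shows "Ck_on (Suc k) S f"
proof -
  have "Ck_on k S (\<lambda>x. fder f x v)" for v
    using Ck_on_cong[OF assms(1), of "\<lambda>x. fder f x v" "\<lambda>x. f' x v" k] fder_eq[OF assms(2)] assms(3)
    by simp
  then show ?thesis
    using assms(2) by (auto simp: differentiable_def)
qed

lemma Ck_on_SucD:
  assumes "Ck_on (Suc k) S f" "x \<in> S"
  shows "(f has_derivative fder f x) (at x)"
  using assms by (auto intro: fder_has)

lemma Ck_on_bounded_linear: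
  assumes "open S" "bounded_linear L" "Ck_on k S f"
  shows "Ck_on k S (\<lambda>x. L (f x))"
  using assms(3)
proof (induction k arbitrary: f)
  case 0
  then show ?case
    using bounded_linear.continuous_on[OF assms(2)] by auto
next
  case (Suc k)
  show ?case
  proof (rule Ck_on_SucI[OF assms(1)])
    show "((\<lambda>x. L (f x)) has_derivative (\<lambda>v. L (fder f x v))) (at x)" if "x \<in> S" for x
      by (intro bounded_linear.has_derivative[OF assms(2)] Ck_on_SucD[OF Suc.prems] that)
    show "Ck_on k S (\<lambda>x. L (fder f x v))" for v
      by (rule Suc.IH) (use Suc.prems in auto)
  qed
qed

lemma Ck_on_add:
  assumes "open S" "Ck_on k S f" "Ck_on k S h"
  shows "Ck_on k S (\<lambda>x. f x + h x)"
  using assms(2,3)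
proof (induction k arbitrary: f h)
  case 0
  then show ?case by (simp add: continuous_on_add)
next
  case (Suc k)
  show ?case
  proof (rule Ck_on_SucI[OF assms(1)])
    show "((\<lambda>x. f x + h x) has_derivative (\<lambda>v. fder f x v + fder h x v)) (at x)" if "x \<in> S" for x
      by (intro has_derivative_add Ck_on_SucD[OF Suc.prems(1)] Ck_on_SucD[OF Suc.prems(2)] that)
    show "Ck_on k S (\<lambda>x. fder f x v + fder h x v)" for v
      by (rule Suc.IH) (use Suc.prems in auto)
  qed
qed

lemma Ck_on_bilinear:
  assumes "open S" "bounded_bilinear B" "Ck_on k S f" "Ck_on k S h"
  shows "Ck_on k S (\<lambda>x. B (f x) (h x))"
  using assms(3,4)
proof (induction k arbitrary: f h)
  case 0
  then show ?case
    using bounded_bilinear.continuous_on[OF assms(2)] by auto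
next
  case (Suc k)
  show ?case
  proof (rule Ck_on_SucI[OF assms(1)])
    show "((\<lambda>x. B (f x) (h x)) has_derivative
        (\<lambda>v. B (f x) (fder h x v) + B (fder f x v) (h x))) (at x)" if "x \<in> S" for x
      by (intro bounded_bilinear.FDERIV[OF assms(2)] Ck_on_SucD[OF Suc.prems(1)]
          Ck_on_SucD[OF Suc.prems(2)] that)
    show "Ck_on k S (\<lambda>x. B (f x) (fder h x v) + B (fder f x v) (h x))" for v
      using Suc.prems(1)[THEN Ck_on_Suc_D] Suc.prems(2)[THEN Ck_on_Suc_D] Suc.prems
      by (intro Ck_on_add assms(1) Suc.IH) simp_all
  qed
qed

lemma Ck_on_inverse:
  fixes f :: "'e::real_normed_vector \<Rightarrow> real"
  assumes "open S" "\<And>x. x \<in> S \<Longrightarrow> f x \<noteq> 0" "Ck_on k S f"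
  shows "Ck_on k S (\<lambda>x. inverse (f x))"
  using assms(3)
proof (induction k)
  case 0
  then show ?case using assms(2) by (simp add: continuous_on_inverse)
next
  case (Suc k)
  show ?case
  proof (rule Ck_on_SucI[OF assms(1)])
    show "((\<lambda>x. inverse (f x)) has_derivative (\<lambda>v. - (inverse (f x) * fder f x v * inverse (f x)))) (at x)"
      if "x \<in> S" for x
      using Deriv.has_derivative_inverse[OF assms(2)[OF that] Ck_on_SucD[OF Suc.prems that]] by simp
    have "Ck_on k S (\<lambda>x. inverse (f x) * fder f x v * inverse (f x))" for v
      using Suc.IH[OF Suc.prems[THEN Ck_on_Suc_D]] Suc.prems
      by (intro Ck_on_bilinear[OF assms(1) bounded_bilinear_mult]) simp_all
    from Ck_on_bounded_linear[OF assms(1) bounded_linear_minus[OF bounded_linear_ident] this]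
    show "Ck_on k S (\<lambda>x. - (inverse (f x) * fder f x v * inverse (f x)))" for v .
  qed
qed

lemma linear_Basis_expand:
  fixes L :: "'e::euclidean_space \<Rightarrow> 'f::real_vector"
  assumes "linear L"
  shows "L v = (\<Sum>i\<in>Basis. (v \<bullet> i) *\<^sub>R L i)"
proof -
  have "L v = L (\<Sum>i\<in>Basis. (v \<bullet> i) *\<^sub>R i)"
    by (simp add: euclidean_representation)
  then show ?thesis
    using assms by (simp add: linear_sum linear_scale)
qed

lemma Ck_on_sum:
  assumes "open S" "\<And>i. i \<in> I \<Longrightarrow> Ck_on k S (f i)"
  shows "Ck_on k S (\<lambda>x. \<Sum>i\<in>I. f i x)"
  using assms(2)
proof (induction I rule: infinite_finite_induct)
  case (insert i I)
  have "Ck_on k S (\<lambda>x. f i x + (\<Sum>i\<in>I. f i x))"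
    by (intro Ck_on_add[OF assms(1)] insert) (use insert.prems in auto)
  then show ?case using insert.hyps by simp
qed (simp_all add: Ck_on_const)

text \<open>The chain rule is expanded in the standard basis: each summand of the derivative is a product of
functions to which the induction hypothesis applies.\<close>

lemma Ck_on_compose:
  fixes f :: "'d::euclidean_space \<Rightarrow> 'f::real_normed_vector"
  assumes "open S" "open T" "h ` S \<subseteq> T" "Ck_on k T f" "Ck_on k S h"
  shows "Ck_on k S (\<lambda>x. f (h x))"
  using assms(4,5)
proof (induction k arbitrary: f)
  case 0
  then show ?case
    using assms(3) continuous_on_compose2[of T f S h] by auto
next
  case (Suc k)
  show ?case
  proof (rule Ck_on_SucI[OF assms(1)])
    fix x assume x: "x \<in> S"
    then have hx: "h x \<in> T" using assms(3) by auto
    have "((\<lambda>x. f (h x)) has_derivative (\<lambda>v. fder f (h x) (fder h x v))) (at x)"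
      using diff_chain_at[OF Ck_on_SucD[OF Suc.prems(2) x] Ck_on_SucD[OF Suc.prems(1) hx]]
      by (simp add: o_def)
    moreover have lin: "linear (fder f (h x))"
      using Suc.prems(1) hx by (auto intro: fder_linear)
    have "fder f (h x) (fder h x v) = (\<Sum>i\<in>Basis. (fder h x v \<bullet> i) *\<^sub>R fder f (h x) i)" for v
      by (rule linear_Basis_expand[OF lin])
    ultimately show "((\<lambda>x. f (h x)) has_derivative
        (\<lambda>v. \<Sum>i\<in>Basis. (fder h x v \<bullet> i) *\<^sub>R fder f (h x) i)) (at x)"
      by simp
  next
    fix v
    show "Ck_on k S (\<lambda>x. \<Sum>i\<in>Basis. (fder h x v \<bullet> i) *\<^sub>R fder f (h x) i)"
    proof (intro Ck_on_sum Ck_on_bilinear[OF assms(1) bounded_bilinear_scaleR] assms(1))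
      fix i :: 'd
      show "Ck_on k S (\<lambda>x. fder h x v \<bullet> i)"
        using Ck_on_bounded_linear[OF assms(1) bounded_linear_inner_left, of k "\<lambda>x. fder h x v" i]
          Suc.prems(2) by auto
      show "Ck_on k S (\<lambda>x. fder f (h x) i)"
        by (rule Suc.IH[OF _ Suc.prems(2)[THEN Ck_on_Suc_D]]) (use Suc.prems(1) in simp)
    qed
  qed
qed

lemma smooth_on_differentiable: "smooth_on S f \<Longrightarrow> x \<in> S \<Longrightarrow> f differentiable (at x)"
  unfolding smooth_on_def by (metis Ck_on.simps(2))

lemma smooth_on_has_derivative: "smooth_on S f \<Longrightarrow> x \<in> S \<Longrightarrow> (f has_derivative fder f x) (at x)"
  by (intro fder_has smooth_on_differentiable)

lemma smooth_on_fder: "smooth_on S f \<Longrightarrow> smooth_on S (\<lambda>x. fder f x v)"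
  unfolding smooth_on_def by (metis Ck_on.simps(2))

lemma smooth_on_cong:
  "open S \<Longrightarrow> (\<And>y. y \<in> S \<Longrightarrow> f y = h y) \<Longrightarrow> smooth_on S f = smooth_on S h"
  unfolding smooth_on_def using Ck_on_cong by metis

lemma smooth_on_subset: "smooth_on S f \<Longrightarrow> T \<subseteq> S \<Longrightarrow> smooth_on T f"
  unfolding smooth_on_def using Ck_on_subset by metis

lemma smooth_on_local:
  assumes "\<And>x. x \<in> S \<Longrightarrow> \<exists>T. open T \<and> x \<in> T \<and> smooth_on T f"
  shows "smooth_on S f"
  unfolding smooth_on_def
proof
  fix k show "Ck_on k S f"
    by (rule Ck_on_local) (use assms in \<open>auto simp: smooth_on_def\<close>)
qed

lemma smooth_on_const: "smooth_on S (\<lambda>x. c)"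
  by (simp add: smooth_on_def Ck_on_const)

lemma smooth_on_bounded_linear:
  assumes "open S" "bounded_linear L" "smooth_on S f"
  shows "smooth_on S (\<lambda>x. L (f x))"
  using assms(3) Ck_on_bounded_linear[OF assms(1,2), of _ f] by (simp add: smooth_on_def)

lemma smooth_on_linear:
  fixes L :: "'d::euclidean_space \<Rightarrow> 'f::real_normed_vector"
  assumes "open S" "linear L" "smooth_on S f"
  shows "smooth_on S (\<lambda>x. L (f x))"
  using assms(2) by (intro smooth_on_bounded_linear[OF assms(1) _ assms(3)])
    (simp add: linear_conv_bounded_linear)

lemma smooth_on_add:
  "open S \<Longrightarrow> smooth_on S f \<Longrightarrow> smooth_on S h \<Longrightarrow> smooth_on S (\<lambda>x. f x + h x)"
  by (simp add: smooth_on_def Ck_on_add)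

lemma smooth_on_mult:
  fixes f h :: "'e::real_normed_vector \<Rightarrow> real"
  shows "open S \<Longrightarrow> smooth_on S f \<Longrightarrow> smooth_on S h \<Longrightarrow> smooth_on S (\<lambda>x. f x * h x)"
  by (simp add: smooth_on_def Ck_on_bilinear[OF _ bounded_bilinear_mult])

lemma smooth_on_scaleR:
  "open S \<Longrightarrow> smooth_on S f \<Longrightarrow> smooth_on S h \<Longrightarrow> smooth_on S (\<lambda>x. f x *\<^sub>R h x)"
  by (simp add: smooth_on_def Ck_on_bilinear[OF _ bounded_bilinear_scaleR])

lemma smooth_on_minus: "open S \<Longrightarrow> smooth_on S f \<Longrightarrow> smooth_on S (\<lambda>x. - f x)"
  by (rule smooth_on_bounded_linear[OF _ bounded_linear_minus[OF bounded_linear_ident]])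

lemma smooth_on_diff:
  "open S \<Longrightarrow> smooth_on S f \<Longrightarrow> smooth_on S h \<Longrightarrow> smooth_on S (\<lambda>x. f x - h x)"
  using smooth_on_add[of S f "\<lambda>x. - h x"] smooth_on_minus[of S h] by simp

lemma smooth_on_inner:
  "open S \<Longrightarrow> smooth_on S f \<Longrightarrow> smooth_on S (\<lambda>x. f x \<bullet> c)"
  by (rule smooth_on_bounded_linear[OF _ bounded_linear_inner_left])

lemma smooth_on_divide:
  fixes f h :: "'e::real_normed_vector \<Rightarrow> real"
  assumes "open S" "smooth_on S f" "smooth_on S h" "\<And>x. x \<in> S \<Longrightarrow> h x \<noteq> 0"
  shows "smooth_on S (\<lambda>x. f x / h x)"
  unfolding divide_inverse
proof (rule smooth_on_mult[OF assms(1,2)])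
  show "smooth_on S (\<lambda>x. inverse (h x))"
    using assms unfolding smooth_on_def by (blast intro: Ck_on_inverse)
qed

lemma smooth_on_sum:
  "open S \<Longrightarrow> (\<And>i. i \<in> I \<Longrightarrow> smooth_on S (f i)) \<Longrightarrow> smooth_on S (\<lambda>x. \<Sum>i\<in>I. f i x)"
  by (simp add: smooth_on_def Ck_on_sum)

lemma smooth_on_prod:
  fixes f :: "'i \<Rightarrow> 'e::real_normed_vector \<Rightarrow> real"
  assumes "open S" "\<And>i. i \<in> I \<Longrightarrow> smooth_on S (f i)"
  shows "smooth_on S (\<lambda>x. \<Prod>i\<in>I. f i x)"
  using assms(2)
proof (induction I rule: infinite_finite_induct)
  case (insert i I)
  have "smooth_on S (\<lambda>x. f i x * (\<Prod>i\<in>I. f i x))"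
    by (intro smooth_on_mult[OF assms(1)] insert) (use insert.prems in auto)
  then show ?case using insert.hyps by simp
qed (simp_all add: smooth_on_const)

lemma smooth_on_compose:
  fixes f :: "'d::euclidean_space \<Rightarrow> 'f::real_normed_vector"
  assumes "open S" "open T" "h ` S \<subseteq> T" "smooth_on T f" "smooth_on S h"
  shows "smooth_on S (\<lambda>x. f (h x))"
  unfolding smooth_on_def
proof
  fix k
  have "Ck_on k T f" "Ck_on k S h" using assms(4,5) by (simp_all only: smooth_on_def)
  then show "Ck_on k S (\<lambda>x. f (h x))" by (rule Ck_on_compose[OF assms(1-3)])
qed

section \<open>Symmetry of second derivatives\<close>

text \<open>The mean value theorem is applied first in the direction \<open>u\<close>, to the increment of \<open>f\<close> in the
direction \<open>v\<close>, and then in the direction \<open>v\<close>.\<close>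

lemma second_difference_mvt:
  fixes f :: "'e::real_normed_vector \<Rightarrow> real"
  assumes "h > 0"
    and in_S: "\<And>s r. 0 \<le> s \<Longrightarrow> s \<le> h \<Longrightarrow> 0 \<le> r \<Longrightarrow> r \<le> h \<Longrightarrow> x + s *\<^sub>R u + r *\<^sub>R v \<in> S"
    and C2: "smooth_on S f"
  shows "\<exists>s r. 0 < s \<and> s < h \<and> 0 < r \<and> r < h \<and>
     f (x + h *\<^sub>R u + h *\<^sub>R v) - f (x + h *\<^sub>R u) - f (x + h *\<^sub>R v) + f x
       = h * h * fder (\<lambda>y. fder f y u) (x + s *\<^sub>R u + r *\<^sub>R v) v"
proof -
  let ?d = "\<lambda>s. f (x + s *\<^sub>R u + h *\<^sub>R v) - f (x + s *\<^sub>R u)"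
  have line: "((\<lambda>s. F (a + s *\<^sub>R b)) has_real_derivative fder F (a + s *\<^sub>R b) b) (at s)"
    if "smooth_on S F" "a + s *\<^sub>R b \<in> S" for F :: "'e \<Rightarrow> real" and a b s
  proof -
    have "((\<lambda>s. a + s *\<^sub>R b) has_derivative (\<lambda>k. k *\<^sub>R b)) (at s)"
      by (auto intro!: derivative_eq_intros)
    from diff_chain_at[OF this smooth_on_has_derivative[OF that]]
    have "((\<lambda>s. F (a + s *\<^sub>R b)) has_derivative (\<lambda>k. fder F (a + s *\<^sub>R b) (k *\<^sub>R b))) (at s)"
      by (simp add: o_def)
    moreover have "fder F (a + s *\<^sub>R b) (k *\<^sub>R b) = fder F (a + s *\<^sub>R b) b * k" for k
      using linear_scale[OF fder_linear[OF smooth_on_differentiable[OF that]], of k b] by simp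
    ultimately show ?thesis
      by (simp add: has_field_derivative_def)
  qed
  have "\<exists>s. 0 < s \<and> s < h \<and> ?d h - ?d 0
      = (h - 0) * (fder f (x + s *\<^sub>R u + h *\<^sub>R v) u - fder f (x + s *\<^sub>R u) u)"
  proof (rule MVT2[OF \<open>h > 0\<close>])
    fix s assume s: "0 \<le> s" "s \<le> h"
    have "((\<lambda>s. f ((x + h *\<^sub>R v) + s *\<^sub>R u)) has_real_derivative fder f ((x + h *\<^sub>R v) + s *\<^sub>R u) u) (at s)"
      using line[OF C2, of "x + h *\<^sub>R v" s u] in_S[of s h] s \<open>h > 0\<close> by (simp add: algebra_simps)
    moreover have "((\<lambda>s. f (x + s *\<^sub>R u)) has_real_derivative fder f (x + s *\<^sub>R u) u) (at s)"
      using line[OF C2, of x s u] in_S[of s 0] s \<open>h > 0\<close> by (simp add: algebra_simps)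
    ultimately show "(?d has_real_derivative
        fder f (x + s *\<^sub>R u + h *\<^sub>R v) u - fder f (x + s *\<^sub>R u) u) (at s)"
      by (auto intro!: derivative_eq_intros simp: algebra_simps)
  qed
  then obtain s where s: "0 < s" "s < h" and
    ds: "?d h - ?d 0 = h * (fder f (x + s *\<^sub>R u + h *\<^sub>R v) u - fder f (x + s *\<^sub>R u) u)" by auto
  let ?e = "\<lambda>r. fder f (x + s *\<^sub>R u + r *\<^sub>R v) u"
  have "\<exists>r. 0 < r \<and> r < h \<and> ?e h - ?e 0
      = (h - 0) * fder (\<lambda>y. fder f y u) (x + s *\<^sub>R u + r *\<^sub>R v) v"
    by (rule MVT2[OF \<open>h > 0\<close>], rule line[OF smooth_on_fder[OF C2]], rule in_S) (use s in auto)
  then obtain r where r: "0 < r" "r < h"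
    "?e h - ?e 0 = h * fder (\<lambda>y. fder f y u) (x + s *\<^sub>R u + r *\<^sub>R v) v" by auto
  then show ?thesis
    using s ds by (intro exI[of _ s] exI[of _ r]) (auto simp: algebra_simps)
qed

text \<open>The second difference is symmetric in \<open>u\<close> and \<open>v\<close>, and it is \<open>h\<^sup>2\<close> times either mixed derivative at
a nearby point. If the two derivatives differed at \<open>x\<close>, continuity would separate them for small \<open>h\<close>.\<close>

lemma second_derivative_symmetric_real:
  fixes f :: "'e::real_normed_vector \<Rightarrow> real"
  assumes "open S" "x \<in> S" "smooth_on S f"
  shows "fder (\<lambda>y. fder f y u) x v = fder (\<lambda>y. fder f y v) x u"
proof (rule ccontr)
  let ?A = "\<lambda>y. fder (\<lambda>y. fder f y u) y v" and ?B = "\<lambda>y. fder (\<lambda>y. fder f y v) y u"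
  assume ne: "?A x \<noteq> ?B x"
  define e where "e = \<bar>?A x - ?B x\<bar> / 2"
  have "e > 0" using ne by (simp add: e_def)
  have "Ck_on 0 S ?A" "Ck_on 0 S ?B"
    using smooth_on_fder[OF smooth_on_fder[OF assms(3)]] by (auto simp only: smooth_on_def)
  then have "continuous (at x) ?A" "continuous (at x) ?B"
    using assms by (auto simp: continuous_on_eq_continuous_at)
  then obtain d1 d2 where d: "d1 > 0" "d2 > 0"
    "\<And>y. dist y x < d1 \<Longrightarrow> dist (?A y) (?A x) < e" "\<And>y. dist y x < d2 \<Longrightarrow> dist (?B y) (?B x) < e"
    using \<open>e > 0\<close> unfolding continuous_at_eps_delta by metis
  obtain d3 where d3: "d3 > 0" "ball x d3 \<subseteq> S"
    using assms open_contains_ball by metis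
  define d where "d = min d1 (min d2 d3)"
  have "d > 0" using d d3 by (simp add: d_def)
  define h where "h = d / (2 * (norm u + norm v + 1))"
  have pos: "norm u + norm v + 1 > 0"
    by (simp add: add_nonneg_pos)
  then have "h > 0" using \<open>d > 0\<close> by (simp add: h_def)
  have near: "dist (x + s *\<^sub>R u + r *\<^sub>R v) x < d" if "0 \<le> s" "s \<le> h" "0 \<le> r" "r \<le> h" for s r
  proof -
    have "dist (x + s *\<^sub>R u + r *\<^sub>R v) x \<le> s * norm u + r * norm v"
      using norm_triangle_ineq[of "s *\<^sub>R u" "r *\<^sub>R v"] that by (simp add: dist_norm)
    also have "\<dots> \<le> h * norm u + h * norm v"
      using that by (intro add_mono mult_right_mono) auto
    also have "\<dots> < 2 * (h * (norm u + norm v + 1))"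
      using \<open>h > 0\<close> pos by (simp add: algebra_simps add_nonneg_pos)
    also have "\<dots> = d"
    proof -
      have "2 * (d / (2 * N) * N) = d" if "N > 0" for N :: real
        using that by simp
      from this[OF pos] show ?thesis unfolding h_def .
    qed
    finally show ?thesis .
  qed
  have in_S: "x + s *\<^sub>R u + r *\<^sub>R v \<in> S" if "0 \<le> s" "s \<le> h" "0 \<le> r" "r \<le> h" for s r
    using near[OF that] d3 by (auto simp: d_def dist_commute)
  then have in_S': "x + s *\<^sub>R v + r *\<^sub>R u \<in> S" if "0 \<le> s" "s \<le> h" "0 \<le> r" "r \<le> h" for s r
    using that by (metis add.assoc add.commute)
  obtain s r where 1: "0 < s" "s < h" "0 < r" "r < h"
    "f (x + h *\<^sub>R u + h *\<^sub>R v) - f (x + h *\<^sub>R u) - f (x + h *\<^sub>R v) + f x = h * h * ?A (x + s *\<^sub>R u + r *\<^sub>R v)"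
    using second_difference_mvt[OF \<open>h > 0\<close> in_S assms(3)] by blast
  obtain s' r' where 2: "0 < s'" "s' < h" "0 < r'" "r' < h"
    "f (x + h *\<^sub>R v + h *\<^sub>R u) - f (x + h *\<^sub>R v) - f (x + h *\<^sub>R u) + f x = h * h * ?B (x + s' *\<^sub>R v + r' *\<^sub>R u)"
    using second_difference_mvt[OF \<open>h > 0\<close> in_S' assms(3)] by blast
  have "h * h * ?A (x + s *\<^sub>R u + r *\<^sub>R v) = h * h * ?B (x + r' *\<^sub>R u + s' *\<^sub>R v)"
    using 1 2 by (simp add: algebra_simps)
  then have eq: "?A (x + s *\<^sub>R u + r *\<^sub>R v) = ?B (x + r' *\<^sub>R u + s' *\<^sub>R v)"
    using \<open>h > 0\<close> by simp
  have "dist (?A (x + s *\<^sub>R u + r *\<^sub>R v)) (?A x) < e"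
    using near[of s r] 1 d by (simp add: d_def)
  moreover have "dist (?B (x + r' *\<^sub>R u + s' *\<^sub>R v)) (?B x) < e"
    using near[of r' s'] 2 d by (simp add: d_def)
  ultimately show False
    unfolding eq dist_real_def e_def
    by (smt (verit, ccfv_SIG) field_sum_of_halves)
qed

lemma fder_bounded_linear:
  assumes "bounded_linear L" "f differentiable (at x)"
  shows "fder (\<lambda>y. L (f y)) x v = L (fder f x v)"
  by (subst fder_eq[OF bounded_linear.has_derivative[OF assms(1) fder_has[OF assms(2)]]]) simp

lemma second_derivative_symmetric:
  fixes f :: "'e::real_normed_vector \<Rightarrow> 'd::euclidean_space"
  assumes "open S" "x \<in> S" "smooth_on S f"
  shows "fder (\<lambda>y. fder f y u) x v = fder (\<lambda>y. fder f y v) x u"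
proof (rule euclidean_eqI)
  fix i :: 'd
  have comp: "fder (\<lambda>y. fder f y u) x v \<bullet> i = fder (\<lambda>y. fder (\<lambda>z. f z \<bullet> i) y u) x v" for u v
  proof -
    note bl = fder_bounded_linear[OF bounded_linear_inner_left]
    have "fder (\<lambda>y. fder f y u) x v \<bullet> i = fder (\<lambda>y. fder f y u \<bullet> i) x v"
      by (rule bl[symmetric], rule smooth_on_differentiable[OF smooth_on_fder[OF assms(3)] assms(2)])
    also have "fder (\<lambda>y. fder f y u \<bullet> i) x = fder (\<lambda>y. fder (\<lambda>z. f z \<bullet> i) y u) x"
      by (rule fder_cong[OF assms(1,2)], rule bl[symmetric])
        (rule smooth_on_differentiable[OF assms(3)])
    finally show ?thesis .
  qed
  show "fder (\<lambda>y. fder f y u) x v \<bullet> i = fder (\<lambda>y. fder f y v) x u \<bullet> i"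
    unfolding comp
    by (rule second_derivative_symmetric_real[OF assms(1,2) smooth_on_inner[OF assms(1,3)]])
qed

section \<open>Smooth fields of bilinear forms\<close>

definition smooth_bilinear :: "'e::euclidean_space set \<Rightarrow> ('e \<Rightarrow> 'e \<Rightarrow> 'e \<Rightarrow> real) \<Rightarrow> bool" where
  "smooth_bilinear V B \<longleftrightarrow> (\<forall>x\<in>V. bilinear (B x)) \<and> (\<forall>u v. smooth_on V (\<lambda>x. B x u v))"

lemma smooth_bilinearD:
  "smooth_bilinear V B \<Longrightarrow> x \<in> V \<Longrightarrow> bilinear (B x)"
  "smooth_bilinear V B \<Longrightarrow> smooth_on V (\<lambda>x. B x u v)"
  by (auto simp: smooth_bilinear_def)

lemma bilinear_Basis_expand:
  fixes B :: "'e::euclidean_space \<Rightarrow> 'e \<Rightarrow> real"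
  assumes "bilinear B"
  shows "B a b = (\<Sum>i\<in>Basis. \<Sum>j\<in>Basis. (a \<bullet> i) * (b \<bullet> j) * B i j)"
proof -
  have "B a b = (\<Sum>i\<in>Basis. (a \<bullet> i) * B i b)"
    using linear_Basis_expand[of "\<lambda>a. B a b" a] assms by (simp add: bilinear_def)
  also have "\<dots> = (\<Sum>i\<in>Basis. (a \<bullet> i) * (\<Sum>j\<in>Basis. (b \<bullet> j) * B i j))"
    using linear_Basis_expand[of "B i" b for i] assms by (simp add: bilinear_def)
  finally show ?thesis
    by (simp add: sum_distrib_left mult.assoc)
qed

lemma smooth_bilinear_apply:
  assumes V: "open V" and B: "smooth_bilinear V B" and Y: "smooth_on V Y" and Z: "smooth_on V Z"
  shows "smooth_on V (\<lambda>x. B x (Y x) (Z x))"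
proof -
  have "smooth_on V (\<lambda>x. \<Sum>i\<in>Basis. \<Sum>j\<in>Basis. (Y x \<bullet> i) * (Z x \<bullet> j) * B x i j)"
    by (intro smooth_on_sum[OF V] smooth_on_mult[OF V] smooth_on_inner[OF V] Y Z smooth_bilinearD(2)[OF B])
  then show ?thesis
    by (rule smooth_on_cong[OF V, THEN iffD1, rotated])
      (rule bilinear_Basis_expand[OF smooth_bilinearD(1)[OF B], symmetric])
qed

text \<open>The Leibniz rule. The first term differentiates the form with its two arguments frozen at \<open>x\<close>.\<close>

lemma fder_smooth_bilinear:
  assumes V: "open V" and B: "smooth_bilinear V B" and x: "x \<in> V"
    and Y: "Y differentiable (at x)" and Z: "Z differentiable (at x)"
  shows "((\<lambda>y. B y (Y y) (Z y)) has_derivative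
     (\<lambda>w. fder (\<lambda>y. B y (Y x) (Z x)) x w + B x (fder Y x w) (Z x) + B x (Y x) (fder Z x w))) (at x)"
proof -
  let ?dB = "\<lambda>i j. fder (\<lambda>y. B y i j) x"
  have main: "((\<lambda>y. B y (Y y) (Z y)) has_derivative
      (\<lambda>w. \<Sum>i\<in>Basis. \<Sum>j\<in>Basis. ((Y x \<bullet> i) * (Z x \<bullet> j)) * ?dB i j w
          + ((Y x \<bullet> i) * (Z' w \<bullet> j) + (Y' w \<bullet> i) * (Z x \<bullet> j)) * B x i j)) (at x)"
    if "(Y has_derivative Y') (at x)" "(Z has_derivative Z') (at x)" for Y Z Y' Z'
  proof -
    have "((\<lambda>y. \<Sum>i\<in>Basis. \<Sum>j\<in>Basis. (Y y \<bullet> i) * (Z y \<bullet> j) * B y i j) has_derivative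
      (\<lambda>w. \<Sum>i\<in>Basis. \<Sum>j\<in>Basis. ((Y x \<bullet> i) * (Z x \<bullet> j)) * ?dB i j w
          + ((Y x \<bullet> i) * (Z' w \<bullet> j) + (Y' w \<bullet> i) * (Z x \<bullet> j)) * B x i j)) (at x)"
      by (intro has_derivative_sum has_derivative_mult has_derivative_inner_left that
          smooth_on_has_derivative[OF smooth_bilinearD(2)[OF B] x])
    then show ?thesis
      by (rule has_derivative_transform_within_open[OF _ V x])
        (rule bilinear_Basis_expand[OF smooth_bilinearD(1)[OF B], symmetric])
  qed
  have const: "fder (\<lambda>y. B y a b) x w = (\<Sum>i\<in>Basis. \<Sum>j\<in>Basis. ((a \<bullet> i) * (b \<bullet> j)) * ?dB i j w)" for a b w
    by (subst fder_eq[OF main[OF has_derivative_const has_derivative_const]]) simp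
  have "(\<Sum>i\<in>Basis. \<Sum>j\<in>Basis. ((Y x \<bullet> i) * (Z x \<bullet> j)) * ?dB i j w
          + ((Y x \<bullet> i) * (fder Z x w \<bullet> j) + (fder Y x w \<bullet> i) * (Z x \<bullet> j)) * B x i j)
     = fder (\<lambda>y. B y (Y x) (Z x)) x w + B x (fder Y x w) (Z x) + B x (Y x) (fder Z x w)" for w
    unfolding const[of "Y x" "Z x"] bilinear_Basis_expand[OF smooth_bilinearD(1)[OF B x], of "fder Y x w" "Z x"]
      bilinear_Basis_expand[OF smooth_bilinearD(1)[OF B x], of "Y x" "fder Z x w"]
    by (simp add: sum.distrib algebra_simps)
  then show ?thesis
    using main[OF fder_has[OF Y] fder_has[OF Z]] by simp
qed

text \<open>Gram-Schmidt without normalisation: \<open>f\<close> is the part of \<open>b\<close> orthogonal to the span of \<open>B\<close>, and the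
field found for \<open>B\<close> is corrected by a multiple of \<open>f\<close>. Each step only divides by the
positive function \<open>G x (f x) b\<close>, so smoothness is preserved.\<close>

lemma smooth_raise_aux:
  fixes \<alpha> :: "'e::euclidean_space \<Rightarrow> 'e \<Rightarrow> real"
  assumes V: "open V" and G: "smooth_bilinear V G"
    and sym: "\<And>x u v. x \<in> V \<Longrightarrow> G x u v = G x v u"
    and pos: "\<And>x u. x \<in> V \<Longrightarrow> u \<noteq> 0 \<Longrightarrow> G x u u > 0"
    and "finite B" "independent B" "\<And>u. smooth_on V (\<lambda>x. \<alpha> x u)"
  shows "\<exists>a. smooth_on V a \<and> (\<forall>x\<in>V. a x \<in> span B \<and> (\<forall>u\<in>B. G x (a x) u = \<alpha> x u))"
  using assms(5-)
proof (induction B arbitrary: \<alpha> rule: finite_induct)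
  case empty
  show ?case by (intro exI[of _ "\<lambda>x. 0"]) (simp add: smooth_on_const)
next
  case (insert b B)
  have ind: "independent B" "b \<notin> span B"
    using insert.prems(1) insert.hyps independent_insert[of b B] by auto
  obtain p where p: "smooth_on V p" "\<And>x. x \<in> V \<Longrightarrow> p x \<in> span B"
    "\<And>x u. x \<in> V \<Longrightarrow> u \<in> B \<Longrightarrow> G x (p x) u = G x b u"
    using insert.IH[of "\<lambda>x u. G x b u"] ind(1) smooth_bilinearD(2)[OF G] by metis
  obtain a where a: "smooth_on V a" "\<And>x. x \<in> V \<Longrightarrow> a x \<in> span B"
    "\<And>x u. x \<in> V \<Longrightarrow> u \<in> B \<Longrightarrow> G x (a x) u = \<alpha> x u"
    using insert.IH[of \<alpha>] ind(1) insert.prems(2) by metis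
  define f where "f = (\<lambda>x. b - p x)"
  have f_smooth: "smooth_on V f"
    unfolding f_def by (intro smooth_on_diff V smooth_on_const p)
  have fB: "G x (f x) u = 0" if "x \<in> V" "u \<in> B" for x u
    using p(3)[OF that] bilinear_lsub[OF smooth_bilinearD(1)[OF G that(1)]] by (simp add: f_def)
  have fb: "G x (f x) b > 0" if x: "x \<in> V" for x
  proof -
    note bl = smooth_bilinearD(1)[OF G x]
    have lin: "linear (G x (f x))" using bl by (simp add: bilinear_def)
    have "G x (f x) u = 0" if "u \<in> span B" for u
      by (rule linear_eq_0_on_span[OF lin _ that]) (rule fB[OF x])
    then have "G x (f x) b = G x (f x) (f x)"
      using p(2)[OF x] bilinear_radd[OF bl, of "f x" "f x" "p x"] by (simp add: f_def)
    moreover have "f x \<noteq> 0"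
      using p(2)[OF x] ind(2) by (auto simp: f_def)
    ultimately show ?thesis using pos[OF x] by simp
  qed
  let ?c = "\<lambda>x. (\<alpha> x b - G x (a x) b) / G x (f x) b"
  show ?case
  proof (intro exI[of _ "\<lambda>x. a x + ?c x *\<^sub>R f x"] conjI ballI)
    have "smooth_on V (\<lambda>x. G x (a x) b)" "smooth_on V (\<lambda>x. G x (f x) b)"
      by (intro smooth_bilinear_apply V G a f_smooth smooth_on_const)+
    then show "smooth_on V (\<lambda>x. a x + ?c x *\<^sub>R f x)"
      using fb insert.prems(2)
      by (intro smooth_on_add smooth_on_scaleR smooth_on_divide smooth_on_diff V a f_smooth) force+
  next
    fix x assume x: "x \<in> V"
    note bl = smooth_bilinearD(1)[OF G x]
    show "a x + ?c x *\<^sub>R f x \<in> span (insert b B)"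
      unfolding f_def using a(2)[OF x] p(2)[OF x] span_mono[of B "insert b B"]
      by (intro span_add span_scale span_diff) (auto intro: span_base)
    fix u assume u: "u \<in> insert b B"
    have "G x (a x + ?c x *\<^sub>R f x) u = G x (a x) u + ?c x * G x (f x) u"
      by (simp add: bilinear_ladd[OF bl] bilinear_lmul[OF bl])
    then show "G x (a x + ?c x *\<^sub>R f x) u = \<alpha> x u"
      using u fb[OF x] fB[OF x] a(3)[OF x] by (cases "u = b") auto
  qed
qed

lemma smooth_raise:
  fixes \<alpha> :: "'e::euclidean_space \<Rightarrow> 'e \<Rightarrow> real"
  assumes V: "open V" and G: "smooth_bilinear V G"
    and sym: "\<And>x u v. x \<in> V \<Longrightarrow> G x u v = G x v u"
    and pos: "\<And>x u. x \<in> V \<Longrightarrow> u \<noteq> 0 \<Longrightarrow> G x u u > 0"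
    and \<alpha>: "\<And>x. x \<in> V \<Longrightarrow> linear (\<alpha> x)" "\<And>u. smooth_on V (\<lambda>x. \<alpha> x u)"
  obtains a where "smooth_on V a" "\<And>x u. x \<in> V \<Longrightarrow> G x (a x) u = \<alpha> x u"
proof -
  obtain a where a: "smooth_on V a" "\<And>x u. x \<in> V \<Longrightarrow> u \<in> Basis \<Longrightarrow> G x (a x) u = \<alpha> x u"
    using smooth_raise_aux[OF V G _ _ finite_Basis independent_Basis, of \<alpha>] sym pos \<alpha>(2) by metis
  have "G x (a x) u = \<alpha> x u" if x: "x \<in> V" for x u
  proof -
    have "linear (G x (a x))" using smooth_bilinearD(1)[OF G x] by (simp add: bilinear_def)
    from linear_eq_stdbasis[OF this \<alpha>(1)[OF x] a(2)[OF x]] show ?thesis by simp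
  qed
  with a(1) that show ?thesis by blast
qed

section \<open>Pfaffian sums and forms of top degree\<close>

text \<open>The wedge power of a 2-form in terms of the matrix of its values on a family of vectors, so that a
change of frame becomes a change of matrix.\<close>

definition pf_sum :: "nat \<Rightarrow> (nat \<Rightarrow> nat \<Rightarrow> real) \<Rightarrow> real" where
  "pf_sum k a = (1 / 2 ^ k) *
     (\<Sum>\<pi> | \<pi> permutes {..<2*k}. of_int (sign \<pi>) * (\<Prod>i<k. a (\<pi> (2*i)) (\<pi> (2*i+1))))"

lemma wedge_power_pf_sum: "wedge_power k \<psi> v = pf_sum k (\<lambda>i j. \<psi> (v i) (v j))"
  by (simp add: wedge_power_def pf_sum_def)

lemma pf_sum_cong:
  assumes "\<And>i j. i < 2*k \<Longrightarrow> j < 2*k \<Longrightarrow> a i j = b i j"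
  shows "pf_sum k a = pf_sum k b"
proof -
  have "a (\<pi> (2*i)) (\<pi> (2*i+1)) = b (\<pi> (2*i)) (\<pi> (2*i+1))" if "\<pi> permutes {..<2*k}" "i < k" for \<pi> i
    using permutes_in_image[OF that(1), of "2*i"] permutes_in_image[OF that(1), of "2*i+1"] that(2)
    by (intro assms) auto
  then show ?thesis
    unfolding pf_sum_def by (auto intro!: sum.cong prod.cong)
qed

lemma pf_sum_permute:
  assumes "\<rho> permutes {..<2*k}"
  shows "pf_sum k (\<lambda>i j. a (\<rho> i) (\<rho> j)) = of_int (sign \<rho>) * pf_sum k a"
proof -
  let ?t = "\<lambda>\<pi>. of_int (sign \<pi>) * (\<Prod>i<k. a (\<pi> (2*i)) (\<pi> (2*i+1)))"
  have "(\<Sum>\<pi> | \<pi> permutes {..<2*k}. ?t \<pi>) = (\<Sum>\<pi> | \<pi> permutes {..<2*k}. ?t (\<rho> \<circ> \<pi>))"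
    by (rule setum_permutations_compose_left[OF assms])
  also have "\<dots> = of_int (sign \<rho>) *
      (\<Sum>\<pi> | \<pi> permutes {..<2*k}. of_int (sign \<pi>) * (\<Prod>i<k. a (\<rho> (\<pi> (2*i))) (\<rho> (\<pi> (2*i+1)))))"
    unfolding sum_distrib_left
  proof (rule sum.cong)
    fix \<pi> assume "\<pi> \<in> {\<pi>. \<pi> permutes {..<2*k}}"
    then have "sign (\<rho> \<circ> \<pi>) = sign \<rho> * sign \<pi>"
      using assms by (intro sign_compose permutes_imp_permutation[of "{..<2*k}"]) auto
    then show "?t (\<rho> \<circ> \<pi>) = of_int (sign \<rho>) *
        (of_int (sign \<pi>) * (\<Prod>i<k. a (\<rho> (\<pi> (2*i))) (\<rho> (\<pi> (2*i+1)))))"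
      by simp
  qed simp
  finally have "pf_sum k a = of_int (sign \<rho>) * pf_sum k (\<lambda>i j. a (\<rho> i) (\<rho> j))"
    by (simp add: pf_sum_def)
  moreover have "of_int (sign \<rho>) * of_int (sign \<rho>) = (1::real)"
    by (simp add: sign_def)
  ultimately show ?thesis
    by (metis mult.assoc mult_1)
qed

text \<open>The arguments are total sequences, so that changing a vector of a frame is a function update and permuting a
frame is a composition.\<close>

definition alternating_form :: "nat \<Rightarrow> ((nat \<Rightarrow> 'v::real_vector) \<Rightarrow> real) \<Rightarrow> bool" where
  "alternating_form n F \<longleftrightarrow>
     (\<forall>v i. i < n \<longrightarrow> linear (\<lambda>z. F (v(i := z)))) \<and>
     (\<forall>v \<rho>. \<rho> permutes {..<n} \<longrightarrow> F (v \<circ> \<rho>) = of_int (sign \<rho>) * F v) \<and>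
     (\<forall>v w. (\<forall>i<n. v i = w i) \<longrightarrow> F v = F w)"

lemma alternating_formD:
  assumes "alternating_form n F"
  shows "i < n \<Longrightarrow> linear (\<lambda>z. F (v(i := z)))"
    and "\<rho> permutes {..<n} \<Longrightarrow> F (v \<circ> \<rho>) = of_int (sign \<rho>) * F v"
    and "(\<And>i. i < n \<Longrightarrow> v i = w i) \<Longrightarrow> F v = F w"
  using assms unfolding alternating_form_def by blast+

lemma alternating_form_repeated:
  assumes F: "alternating_form n F" and "i < n" "j < n" "i \<noteq> j" "v i = v j"
  shows "F v = 0"
proof -
  have "v \<circ> Transposition.transpose i j = v"
    using assms(5) by (auto simp: Transposition.transpose_def)
  moreover have "F (v \<circ> Transposition.transpose i j) = - F v"
    using alternating_formD(2)[OF F permutes_swap_id, of i j v] assms by (simp add: sign_swap_id)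
  ultimately show ?thesis by simp
qed

text \<open>In the summand belonging to a permutation every vector occurs in exactly one factor, in its first
or in its second slot. This gives multilinearity and, below, the product rule.\<close>

lemma prod_first_slot:
  fixes \<pi> :: "nat \<Rightarrow> nat" and \<psi> :: "'v \<Rightarrow> 'v \<Rightarrow> real"
  assumes "\<pi> permutes {..<2*k}" "l < k"
  shows "(\<Prod>i<k. \<psi> ((v(\<pi> (2*l) := z)) (\<pi> (2*i))) ((v(\<pi> (2*l) := z)) (\<pi> (2*i+1))))
    = \<psi> z (v (\<pi> (2*l+1))) * (\<Prod>i\<in>{..<k} - {l}. \<psi> (v (\<pi> (2*i))) (v (\<pi> (2*i+1)))::real)"
proof -
  have inj: "\<pi> i = \<pi> j \<longleftrightarrow> i = j" for i j
    using permutes_inj[OF assms(1)] by (simp add: inj_eq)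
  have *: "2*i+1 \<noteq> 2*l" "Suc (2*i) \<noteq> 2*l" for i by presburger+
  show ?thesis
    using assms(2) by (subst prod.remove[of _ l]) (auto simp: inj * intro!: prod.cong)
qed

lemma prod_second_slot:
  fixes \<pi> :: "nat \<Rightarrow> nat" and \<psi> :: "'v \<Rightarrow> 'v \<Rightarrow> real"
  assumes "\<pi> permutes {..<2*k}" "l < k"
  shows "(\<Prod>i<k. \<psi> ((v(\<pi> (2*l+1) := z)) (\<pi> (2*i))) ((v(\<pi> (2*l+1) := z)) (\<pi> (2*i+1))))
    = \<psi> (v (\<pi> (2*l))) z * (\<Prod>i\<in>{..<k} - {l}. \<psi> (v (\<pi> (2*i))) (v (\<pi> (2*i+1)))::real)"
proof -
  have inj: "\<pi> i = \<pi> j \<longleftrightarrow> i = j" for i j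
    using permutes_inj[OF assms(1)] by (simp add: inj_eq)
  have *: "2*i \<noteq> 2*l+1" "2*i \<noteq> Suc (2*l)" for i by presburger+
  show ?thesis
    using assms(2) by (subst prod.remove[of _ l]) (auto simp: inj * intro!: prod.cong)
qed

lemma pf_sum_alternating:
  fixes \<psi> :: "'v::real_vector \<Rightarrow> 'v \<Rightarrow> real"
  assumes "bilinear \<psi>"
  shows "alternating_form (2*k) (\<lambda>v. pf_sum k (\<lambda>i j. \<psi> (v i) (v j)))"
  unfolding alternating_form_def
proof (intro conjI allI impI)
  fix v :: "nat \<Rightarrow> 'v" and i assume i: "i < 2*k"
  have lin: "linear (\<lambda>z. \<psi> z y * c)" "linear (\<lambda>z. \<psi> y z * c)" for y c
    using assms by (auto simp: bilinear_def linear_iff algebra_simps)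
  have "linear (\<lambda>z. \<Prod>j<k. \<psi> ((v(i := z)) (\<pi> (2*j))) ((v(i := z)) (\<pi> (2*j+1))))"
    if \<pi>: "\<pi> permutes {..<2*k}" for \<pi>
  proof -
    obtain j where j: "\<pi> j = i" "j < 2*k"
      using permutes_image[OF \<pi>] i by (metis imageE lessThan_iff)
    consider l where "j = 2*l" "l < k" | l where "j = 2*l+1" "l < k"
    proof (cases "even j")
      case True with j that show ?thesis by (auto elim!: evenE)
    next
      case False with j that show ?thesis by (auto elim!: oddE)
    qed
    then show ?thesis
    proof cases
      case 1 with j show ?thesis
        using prod_first_slot[OF \<pi> 1(2), of \<psi> v] lin(1) by auto
    next
      case 2 with j show ?thesis
        using prod_second_slot[OF \<pi> 2(2), of \<psi> v] lin(2) by auto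
    qed
  qed
  then show "linear (\<lambda>z. pf_sum k (\<lambda>ia j. \<psi> ((v(i := z)) ia) ((v(i := z)) j)))"
    unfolding pf_sum_def
    by (intro linear_compose_scale_right[where 'b = real, simplified] linear_compose_sum ballI) auto
next
  fix v :: "nat \<Rightarrow> 'v" and \<rho> :: "nat \<Rightarrow> nat" assume "\<rho> permutes {..<2*k}"
  then show "pf_sum k (\<lambda>i j. \<psi> ((v \<circ> \<rho>) i) ((v \<circ> \<rho>) j)) = of_int (sign \<rho>) * pf_sum k (\<lambda>i j. \<psi> (v i) (v j))"
    using pf_sum_permute[of \<rho> k "\<lambda>i j. \<psi> (v i) (v j)"] by simp
next
  fix v w :: "nat \<Rightarrow> 'v" assume "\<forall>i<2*k. v i = w i"
  then show "pf_sum k (\<lambda>i j. \<psi> (v i) (v j)) = pf_sum k (\<lambda>i j. \<psi> (w i) (w j))"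
    by (intro pf_sum_cong) auto
qed

definition linear_trace :: "('e::euclidean_space \<Rightarrow> 'e) \<Rightarrow> real" where
  "linear_trace L = (\<Sum>i\<in>Basis. L i \<bullet> i)"

text \<open>A linear map acts as a derivation on forms of top degree by its trace: of \<open>L (b i)\<close> only the
component along \<open>b i\<close> contributes, all others repeat an argument.\<close>

lemma alternating_form_trace:
  fixes b :: "nat \<Rightarrow> 'e::euclidean_space"
  assumes F: "alternating_form n F" and b: "bij_betw b {..<n} Basis"
  shows "(\<Sum>i<n. F (b(i := L (b i)))) = linear_trace L * F b"
proof -
  have "F (b(i := L (b i))) = (L (b i) \<bullet> b i) * F b" if i: "i < n" for i
  proof -
    have "F (b(i := L (b i))) = (\<Sum>j\<in>Basis. (L (b i) \<bullet> j) * F (b(i := j)))"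
      using linear_Basis_expand[OF alternating_formD(1)[OF F i], of b "L (b i)"] by simp
    also have "\<dots> = (\<Sum>j\<in>Basis. if j = b i then (L (b i) \<bullet> b i) * F b else 0)"
    proof (rule sum.cong)
      fix j :: 'e assume "j \<in> Basis"
      then obtain k where k: "k < n" "j = b k"
        using b by (auto simp: bij_betw_def)
      show "(L (b i) \<bullet> j) * F (b(i := j)) = (if j = b i then (L (b i) \<bullet> b i) * F b else 0)"
        using alternating_form_repeated[OF F i k(1), of "b(i := j)"] k by auto
    qed simp
    also have "\<dots> = (L (b i) \<bullet> b i) * F b"
      using b i by (auto simp: bij_betw_def)
    finally show ?thesis .
  qed
  then have "(\<Sum>i<n. F (b(i := L (b i)))) = (\<Sum>i<n. (L (b i) \<bullet> b i)) * F b"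
    by (simp add: sum_distrib_right)
  also have "(\<Sum>i<n. (L (b i) \<bullet> b i)) = linear_trace L"
    unfolding linear_trace_def by (rule sum.reindex_bij_betw[OF b])
  finally show ?thesis .
qed

text \<open>The point is that \<open>D\<close>, which is the determinant of \<open>e\<close> with respect to \<open>b\<close>, does not depend on \<open>F\<close>. In the
proof the entries of \<open>e\<close> are replaced by basis vectors one at a time.\<close>

lemma alternating_form_proportional:
  fixes b e :: "nat \<Rightarrow> 'e::euclidean_space"
  assumes b: "bij_betw b {..<n} Basis"
  shows "\<exists>D. \<forall>F. alternating_form n F \<longrightarrow> F e = D * F b"
proof -
  have "\<forall>e. (\<forall>i. k \<le> i \<and> i < n \<longrightarrow> e i \<in> Basis) \<longrightarrow> (\<exists>D. \<forall>F. alternating_form n F \<longrightarrow> F e = D * F b)"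
    if "k \<le> n" for k
    using that
  proof (induction k)
    case 0
    show ?case
    proof (intro allI impI)
      fix e :: "nat \<Rightarrow> 'e" assume "\<forall>i. 0 \<le> i \<and> i < n \<longrightarrow> e i \<in> Basis"
      then have e: "e i \<in> Basis" if "i < n" for i using that by auto
      define f where "f = (\<lambda>i. if i < n then inv_into {..<n} b (e i) else i)"
      have bf: "b (f i) = e i" "f i < n" if "i < n" for i
        using that e[OF that] b bij_betw_inv_into_right[OF b, of "e i"]
          inv_into_into[of "e i" b "{..<n}"]
        by (auto simp: f_def bij_betw_def)
      show "\<exists>D. \<forall>F. alternating_form n F \<longrightarrow> F e = D * F b"
      proof (cases "inj_on f {..<n}")
        case True
        have "f ` {..<n} \<subseteq> {..<n}" using bf by auto
        then have "f permutes {..<n}"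
          using True endo_inj_surj[of "{..<n}" f] by (intro bij_imp_permutes) (auto simp: bij_betw_def f_def)
        then have "F e = of_int (sign f) * F b" if "alternating_form n F" for F
          using alternating_formD(2)[OF that, of f b] alternating_formD(3)[OF that, of "b \<circ> f" e] bf by auto
        then show ?thesis by blast
      next
        case False
        then obtain i j where "i < n" "j < n" "i \<noteq> j" "f i = f j" by (auto simp: inj_on_def)
        then have "F e = 0" if "alternating_form n F" for F
          using alternating_form_repeated[OF that, of i j e] bf by metis
        then show ?thesis by (intro exI[of _ 0]) auto
      qed
    qed
  next
    case (Suc k)
    show ?case
    proof (intro allI impI)
      fix e :: "nat \<Rightarrow> 'e" assume e: "\<forall>i. Suc k \<le> i \<and> i < n \<longrightarrow> e i \<in> Basis"
      have "\<exists>D. \<forall>F. alternating_form n F \<longrightarrow> F (e(k := j)) = D * F b" if "j \<in> Basis" for j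
      proof -
        have "\<forall>i. k \<le> i \<and> i < n \<longrightarrow> (e(k := j)) i \<in> Basis"
          using e that by (metis fun_upd_apply le_neq_implies_less Suc_leI)
        then show ?thesis using Suc.IH Suc.prems by auto
      qed
      then obtain D where D: "\<And>j F. j \<in> Basis \<Longrightarrow> alternating_form n F \<Longrightarrow> F (e(k := j)) = D j * F b"
        by metis
      have "F e = (\<Sum>j\<in>Basis. (e k \<bullet> j) * D j) * F b" if F: "alternating_form n F" for F
      proof -
        have "F (e(k := e k)) = (\<Sum>j\<in>Basis. (e k \<bullet> j) * F (e(k := j)))"
          using linear_Basis_expand[OF alternating_formD(1)[OF F], of k e "e k"] Suc.prems by simp
        then show ?thesis
          using D[OF _ F] by (simp add: sum_distrib_right mult.assoc)
      qed
      then show "\<exists>D. \<forall>F. alternating_form n F \<longrightarrow> F e = D * F b" by blast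
    qed
  qed
  from this[OF order_refl] show ?thesis by (metis leD)
qed

lemma pf_sum_has_derivative:
  assumes "\<And>i j. ((\<lambda>x. a x i j) has_derivative a' i j) (at x)"
  shows "((\<lambda>x. pf_sum k (a x)) has_derivative
    (\<lambda>w. (1 / 2 ^ k) * (\<Sum>\<pi> | \<pi> permutes {..<2*k}. of_int (sign \<pi>) *
       (\<Sum>l<k. a' (\<pi> (2*l)) (\<pi> (2*l+1)) w * (\<Prod>i\<in>{..<k} - {l}. a x (\<pi> (2*i)) (\<pi> (2*i+1))))))) (at x)"
  unfolding pf_sum_def
  by (intro has_derivative_mult_right has_derivative_sum has_derivative_prod assms)

lemma sum_even_odd:
  fixes f :: "nat \<Rightarrow> real"
  shows "(\<Sum>j<2*k. f j) = (\<Sum>l<k. f (2*l) + f (2*l+1))"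
  by (induction k) auto

text \<open>On the left stands the derivative of the pfaffian sum at \<open>\<psi>\<close> in the direction of the form
\<open>\<psi> (L u) v + \<psi> u (L v)\<close>. As \<open>\<psi>\<close> is pulled back infinitesimally by \<open>L\<close>, it is the derivation
induced by \<open>L\<close> applied to a form of top degree.\<close>

lemma pf_derivation_trace:
  fixes \<psi> :: "'e::euclidean_space \<Rightarrow> 'e \<Rightarrow> real"
  assumes "bilinear \<psi>" and b: "bij_betw b {..<2*k} Basis"
  shows "(1 / 2 ^ k) * (\<Sum>\<pi> | \<pi> permutes {..<2*k}. of_int (sign \<pi>) *
       (\<Sum>l<k. (\<psi> (L (b (\<pi> (2*l)))) (b (\<pi> (2*l+1))) + \<psi> (b (\<pi> (2*l))) (L (b (\<pi> (2*l+1)))))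
          * (\<Prod>i\<in>{..<k} - {l}. \<psi> (b (\<pi> (2*i))) (b (\<pi> (2*i+1))))))
    = linear_trace L * pf_sum k (\<lambda>i j. \<psi> (b i) (b j))"
proof -
  let ?t = "\<lambda>\<pi> v. \<Prod>i<k. \<psi> (v (\<pi> (2*i))) (v (\<pi> (2*i+1)))"
  have inner: "(\<Sum>l<k. (\<psi> (L (b (\<pi> (2*l)))) (b (\<pi> (2*l+1))) + \<psi> (b (\<pi> (2*l))) (L (b (\<pi> (2*l+1)))))
          * (\<Prod>i\<in>{..<k} - {l}. \<psi> (b (\<pi> (2*i))) (b (\<pi> (2*i+1)))))
     = (\<Sum>i<2*k. ?t \<pi> (b(i := L (b i))))" if \<pi>: "\<pi> permutes {..<2*k}" for \<pi>
  proof -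
    have "(\<Sum>i<2*k. ?t \<pi> (b(i := L (b i)))) = (\<Sum>j<2*k. ?t \<pi> (b(\<pi> j := L (b (\<pi> j)))))"
      using sum.permute[OF \<pi>, of "\<lambda>i. ?t \<pi> (b(i := L (b i)))"] by (simp add: o_def)
    also have "\<dots> = (\<Sum>l<k. ?t \<pi> (b(\<pi> (2*l) := L (b (\<pi> (2*l))))) + ?t \<pi> (b(\<pi> (2*l+1) := L (b (\<pi> (2*l+1))))))"
      by (rule sum_even_odd)
    finally show ?thesis
      using prod_first_slot[OF \<pi>, of _ \<psi> b] prod_second_slot[OF \<pi>, of _ \<psi> b]
      by (simp add: distrib_right)
  qed
  have "(\<Sum>\<pi> | \<pi> permutes {..<2*k}. of_int (sign \<pi>) *
       (\<Sum>l<k. (\<psi> (L (b (\<pi> (2*l)))) (b (\<pi> (2*l+1))) + \<psi> (b (\<pi> (2*l))) (L (b (\<pi> (2*l+1)))))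
          * (\<Prod>i\<in>{..<k} - {l}. \<psi> (b (\<pi> (2*i))) (b (\<pi> (2*i+1))))))
      = (\<Sum>\<pi> | \<pi> permutes {..<2*k}. of_int (sign \<pi>) * (\<Sum>i<2*k. ?t \<pi> (b(i := L (b i)))))"
    by (rule sum.cong) (simp_all only: inner mem_Collect_eq)
  also have "\<dots> = (\<Sum>i<2*k. \<Sum>\<pi> | \<pi> permutes {..<2*k}. of_int (sign \<pi>) * ?t \<pi> (b(i := L (b i))))"
    by (subst sum.swap) (simp add: sum_distrib_left)
  finally show ?thesis
    using alternating_form_trace[OF pf_sum_alternating[OF assms(1)] b, of L]
    unfolding pf_sum_def by (simp only: sum_distrib_left)
qed

text \<open>An adapted frame consists of pairs \<open>e (2 * k)\<close>, \<open>e (2 * k + 1) = J (e (2 * k))\<close>.\<close>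

definition partner :: "nat \<Rightarrow> nat" where
  "partner i = (if even i then i + 1 else i - 1)"

text \<open>The matrix of \<open>\<omega>\<close> in an adapted frame.\<close>

definition standard_form :: "nat \<Rightarrow> nat \<Rightarrow> real" where
  "standard_form i j = (if j = partner i then if even i then 1 else -1 else 0)"

text \<open>By induction on the number of pairs: the pair at the last position is moved to its place by a
product of two disjoint transpositions, which is even and respects parities; if the pair
stands in the wrong order, it is first reversed, which changes the sign and exactly one factor.\<close>

lemma partner_preserving_sign:
  assumes "\<pi> permutes {..<2*k}" "\<And>i. i < k \<Longrightarrow> \<pi> (2*i+1) = partner (\<pi> (2*i))"
  shows "sign \<pi> * (\<Prod>i<k. if even (\<pi> (2*i)) then 1 else -1) = (1::int)"
  using assms
proof (induction k arbitrary: \<pi>)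
  case 0
  then show ?case by simp
next
  case (Suc k)
  have even_case: "sign \<rho> * (\<Prod>i<Suc k. if even (\<rho> (2*i)) then 1 else -1) = (1::int)"
    if \<rho>: "\<rho> permutes {..<2 * Suc k}" and pair: "\<And>i. i < Suc k \<Longrightarrow> \<rho> (2*i+1) = partner (\<rho> (2*i))"
      and ev: "even (\<rho> (2*k))" for \<rho>
  proof -
    define a where "a = \<rho> (2*k)"
    have a: "even a" "a < 2 * Suc k" "\<rho> (2*k+1) = a + 1"
      using ev pair[of k] permutes_in_image[OF \<rho>, of "2*k"] by (auto simp: a_def partner_def)
    then have a_le: "a \<le> 2*k" by presburger
    let ?s1 = "Transposition.transpose a (2*k)" and ?s2 = "Transposition.transpose (a+1) (2*k+1)"
    define s where "s = ?s1 \<circ> ?s2"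
    have s_vals: "s a = 2*k" "s (a+1) = 2*k+1"
    proof -
      have "Suc a \<noteq> 2*k" "Suc (2*k) \<noteq> a" "a \<noteq> Suc a" using a(1) by presburger+
      then show "s a = 2*k" "s (a+1) = 2*k+1"
        using a_le by (auto simp: s_def Transposition.transpose_def)
    qed
    have parity: "even (s j) \<longleftrightarrow> even j" for j
    proof -
      have "Suc a \<noteq> 2*k" using a(1) by presburger
      then show ?thesis
        using a(1) by (auto simp: s_def Transposition.transpose_def)
    qed
    have s_partner: "s (partner j) = partner (s j)" for j
    proof -
      obtain c where c: "a = 2*c" using a(1) by (auto elim: evenE)
      have ne: "Suc (2*c) \<noteq> 2*k" "Suc (2*k) \<noteq> 2*c" "2*c \<noteq> Suc (2*k)" "2*k \<noteq> Suc (2*c)"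
        by presburger+
      have fixed: "s i = i" if "i \<notin> {2*c, 2*c+1, 2*k, 2*k+1}" for i
        using that by (simp add: s_def c)
      have s_vals': "s (2*c) = 2*k" "s (2*k) = 2*c" "s (2*c+1) = 2*k+1" "s (2*k+1) = 2*c+1"
        using ne by (auto simp: s_def c Transposition.transpose_def)
      have vals: "partner (2*i) = 2*i+1" "partner (2*i+1) = 2*i" for i
        by (simp_all add: partner_def)
      show ?thesis
      proof (cases "j \<in> {2*c, 2*c+1, 2*k, 2*k+1}")
        case True
        then show ?thesis using s_vals' vals by auto
      next
        case False
        then have "partner j \<notin> {2*c, 2*c+1, 2*k, 2*k+1}"
          by (cases "even j") (auto simp: partner_def elim!: evenE oddE)
        then show ?thesis using False fixed by simp
      qed
    qed
    have perm1: "?s1 permutes {..<2 * Suc k}" "?s2 permutes {..<2 * Suc k}"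
      using a_le by (auto intro!: permutes_swap_id)
    then have s_perm: "s permutes {..<2 * Suc k}"
      unfolding s_def by (intro permutes_compose)
    have sign_s: "sign s = 1"
      unfolding s_def by (subst sign_compose) (auto simp: sign_swap_id permutation_swap_id)
    have "s \<circ> \<rho> permutes {..<2 * Suc k}"
      by (rule permutes_compose[OF \<rho> s_perm])
    then have perm': "s \<circ> \<rho> permutes {..<2*k}"
    proof (rule permutes_superset)
      fix j assume "j \<in> {..<2 * Suc k} - {..<2*k}"
      then have "j = 2*k \<or> j = 2*k+1" by auto
      then show "(s \<circ> \<rho>) j = j" using s_vals a a_def by auto
    qed
    have "sign (s \<circ> \<rho>) * (\<Prod>i<k. if even ((s \<circ> \<rho>) (2*i)) then 1 else -1) = (1::int)"
      by (rule Suc.IH[OF perm']) (use pair s_partner in auto)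
    moreover have "sign (s \<circ> \<rho>) = sign \<rho>"
      using sign_compose[of s \<rho>] sign_s permutes_imp_permutation[OF _ \<rho>] permutes_imp_permutation[OF _ s_perm]
      by simp
    ultimately show ?thesis using ev parity by simp
  qed
  show ?case
  proof (cases "even (\<pi> (2*k))")
    case True
    then show ?thesis using even_case[OF Suc.prems] by blast
  next
    case False
    define a where "a = \<pi> (2*k)"
    have a: "odd a" "a < 2 * Suc k" "\<pi> (2*k+1) = a - 1"
      using False Suc.prems(2)[of k] permutes_in_image[OF Suc.prems(1), of "2*k"]
      by (auto simp: a_def partner_def)
    define t where "t = Transposition.transpose a (a - 1)"
    have t_perm: "t permutes {..<2 * Suc k}"
      unfolding t_def using a by (intro permutes_swap_id) auto
    have perm: "t \<circ> \<pi> permutes {..<2 * Suc k}"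
      by (rule permutes_compose[OF Suc.prems(1) t_perm])
    have t_partner: "t (partner j) = partner (t j)" for j
    proof -
      obtain c where c: "a = 2*c+1" using a(1) by (auto elim: oddE)
      show ?thesis
      proof (cases "j = 2*c \<or> j = 2*c+1")
        case True
        then show ?thesis by (auto simp: t_def c partner_def)
      next
        case False
        then have "partner j \<noteq> 2*c \<and> partner j \<noteq> 2*c+1"
          by (cases "even j") (auto simp: partner_def elim!: evenE oddE)
        then show ?thesis using False by (simp add: t_def c)
      qed
    qed
    have inj: "\<pi> i = \<pi> j \<longleftrightarrow> i = j" for i j
      using permutes_inj[OF Suc.prems(1)] by (simp add: inj_eq)
    have fixed: "t (\<pi> (2*i)) = \<pi> (2*i)" if "i < k" for i
    proof -
      have "\<pi> (2*i) \<noteq> \<pi> (2*k)" "\<pi> (2*i) \<noteq> \<pi> (2*k+1)"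
        unfolding inj using that by presburger+
      then show ?thesis
        using a by (simp add: t_def a_def[symmetric] Transposition.transpose_def)
    qed
    have ta: "t (\<pi> (2*k)) = a - 1" "even (a - 1)"
      using a(1) by (auto simp: t_def a_def[symmetric])
    have "sign (t \<circ> \<pi>) * (\<Prod>i<Suc k. if even ((t \<circ> \<pi>) (2*i)) then 1 else -1) = (1::int)"
      by (rule even_case[OF perm]) (use Suc.prems(2) t_partner ta in auto)
    moreover have "sign t = -1"
      using a(1) by (auto simp: t_def sign_swap_id elim!: oddE)
    moreover have "sign (t \<circ> \<pi>) = sign t * sign \<pi>"
      using permutes_imp_permutation[OF _ Suc.prems(1)] permutes_imp_permutation[OF _ t_perm]
      by (intro sign_compose) auto
    moreover have "(\<Prod>i<k. if even ((t \<circ> \<pi>) (2*i)) then 1 else -1) = (\<Prod>i<k. if even (\<pi> (2*i)) then 1 else -1 :: int)"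
      using fixed by (intro prod.cong) auto
    ultimately show ?thesis
      using ta False by simp
  qed
qed

text \<open>By the preceding lemma every nonzero summand is 1.\<close>

lemma pf_sum_standard_form_pos: "pf_sum k standard_form > 0"
proof -
  let ?t = "\<lambda>\<pi>. of_int (sign \<pi>) * (\<Prod>i<k. standard_form (\<pi> (2*i)) (\<pi> (2*i+1)))"
  have nonneg: "?t \<pi> \<ge> 0" if \<pi>: "\<pi> permutes {..<2*k}" for \<pi>
  proof (cases "\<forall>i<k. \<pi> (2*i+1) = partner (\<pi> (2*i))")
    case True
    then have "(\<Prod>i<k. standard_form (\<pi> (2*i)) (\<pi> (2*i+1))) = of_int (\<Prod>i<k. if even (\<pi> (2*i)) then 1 else -1)"
      unfolding of_int_prod by (intro prod.cong) (auto simp: standard_form_def)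
    then have "?t \<pi> = of_int (sign \<pi> * (\<Prod>i<k. if even (\<pi> (2*i)) then 1 else -1))"
      by (simp only: of_int_mult)
    then show ?thesis
      using partner_preserving_sign[OF \<pi>] True by (simp only: of_int_1 zero_le_one)
  next
    case False
    then have "(\<Prod>i<k. standard_form (\<pi> (2*i)) (\<pi> (2*i+1))) = 0"
      by (auto simp: standard_form_def)
    then show ?thesis by (simp only: mult_zero_right order_refl)
  qed
  have id: "?t id = 1"
    by (simp add: standard_form_def partner_def)
  have "?t id \<le> (\<Sum>\<pi> | \<pi> permutes {..<2*k}. ?t \<pi>)"
    by (rule member_le_sum) (use nonneg in \<open>auto simp: permutes_id permutes_id[unfolded id_def] finite_permutations\<close>)
  then show ?thesis
    using id by (simp add: pf_sum_def)
qed

section \<open>Kaehler metrics in a holomorphic chart\<close>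

text \<open>A Kaehler metric in a holomorphic chart: \<open>G\<close> is the metric, \<open>J\<close> the constant complex structure and
\<open>\<Gamma>\<close> the Christoffel symbols of the Levi-Civita connection.\<close>

locale kaehler_chart =
  fixes V :: "'e::euclidean_space set" and G :: "'e \<Rightarrow> 'e \<Rightarrow> 'e \<Rightarrow> real"
    and J :: "'e \<Rightarrow> 'e" and \<Gamma> :: "'e \<Rightarrow> 'e \<Rightarrow> 'e \<Rightarrow> 'e"
  assumes V: "open V"
    and G: "smooth_bilinear V G"
    and G_sym: "x \<in> V \<Longrightarrow> G x u v = G x v u"
    and G_pos: "x \<in> V \<Longrightarrow> u \<noteq> 0 \<Longrightarrow> G x u u > 0"
    and J_linear: "linear J"
    and J_J: "J (J u) = - u"
    and G_J_J: "x \<in> V \<Longrightarrow> G x (J u) (J v) = G x u v"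
    and \<Gamma>_bilinear: "x \<in> V \<Longrightarrow> bilinear (\<Gamma> x)"
    and \<Gamma>_sym: "x \<in> V \<Longrightarrow> \<Gamma> x u v = \<Gamma> x v u"
    and fder_G: "x \<in> V \<Longrightarrow> fder (\<lambda>y. G y u v) x w = G x (\<Gamma> x w u) v + G x u (\<Gamma> x w v)"
    and kaehler_closed: "x \<in> V \<Longrightarrow> fder (\<lambda>y. G y (J u) v) x w + fder (\<lambda>y. G y (J v) w) x u
        + fder (\<lambda>y. G y (J w) u) x v = 0"
begin

lemma G_bilinear: "x \<in> V \<Longrightarrow> bilinear (G x)"
  by (rule smooth_bilinearD[OF G])

lemma G_linear: "x \<in> V \<Longrightarrow> linear (G x u)"
  using G_bilinear by (simp add: bilinear_def)

lemmas G_lin = bilinear_ladd[OF G_bilinear] bilinear_radd[OF G_bilinear]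
  bilinear_lsub[OF G_bilinear] bilinear_rsub[OF G_bilinear]
  bilinear_lneg[OF G_bilinear] bilinear_rneg[OF G_bilinear]
  bilinear_lzero[OF G_bilinear] bilinear_rzero[OF G_bilinear]
  bilinear_lmul[OF G_bilinear] bilinear_rmul[OF G_bilinear]

lemmas J_lin = linear_add[OF J_linear] linear_diff[OF J_linear] linear_neg[OF J_linear]
  linear_0[OF J_linear] linear_scale[OF J_linear] J_J

lemmas \<Gamma>_lin = bilinear_ladd[OF \<Gamma>_bilinear] bilinear_radd[OF \<Gamma>_bilinear]
  bilinear_lneg[OF \<Gamma>_bilinear] bilinear_rneg[OF \<Gamma>_bilinear]
  bilinear_lmul[OF \<Gamma>_bilinear] bilinear_rmul[OF \<Gamma>_bilinear]

lemma G_J_left: "x \<in> V \<Longrightarrow> G x (J u) v = - G x u (J v)"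
  using G_J_J[of x "J u" v] by (simp add: J_J G_lin)

lemma G_J_self: "x \<in> V \<Longrightarrow> G x u (J u) = 0"
  using G_J_left[of x u u] G_sym[of x "J u" u] by simp

lemma G_eqI:
  assumes "x \<in> V" "\<And>v. G x a v = G x b v"
  shows "a = b"
proof -
  have "G x (a - b) (a - b) = 0"
    using assms(2)[of "a - b"] by (simp add: G_lin(3)[OF assms(1)])
  then show ?thesis using G_pos[OF assms(1), of "a - b"] by fastforce
qed

text \<open>The Kaehler condition in a holomorphic chart: \<open>J\<close> is parallel. By Koszul's formula the Christoffel
symbols are combinations of derivatives \<open>D\<close> of the metric, and the assertion is a combination
of the closedness of \<open>\<omega>\<close> on \<open>(u, v, w)\<close> and on \<open>(u, J v, J w)\<close>.\<close>

lemma \<Gamma>_J_right: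
  assumes x: "x \<in> V"
  shows "\<Gamma> x u (J v) = J (\<Gamma> x u v)"
proof (rule G_eqI[OF x])
  fix w
  define D where "D = (\<lambda>a b c. fder (\<lambda>y. G y b c) x a)"
  have koszul: "2 * G x (\<Gamma> x a b) c = D a b c + D b a c - D c a b" for a b c
    unfolding D_def fder_G[OF x] G_sym[OF x, of b "\<Gamma> x c _"] G_sym[OF x, of a "\<Gamma> x _ c"]
      G_sym[OF x, of b "\<Gamma> x _ c"] G_sym[OF x, of a "\<Gamma> x c _"]
    using \<Gamma>_sym[OF x] G_sym[OF x] by simp
  have D_sym: "D a b c = D a c b" for a b c
    using fder_cong[OF V x, of "\<lambda>y. G y b c" "\<lambda>y. G y c b"] G_sym by (simp add: D_def)
  have closed: "D w (J u) v + D u (J v) w + D v (J w) u = 0" for u v w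
    using kaehler_closed[OF x, of u v w] unfolding D_def .
  have D_neg: "D a (- b) c = - D a b c" for a b c
    by (simp add: D_def fder_G[OF x] \<Gamma>_lin[OF x] G_lin[OF x])
  have skew: "D w (J u) v = - D w u (J v)" for u v w
  proof -
    have "fder (\<lambda>y. G y (J u) v) x w = fder (\<lambda>y. G y (- u) (J v)) x w"
      using fder_cong[OF V x, of "\<lambda>y. G y (J u) v" "\<lambda>y. G y (- u) (J v)"] G_J_left G_lin by simp
    then show ?thesis using D_neg by (simp add: D_def)
  qed
  have invariant: "D w (J u) (J v) = D w u v" for u v w
    using skew[of w u "J v"] D_sym D_neg by (simp add: J_J)
  \<comment> \<open>Koszul turns the left-hand side into six derivatives of the metric.\<close>
  have "2 * G x (\<Gamma> x u (J v)) w + 2 * G x (\<Gamma> x u v) (J w) = 0"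
    unfolding koszul
    using closed[of w u v] closed[of "J w" u "J v"] skew[of w u v] skew[of u v w] skew[of u w v]
      invariant[of "J w" u v] D_neg D_sym by (simp add: J_J)
  then show "G x (\<Gamma> x u (J v)) w = G x (J (\<Gamma> x u v)) w"
    using G_J_left[OF x] by simp
qed

lemma \<Gamma>_J_left: "x \<in> V \<Longrightarrow> \<Gamma> x (J u) v = J (\<Gamma> x u v)"
  using \<Gamma>_J_right \<Gamma>_sym by metis

definition cov_deriv :: "('e \<Rightarrow> 'e) \<Rightarrow> 'e \<Rightarrow> 'e \<Rightarrow> 'e" where
  "cov_deriv a x w = fder a x w + \<Gamma> x w (a x)"

lemma fder_J: "a differentiable (at x) \<Longrightarrow> fder (\<lambda>y. J (a y)) x w = J (fder a x w)"
  by (rule fder_bounded_linear) (use J_linear in \<open>simp add: linear_conv_bounded_linear\<close>)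

lemma differentiable_J: "a differentiable (at x) \<Longrightarrow> (\<lambda>y. J (a y)) differentiable (at x)"
  by (rule differentiable_compose[of J])
    (use J_linear in \<open>auto intro: linear_imp_differentiable\<close>)

lemma cov_deriv_J:
  assumes "x \<in> V" "a differentiable (at x)"
  shows "cov_deriv (\<lambda>y. J (a y)) x w = J (cov_deriv a x w)"
  using assms by (simp add: cov_deriv_def fder_J \<Gamma>_J_right J_lin)

lemma fder_pairing:
  assumes x: "x \<in> V" and "a differentiable (at x)" "b differentiable (at x)"
  shows "fder (\<lambda>y. G y (a y) (b y)) x w = G x (cov_deriv a x w) (b x) + G x (a x) (cov_deriv b x w)"
  unfolding fder_eq[OF fder_smooth_bilinear[OF V G x assms(2,3)]] fder_G[OF x]
  by (simp add: cov_deriv_def G_lin[OF x])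

definition raise :: "'e \<Rightarrow> ('e \<Rightarrow> real) \<Rightarrow> 'e" where
  "raise x \<alpha> = (THE a. \<forall>v. G x a v = \<alpha> v)"

lemma raise_eqI:
  assumes "x \<in> V" "\<And>v. G x a v = \<alpha> v"
  shows "raise x \<alpha> = a"
  unfolding raise_def by (rule the_equality) (use assms G_eqI[OF assms(1)] in auto)

lemma raise_field:
  assumes "\<And>x. x \<in> V \<Longrightarrow> linear (\<alpha> x)" "\<And>u. smooth_on V (\<lambda>x. \<alpha> x u)"
  shows "smooth_on V (\<lambda>x. raise x (\<alpha> x))" "x \<in> V \<Longrightarrow> G x (raise x (\<alpha> x)) u = \<alpha> x u"
proof -
  obtain a where a: "smooth_on V a" "\<And>x u. x \<in> V \<Longrightarrow> G x (a x) u = \<alpha> x u"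
    using smooth_raise[OF V G, of \<alpha>] G_sym G_pos assms by metis
  have r: "raise x (\<alpha> x) = a x" if "x \<in> V" for x
    using raise_eqI[OF that] a(2)[OF that] by blast
  show "smooth_on V (\<lambda>x. raise x (\<alpha> x))"
    by (rule smooth_on_cong[OF V, THEN iffD1, OF _ a(1)]) (rule r[symmetric])
  show "G x (raise x (\<alpha> x)) u = \<alpha> x u" if "x \<in> V"
    using r[OF that] a(2)[OF that] by simp
qed

definition gradient :: "('e \<Rightarrow> real) \<Rightarrow> 'e \<Rightarrow> 'e" where
  "gradient f x = raise x (fder f x)"

lemma gradient:
  assumes "smooth_on V f"
  shows grd_smooth: "smooth_on V (gradient f)" and G_grd: "x \<in> V \<Longrightarrow> G x (gradient f x) u = fder f x u"
  using raise_field[of "fder f"] smooth_on_fder[OF assms]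
    fder_linear[OF smooth_on_differentiable[OF assms]]
  unfolding gradient_def[abs_def] by blast+

text \<open>In constant directions the Hessian is the matrix of second derivatives, corrected by a symmetric term.\<close>

lemma hessian_symmetric:
  assumes f: "smooth_on V f" and x: "x \<in> V"
  shows "G x (cov_deriv (gradient f) x u) v = G x (cov_deriv (gradient f) x v) u"
proof -
  have d: "gradient f differentiable (at x)"
    by (rule smooth_on_differentiable[OF grd_smooth[OF f] x])
  have "G x (cov_deriv (gradient f) x u) v + G x (gradient f x) (\<Gamma> x u v) = fder (\<lambda>y. fder f y v) x u" for u v
  proof -
    have "fder (\<lambda>y. G y (gradient f y) v) x u = G x (cov_deriv (gradient f) x u) v + G x (gradient f x) (cov_deriv (\<lambda>y. v) x u)"
      by (rule fder_pairing[OF x d]) simp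
    moreover have "fder (\<lambda>y. G y (gradient f y) v) x = fder (\<lambda>y. fder f y v) x"
      by (rule fder_cong[OF V x]) (rule G_grd[OF f])
    ultimately show ?thesis by (simp add: cov_deriv_def)
  qed
  from this[of u v] this[of v u] show ?thesis
    using second_derivative_symmetric_real[OF V x f, of u v] \<Gamma>_sym[OF x, of u v] by simp
qed

text \<open>The Lie derivative of \<open>B\<close> along \<open>X\<close>, evaluated on the constant fields \<open>u\<close> and \<open>v\<close>, whose brackets with \<open>X\<close>
are the negatives of the derivatives of \<open>X\<close>.\<close>

definition lie_form :: "('e \<Rightarrow> 'e) \<Rightarrow> ('e \<Rightarrow> 'e \<Rightarrow> 'e \<Rightarrow> real) \<Rightarrow> 'e \<Rightarrow> 'e \<Rightarrow> 'e \<Rightarrow> real" where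
  "lie_form X B x u v = fder (\<lambda>y. B y u v) x (X x) + B x (fder X x u) v + B x u (fder X x v)"

lemma lie_metric:
  assumes x: "x \<in> V" and a: "a differentiable (at x)"
  shows "lie_form (\<lambda>y. J (a y)) G x u v = - G x (cov_deriv a x v) (J u) - G x (cov_deriv a x u) (J v)"
proof -
  have "lie_form (\<lambda>y. J (a y)) G x u v = G x (J (cov_deriv a x u)) v + G x u (J (cov_deriv a x v))"
    using \<Gamma>_sym[OF x] by (simp add: lie_form_def fder_G[OF x] fder_J[OF a] cov_deriv_def J_lin G_lin[OF x] \<Gamma>_J_right[OF x])
  then show ?thesis
    using G_J_left[OF x] G_sym[OF x, of u "J (cov_deriv a x v)"] by simp
qed

text \<open>The Lie derivative of the metric along \<open>J\<close> times a gradient is twice the symmetric part of \<open>J\<close> times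
the Hessian; since the Hessian \<open>S\<close> is symmetric and \<open>J\<close> is skew, it vanishes exactly if \<open>J S = S J\<close>.\<close>

lemma killing_iff:
  assumes f: "smooth_on V f" and x: "x \<in> V"
  shows "(\<forall>u v. lie_form (\<lambda>y. J (gradient f y)) G x u v = 0) \<longleftrightarrow> (\<forall>w. cov_deriv (gradient f) x (J w) = J (cov_deriv (gradient f) x w))"
proof -
  have d: "gradient f differentiable (at x)"
    by (rule smooth_on_differentiable[OF grd_smooth[OF f] x])
  have "lie_form (\<lambda>y. J (gradient f y)) G x u v = G x (J (cov_deriv (gradient f) x v) - cov_deriv (gradient f) x (J v)) u" for u v
    unfolding lie_metric[OF x d] G_lin(3)[OF x] G_J_left[OF x]
    using hessian_symmetric[OF f x, of "J v" u] G_sym[OF x] by simp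
  then show ?thesis
    using G_eqI[OF x, of "J (cov_deriv (gradient f) x _)"] by (auto simp: G_lin[OF x])
qed

end

context kaehler_chart
begin

text \<open>Through the auxiliary inner product of the model space the conditions become orthogonality to fewer than
\<open>DIM('e)\<close> vectors.\<close>

lemma orthogonal_vector_exists:
  assumes x: "x \<in> V" and "n < DIM('e)"
  obtains w where "w \<noteq> 0" "\<And>i. i < n \<Longrightarrow> G x (e i) w = 0"
proof -
  \<comment> \<open>The map \<open>r\<close> turns \<open>G\<close> into the inner product of the model space.\<close>
  define r where "r = (\<lambda>a. \<Sum>i\<in>Basis. G x a i *\<^sub>R i)"
  have r: "r a \<bullet> v = G x a v" for a v
    using linear_Basis_expand[OF G_linear[OF x], of a v]
    by (simp add: r_def inner_sum_left inner_sum_right inner_commute mult.commute)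
  have "dim (r ` e ` {..<n}) \<le> card (r ` e ` {..<n})"
    by (rule dim_le_card') simp
  also have "\<dots> \<le> n"
    using card_image_le[of "{..<n}" "r \<circ> e"] by (simp add: image_comp)
  also note assms(2)
  finally obtain w where w: "w \<noteq> 0" "\<And>y. y \<in> span (r ` e ` {..<n}) \<Longrightarrow> orthogonal w y"
    using orthogonal_to_subspace_exists[of "r ` e ` {..<n}"] by metis
  have "G x (e i) w = 0" if "i < n" for i
  proof -
    have "orthogonal w (r (e i))" using that by (intro w(2) span_base) auto
    then show ?thesis using r[of "e i" w] by (simp add: orthogonal_def inner_commute)
  qed
  with w(1) that show ?thesis by blast
qed

definition adapted :: "nat \<Rightarrow> 'e \<Rightarrow> (nat \<Rightarrow> 'e) \<Rightarrow> bool" where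
  "adapted k x e \<longleftrightarrow> (\<forall>i<2*k. \<forall>j<2*k. G x (e i) (e j) = (if i = j then 1 else 0)) \<and>
     (\<forall>i<k. e (2*i+1) = J (e (2*i)))"

lemma adapted_exists:
  assumes x: "x \<in> V" and "2 * k \<le> DIM('e)"
  shows "\<exists>e. adapted k x e"
  using assms(2)
proof (induction k)
  case 0
  show ?case by (simp add: adapted_def)
next
  case (Suc k)
  then obtain e where e: "adapted k x e" by auto
  obtain u where u: "u \<noteq> 0" "\<And>i. i < 2*k \<Longrightarrow> G x (e i) u = 0"
    using orthogonal_vector_exists[OF x, of "2*k" e] Suc.prems by auto
  define w where "w = (1 / sqrt (G x u u)) *\<^sub>R u"
  have w: "G x w w = 1" "\<And>i. i < 2*k \<Longrightarrow> G x (e i) w = 0"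
    using u G_pos[OF x u(1)] by (auto simp: w_def G_lin[OF x])
  have Jw: "G x (e i) (J w) = 0" if "i < 2*k" for i
  proof (cases "even i")
    case True
    then obtain l where l: "i = 2*l" by (auto elim: evenE)
    then have "J (e i) = e (i+1)" "i + 1 < 2*k" using e that by (auto simp: adapted_def)
    then show ?thesis using w(2)[of "i+1"] G_J_left[OF x, of "e i" w] by simp
  next
    case False
    then obtain l where l: "i = 2*l+1" by (auto elim: oddE)
    then have "e i = J (e (2*l))" "2*l < 2*k" using e that by (auto simp: adapted_def)
    then show ?thesis using w(2)[of "2*l"] G_J_J[OF x, of "e (2*l)" w] by simp
  qed
  define e' where "e' = e(2*k := w, 2*k+1 := J w)"
  have old: "e' i = e i" if "i < 2*k" for i using that by (simp add: e'_def)
  have new: "e' (2*k) = w" "e' (2*k+1) = J w" by (simp_all add: e'_def)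
  have "adapted (Suc k) x e'"
    unfolding adapted_def
  proof (intro conjI allI impI)
    have cases: "i < 2*k \<or> i = 2*k \<or> i = 2*k+1" if "i < 2 * Suc k" for i using that by auto
    fix i j assume ij: "i < 2 * Suc k" "j < 2 * Suc k"
    have ee: "G x (e i) (e j) = (if i = j then 1 else 0)" if "i < 2*k" "j < 2*k"
      using e that by (simp add: adapted_def)
    show "G x (e' i) (e' j) = (if i = j then 1 else 0)"
      using cases[OF ij(1)] cases[OF ij(2)] ee w Jw G_J_J[OF x, of w w] G_J_self[OF x, of w] G_sym[OF x]
      by (elim disjE) (simp_all add: old new[simplified] new G_J_left[OF x] J_J G_lin[OF x])
  next
    fix i assume i: "i < Suc k"
    show "e' (2*i+1) = J (e' (2*i))"
    proof (cases "i < k")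
      case True
      then show ?thesis using e old[of "2*i"] old[of "2*i+1"] by (simp add: adapted_def)
    next
      case False
      then have "i = k" using i by simp
      then show ?thesis using new by simp
    qed
  qed
  then show ?case by blast
qed

lemma adapted_kaehler_form:
  assumes x: "x \<in> V" and e: "adapted k x e" and "i < 2*k" "j < 2*k"
  shows "G x (J (e i)) (e j) = standard_form i j"
proof (cases "even i")
  case True
  then obtain l where l: "i = 2*l" by (auto elim: evenE)
  then have "J (e i) = e (i+1)" "i + 1 < 2*k" using e assms by (auto simp: adapted_def)
  then show ?thesis using e assms True by (auto simp: adapted_def standard_form_def partner_def)
next
  case False
  then obtain l where l: "i = 2*l+1" by (auto elim: oddE)
  then have "e i = J (e (2*l))" "2*l < 2*k" using e assms by (auto simp: adapted_def)
  then have "J (e i) = - e (2*l)" by (simp add: J_J)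
  then show ?thesis using e assms False l \<open>2*l < 2*k\<close>
    by (auto simp: adapted_def standard_form_def partner_def G_lin[OF x])
qed

end

section \<open>Hamiltonian 2-forms in a holomorphic chart\<close>

text \<open>The components of a hamiltonian 2-form in a holomorphic chart.\<close>

locale hamiltonian_chart = kaehler_chart V G J \<Gamma>
  for V :: "'e::euclidean_space set" and G J \<Gamma> +
  fixes \<phi> :: "'e \<Rightarrow> 'e \<Rightarrow> 'e \<Rightarrow> real" and \<sigma> :: "'e \<Rightarrow> real" and m :: nat
  assumes \<phi>: "smooth_bilinear V \<phi>"
    and \<phi>_skew: "x \<in> V \<Longrightarrow> \<phi> x u v = - \<phi> x v u"
    and \<phi>_J_J: "x \<in> V \<Longrightarrow> \<phi> x (J u) (J v) = \<phi> x u v"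
    and \<sigma>: "smooth_on V \<sigma>"
    and dim: "DIM('e) = 2 * m"
    and hamiltonian: "x \<in> V \<Longrightarrow>
        fder (\<lambda>y. \<phi> y u v) x w - \<phi> x (\<Gamma> x w u) v - \<phi> x u (\<Gamma> x w v) =
        1/2 * ((fder \<sigma> x u * G x (J w) v - fder \<sigma> x v * G x (J w) u)
             - (- fder \<sigma> x (J u) * G x w v + fder \<sigma> x (J v) * G x w u))"
    and killing_potential: "m = 1 \<Longrightarrow> x \<in> V \<Longrightarrow> lie_form (\<lambda>y. J (gradient \<sigma> y)) G x u v = 0"
begin

abbreviation \<xi> where "\<xi> \<equiv> gradient \<sigma>"

lemma \<xi>_smooth: "smooth_on V \<xi>" and G_\<xi>: "x \<in> V \<Longrightarrow> G x (\<xi> x) u = fder \<sigma> x u"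
  using gradient[OF \<sigma>] by auto

lemma \<xi>_differentiable: "x \<in> V \<Longrightarrow> \<xi> differentiable (at x)"
  by (rule smooth_on_differentiable[OF \<xi>_smooth])

lemma \<phi>_bilinear: "x \<in> V \<Longrightarrow> bilinear (\<phi> x)"
  by (rule smooth_bilinearD[OF \<phi>])

lemmas \<phi>_lin = bilinear_ladd[OF \<phi>_bilinear] bilinear_radd[OF \<phi>_bilinear]
  bilinear_lsub[OF \<phi>_bilinear] bilinear_rsub[OF \<phi>_bilinear]
  bilinear_lneg[OF \<phi>_bilinear] bilinear_rneg[OF \<phi>_bilinear]
  bilinear_lmul[OF \<phi>_bilinear] bilinear_rmul[OF \<phi>_bilinear]

lemma fder_\<phi>:
  assumes x: "x \<in> V"
  shows "fder (\<lambda>y. \<phi> y u v) x w = \<phi> x (\<Gamma> x w u) v + \<phi> x u (\<Gamma> x w v)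
    + 1/2 * (G x (\<xi> x) u * G x (J w) v - G x (\<xi> x) v * G x (J w) u
      + G x (\<xi> x) (J u) * G x w v - G x (\<xi> x) (J v) * G x w u)"
  using hamiltonian[OF x, of u v w] by (simp add: G_\<xi>[OF x] algebra_simps)

text \<open>The endomorphism \<open>\<Phi>\<close> with \<open>\<phi> x u v = G x (J (\<Phi> x u)) v\<close>.\<close>

definition \<Phi> :: "'e \<Rightarrow> 'e \<Rightarrow> 'e" where
  "\<Phi> x u = raise x (\<lambda>v. \<phi> x u (J v))"

lemma \<Phi>_smooth: "smooth_on V (\<lambda>x. \<Phi> x u)" and G_\<Phi>: "x \<in> V \<Longrightarrow> G x (\<Phi> x u) v = \<phi> x u (J v)"
proof -
  have "linear (\<lambda>v. \<phi> x u (J v))" if "x \<in> V" for x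
    using linear_compose[OF J_linear, of "\<phi> x u"] \<phi>_bilinear[OF that] by (simp add: bilinear_def o_def)
  then show "smooth_on V (\<lambda>x. \<Phi> x u)" "x \<in> V \<Longrightarrow> G x (\<Phi> x u) v = \<phi> x u (J v)"
    using raise_field[of "\<lambda>x v. \<phi> x u (J v)"] smooth_bilinearD(2)[OF \<phi>] unfolding \<Phi>_def by blast+
qed

lemma \<Phi>_linear:
  assumes x: "x \<in> V"
  shows "linear (\<Phi> x)"
proof (rule linearI)
  show "\<Phi> x (a + b) = \<Phi> x a + \<Phi> x b" for a b
    by (rule G_eqI[OF x]) (simp add: G_\<Phi>[OF x] G_lin[OF x] \<phi>_lin[OF x])
  show "\<Phi> x (c *\<^sub>R a) = c *\<^sub>R \<Phi> x a" for c a
    by (rule G_eqI[OF x]) (simp add: G_\<Phi>[OF x] G_lin[OF x] \<phi>_lin[OF x])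
qed

lemma \<phi>_J_left: "x \<in> V \<Longrightarrow> \<phi> x (J u) v = - \<phi> x u (J v)"
  using \<phi>_J_J[of x "J u" v] by (simp add: J_J \<phi>_lin)

lemma \<Phi>_symmetric: "x \<in> V \<Longrightarrow> G x (\<Phi> x u) v = G x (\<Phi> x v) u"
  using \<phi>_J_left[of x u v] \<phi>_skew[of x "J u" v] by (simp add: G_\<Phi>)

lemma \<Phi>_J:
  assumes x: "x \<in> V"
  shows "\<Phi> x (J u) = J (\<Phi> x u)"
  by (rule G_eqI[OF x]) (simp add: G_J_left[OF x] G_\<Phi>[OF x] \<phi>_J_left[OF x] J_J \<phi>_lin[OF x])

text \<open>The hamiltonian equation for the endomorphism: the first two terms are the correction by the Christoffel symbols, the
last one is the covariant derivative of \<open>\<Phi>\<close>.\<close>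

lemma fder_\<Phi>:
  assumes x: "x \<in> V"
  shows "fder (\<lambda>y. \<Phi> y u) x w = \<Phi> x (\<Gamma> x w u) - \<Gamma> x w (\<Phi> x u)
    + (1/2) *\<^sub>R (G x (\<xi> x) u *\<^sub>R w + G x w u *\<^sub>R \<xi> x + G x (J w) u *\<^sub>R J (\<xi> x) + G x (J (\<xi> x)) u *\<^sub>R J w)"
proof (rule G_eqI[OF x])
  fix v
  have d: "(\<lambda>y. \<Phi> y u) differentiable (at x)"
    by (rule smooth_on_differentiable[OF \<Phi>_smooth x])
  have "fder (\<lambda>y. \<phi> y u (J v)) x w = fder (\<lambda>y. G y (\<Phi> y u) v) x w"
    using fder_cong[OF V x, of "\<lambda>y. \<phi> y u (J v)" "\<lambda>y. G y (\<Phi> y u) v"] G_\<Phi> by simp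
  also have "\<dots> = G x (cov_deriv (\<lambda>y. \<Phi> y u) x w) v + G x (\<Phi> x u) (cov_deriv (\<lambda>y. v) x w)"
    by (rule fder_pairing[OF x d]) simp
  finally have "G x (fder (\<lambda>y. \<Phi> y u) x w) v = fder (\<lambda>y. \<phi> y u (J v)) x w
      - G x (\<Gamma> x w (\<Phi> x u)) v - G x (\<Phi> x u) (\<Gamma> x w v)"
    by (simp add: cov_deriv_def G_lin[OF x])
  then show "G x (fder (\<lambda>y. \<Phi> y u) x w) v = G x (\<Phi> x (\<Gamma> x w u) - \<Gamma> x w (\<Phi> x u)
    + (1/2) *\<^sub>R (G x (\<xi> x) u *\<^sub>R w + G x w u *\<^sub>R \<xi> x + G x (J w) u *\<^sub>R J (\<xi> x) + G x (J (\<xi> x)) u *\<^sub>R J w)) v"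
    by (simp add: fder_\<phi>[OF x] G_\<Phi>[OF x] \<Gamma>_J_right[OF x] G_lin[OF x] G_J_left[OF x] J_J algebra_simps)
qed

text \<open>Up to a factor, the derivative in the direction of the \<open>(0,1)\<close>-part of \<open>w\<close>. Because the Christoffel symbols are complex
bilinear, they cancel in it, so that it can replace the covariant derivative.\<close>

definition dbar :: "('e \<Rightarrow> 'e) \<Rightarrow> 'e \<Rightarrow> 'e \<Rightarrow> 'e" where
  "dbar a x w = fder a x w + J (fder a x (J w))"

lemma dbar_dbar_symmetric:
  assumes a: "smooth_on V a" and x: "x \<in> V"
  shows "dbar (\<lambda>y. dbar a y w) x z = dbar (\<lambda>y. dbar a y z) x w"
proof -
  have d: "(\<lambda>y. fder a y w) differentiable (at x)" for w
    by (rule smooth_on_differentiable[OF smooth_on_fder[OF a] x])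
  have "fder (\<lambda>y. dbar a y w) x z = fder (\<lambda>y. fder a y w) x z + J (fder (\<lambda>y. fder a y (J w)) x z)" for w z
    unfolding dbar_def
    by (subst fder_eq[OF has_derivative_add[OF fder_has[OF d] fder_has[OF differentiable_J[OF d]]]])
      (simp add: fder_J[OF d])
  then show ?thesis
    unfolding dbar_def[of _ x]
    by (simp add: J_lin second_derivative_symmetric[OF V x a, of _ w]
        second_derivative_symmetric[OF V x a, of _ "J w"])
qed

lemma dbar_\<Phi>:
  assumes x: "x \<in> V"
  shows "dbar (\<lambda>y. \<Phi> y u) x w = G x w u *\<^sub>R \<xi> x + G x (J w) u *\<^sub>R J (\<xi> x)"
proof -
  have half: "(c/2) *\<^sub>R a + (c/2) *\<^sub>R a = c *\<^sub>R a" for c and a :: 'e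
    by (simp flip: scaleR_left_distrib)
  show ?thesis
    unfolding dbar_def fder_\<Phi>[OF x]
    apply (simp add: J_lin \<Phi>_J[OF x] \<Gamma>_J_left[OF x] G_J_left[OF x] G_lin[OF x] scaleR_add_right)
    by (simp add: half algebra_simps)
qed

text \<open>The terms with \<open>\<Gamma>\<close> are symmetric in \<open>z\<close> and \<open>w\<close>; they drop out below.\<close>

lemma dbar_metric_combination:
  assumes x: "x \<in> V" and a: "a differentiable (at x)"
  shows "dbar (\<lambda>y. G y w u *\<^sub>R a y + G y (J w) u *\<^sub>R J (a y)) x z
    = (2 * G x (\<Gamma> x z w) u) *\<^sub>R a x + (2 * G x (J (\<Gamma> x z w)) u) *\<^sub>R J (a x)
      + G x w u *\<^sub>R dbar a x z + G x (J w) u *\<^sub>R J (dbar a x z)"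
proof -
  have dG: "((\<lambda>y. G y w u) has_derivative (\<lambda>z. G x (\<Gamma> x z w) u + G x w (\<Gamma> x z u))) (at x)" for w
  proof -
    have "fder (\<lambda>y. G y w u) x = (\<lambda>z. G x (\<Gamma> x z w) u + G x w (\<Gamma> x z u))"
      by (rule ext) (rule fder_G[OF x])
    then show ?thesis
      using smooth_on_has_derivative[OF smooth_bilinearD(2)[OF G] x, of w u] by (simp only:)
  qed
  have f: "fder (\<lambda>y. G y w u *\<^sub>R a y + G y (J w) u *\<^sub>R J (a y)) x z
    = (G x w u *\<^sub>R fder a x z + (G x (\<Gamma> x z w) u + G x w (\<Gamma> x z u)) *\<^sub>R a x)
      + (G x (J w) u *\<^sub>R J (fder a x z) + (G x (\<Gamma> x z (J w)) u + G x (J w) (\<Gamma> x z u)) *\<^sub>R J (a x))" for z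
    by (subst fder_eq[OF has_derivative_add[OF has_derivative_scaleR[OF dG fder_has[OF a]]
          has_derivative_scaleR[OF dG fder_has[OF differentiable_J[OF a]]]]]) (simp add: fder_J[OF a])
  have double: "(2 * c) *\<^sub>R a = c *\<^sub>R a + c *\<^sub>R a" for c and a :: 'e
    by (simp flip: scaleR_left_distrib)
  show ?thesis
    unfolding dbar_def f double
    by (simp add: J_lin \<Gamma>_J_left[OF x] \<Gamma>_J_right[OF x] G_J_left[OF x] G_lin[OF x] algebra_simps)
qed

text \<open>For \<open>m > 1\<close>: applying \<open>dbar\<close> to \<open>dbar_\<Phi>\<close> and using the symmetry of the iterated operator gives
\<open>G w u (dbar\<^sub>z \<xi>) + G (J w) u J (dbar\<^sub>z \<xi>) = G z u (dbar\<^sub>w \<xi>) + G (J z) u J (dbar\<^sub>w \<xi>)\<close>. With \<open>w\<close>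
orthogonal to \<open>z\<close> and \<open>J z\<close>, which exists in real dimension at least four, and \<open>u = w\<close>, only a nonzero multiple
of \<open>dbar\<^sub>z \<xi>\<close> is left.\<close>

lemma \<xi>_holomorphic:
  assumes x: "x \<in> V"
  shows "cov_deriv \<xi> x (J z) = J (cov_deriv \<xi> x z)"
proof (cases "m = 1")
  case True
  then show ?thesis
    using killing_potential[OF True x] killing_iff[OF \<sigma> x] by blast
next
  case False
  have "m > 0" using dim DIM_positive[where 'a = 'e] by simp
  with False have "2 < DIM('e)" using dim by simp
  obtain w where "w \<noteq> 0" and perp: "\<And>i::nat. i < 2 \<Longrightarrow> G x (if i = 0 then z else J z) w = 0"
    by (rule orthogonal_vector_exists[OF x \<open>2 < DIM('e)\<close>, where e = "\<lambda>i. if i = 0 then z else J z"])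
      (rule that, assumption, assumption)
  then have w: "w \<noteq> 0" "G x z w = 0" "G x (J z) w = 0"
    using perp[of 0] perp[of 1] by simp_all
  have "dbar (\<lambda>y. dbar (\<lambda>y. \<Phi> y w) y v) x u
      = (2 * G x (\<Gamma> x u v) w) *\<^sub>R \<xi> x + (2 * G x (J (\<Gamma> x u v)) w) *\<^sub>R J (\<xi> x)
        + G x v w *\<^sub>R dbar \<xi> x u + G x (J v) w *\<^sub>R J (dbar \<xi> x u)" for u v
  proof -
    have "fder (\<lambda>y. dbar (\<lambda>y. \<Phi> y w) y v) x = fder (\<lambda>y. G y v w *\<^sub>R \<xi> y + G y (J v) w *\<^sub>R J (\<xi> y)) x"
      by (rule fder_cong[OF V x]) (rule dbar_\<Phi>)
    then show ?thesis
      using dbar_metric_combination[OF x \<xi>_differentiable[OF x], of v w u] by (simp add: dbar_def)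
  qed
  from this[of w z] this[of z w] dbar_dbar_symmetric[OF \<Phi>_smooth x, of w w z]
  have "G x w w *\<^sub>R dbar \<xi> x z + G x (J w) w *\<^sub>R J (dbar \<xi> x z)
      = G x z w *\<^sub>R dbar \<xi> x w + G x (J z) w *\<^sub>R J (dbar \<xi> x w)"
    using \<Gamma>_sym[OF x, of w z] by (simp add: add.assoc)
  then have "dbar \<xi> x z = 0"
    using w G_pos[OF x w(1)] G_J_left[OF x, of w w] G_J_self[OF x, of w] by simp
  then have "J (dbar \<xi> x z) = 0" by (simp add: J_lin)
  then show ?thesis
    by (simp add: dbar_def cov_deriv_def J_lin \<Gamma>_J_left[OF x])
qed

end

section \<open>The momentum polynomial in a holomorphic chart\<close>

text \<open>This is how identities proved with the resolvent, for large \<open>t\<close>, extend to all \<open>t\<close>.\<close>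

lemma real_polynomial_zero:
  fixes f :: "real \<Rightarrow> real"
  assumes "real_polynomial_function f" "\<And>t. t > c \<Longrightarrow> f t = 0"
  shows "f t = 0"
proof -
  obtain a n where f: "f = (\<lambda>t. \<Sum>i\<le>n. a i * t ^ i)"
    using assms(1) real_polynomial_function_iff_sum by blast
  have "{c<..} \<subseteq> {t. (\<Sum>i\<le>n. a i * t ^ i) = 0}"
    using assms(2) f by auto
  then have "infinite {t. (\<Sum>i\<le>n. a i * t ^ i) = 0}"
    using infinite_Ioi finite_subset by blast
  then have "\<forall>i\<le>n. a i = 0"
    using polyfun_finite_roots[of a n] by blast
  then show ?thesis using f by simp
qed

lemma real_polynomial_monomial: "real_polynomial_function (\<lambda>t. t ^ n * c)"
  by (intro real_polynomial_function.intros(4) real_polynomial_function_power real_polynomial_function.intros(2)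
      real_polynomial_function.intros(1) bounded_linear_ident)

lemma eventually_not_eigenvalue:
  fixes L :: "'e::euclidean_space \<Rightarrow> 'e"
  assumes "linear L"
  obtains c where "\<And>t. t > c \<Longrightarrow> inj (\<lambda>u. L u - t *\<^sub>R u)"
proof -
  obtain B where B: "B > 0" "\<And>u. norm (L u) \<le> B * norm u"
    using linear_bounded_pos[OF assms] by blast
  have "inj (\<lambda>u. L u - t *\<^sub>R u)" if "t > B" for t
  proof -
    have lin: "linear (\<lambda>u. L u - t *\<^sub>R u)"
      using assms by (intro linear_compose_sub linear_scale_self) auto
    have "u = 0" if u: "L u - t *\<^sub>R u = 0" for u
    proof (rule ccontr)
      assume "u \<noteq> 0"
      then have "B * norm u < t * norm u" using \<open>t > B\<close> by simp
      also have "\<dots> = norm (L u)" using u \<open>t > B\<close> B(1) by simp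
      finally show False using B(2)[of u] by simp
    qed
    then show ?thesis
      using linear_injective_0[OF lin] by blast
  qed
  with that show ?thesis by blast
qed

definition basis_enum :: "nat \<Rightarrow> 'e::euclidean_space" where
  "basis_enum = (SOME b. bij_betw b {..<DIM('e)} Basis)"

lemma bij_basis_enum: "bij_betw basis_enum {..<DIM('e)} (Basis :: 'e::euclidean_space set)"
proof -
  have "\<exists>b. bij_betw b {..<DIM('e)} (Basis :: 'e set)"
    using ex_bij_betw_nat_finite[of "Basis :: 'e set"] by (simp add: atLeast0LessThan)
  then show ?thesis unfolding basis_enum_def by (rule someI_ex)
qed

definition top_pf :: "nat \<Rightarrow> ('e::euclidean_space \<Rightarrow> 'e \<Rightarrow> real) \<Rightarrow> real" where
  "top_pf m B = pf_sum m (\<lambda>i j. B (basis_enum i) (basis_enum j))"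

lemma fder_top_pf:
  fixes B :: "'e::euclidean_space \<Rightarrow> 'e \<Rightarrow> 'e \<Rightarrow> real"
  assumes dim: "DIM('e) = 2 * m" and B: "smooth_bilinear V B" and x: "x \<in> V"
    and L: "\<And>u v. fder (\<lambda>y. B y u v) x w = B x (L u) v + B x u (L v)"
  shows "fder (\<lambda>y. top_pf m (B y)) x w = linear_trace L * top_pf m (B x)"
proof -
  let ?b = "basis_enum :: nat \<Rightarrow> 'e"
  have "((\<lambda>y. pf_sum m (\<lambda>i j. B y (?b i) (?b j))) has_derivative
    (\<lambda>w. (1 / 2 ^ m) * (\<Sum>\<pi> | \<pi> permutes {..<2*m}. of_int (sign \<pi>) *
       (\<Sum>l<m. fder (\<lambda>y. B y (?b (\<pi> (2*l))) (?b (\<pi> (2*l+1)))) x w *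
         (\<Prod>i\<in>{..<m} - {l}. B x (?b (\<pi> (2*i))) (?b (\<pi> (2*i+1)))))))) (at x)"
    by (rule pf_sum_has_derivative[of "\<lambda>y i j. B y (?b i) (?b j)"])
      (rule smooth_on_has_derivative[OF smooth_bilinearD(2)[OF B] x])
  from fder_eq[OF this] show ?thesis
    unfolding top_pf_def
    using pf_derivation_trace[OF smooth_bilinearD(1)[OF B x], of ?b m L] bij_basis_enum[where 'e = 'e]
    by (simp add: dim L)
qed

lemma top_pf_smooth:
  assumes "open V" and B: "smooth_bilinear V B"
  shows "smooth_on V (\<lambda>x. top_pf m (B x))"
  unfolding top_pf_def pf_sum_def
  by (intro smooth_on_mult[OF assms(1)] smooth_on_sum[OF assms(1)] smooth_on_prod[OF assms(1)]
      smooth_on_const smooth_bilinearD(2)[OF B])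

context hamiltonian_chart
begin

lemma G_left_linear: "x \<in> V \<Longrightarrow> linear (\<lambda>a. G x a v)"
  using G_bilinear by (simp add: bilinear_def)

definition omega :: "'e \<Rightarrow> 'e \<Rightarrow> 'e \<Rightarrow> real" where
  "omega x u v = G x (J u) v"

text \<open>The form whose pfaffian defines the momentum polynomial.\<close>

definition \<psi> :: "real \<Rightarrow> 'e \<Rightarrow> 'e \<Rightarrow> 'e \<Rightarrow> real" where
  "\<psi> t x u v = \<phi> x u v - t * omega x u v"

lemma omega_smooth_bilinear: "smooth_bilinear V omega"
  unfolding smooth_bilinear_def
proof (intro conjI ballI allI)
  show "bilinear (omega x)" if "x \<in> V" for x
    unfolding bilinear_def omega_def using linear_compose[OF J_linear] G_bilinear[OF that]
    by (auto simp: bilinear_def o_def)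
  show "smooth_on V (\<lambda>x. omega x u v)" for u v
    unfolding omega_def by (rule smooth_bilinearD(2)[OF G])
qed

lemma \<psi>_smooth_bilinear: "smooth_bilinear V (\<psi> t)"
  unfolding smooth_bilinear_def
proof (intro conjI ballI allI)
  show "bilinear (\<psi> t x)" if "x \<in> V" for x
    using \<phi>_bilinear[OF that] smooth_bilinearD(1)[OF omega_smooth_bilinear that]
    unfolding bilinear_def \<psi>_def by (auto simp: linear_iff algebra_simps)
  show "smooth_on V (\<lambda>x. \<psi> t x u v)" for u v
    unfolding \<psi>_def
    by (intro smooth_on_diff smooth_on_mult smooth_on_const V smooth_bilinearD(2)[OF \<phi>]
        smooth_bilinearD(2)[OF omega_smooth_bilinear])
qed

lemma top_pf_om_adapted:
  assumes x: "x \<in> V" and e: "adapted m x e"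
  shows "pf_sum m (\<lambda>i j. omega x (e i) (e j)) = pf_sum m standard_form"
  by (rule pf_sum_cong) (use adapted_kaehler_form[OF x e] in \<open>simp add: omega_def\<close>)

text \<open>Both pfaffian sums scale with the same factor when the adapted frame is replaced by the coordinate frame,
and the pfaffian sum of \<open>\<omega>\<close> is the same number in every adapted frame.\<close>

lemma pf_sum_adapted_frame:
  assumes x: "x \<in> V" and e: "adapted m x e" and B: "bilinear B"
  shows "top_pf m (omega x) \<noteq> 0"
    and "pf_sum m (\<lambda>i j. B (e i) (e j)) = pf_sum m standard_form * (top_pf m B / top_pf m (omega x))"
proof -
  have "bij_betw basis_enum {..<2*m} (Basis :: 'e set)"
    using bij_basis_enum[where 'e = 'e] dim by simp
  from alternating_form_proportional[OF this, of e] obtain D where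
    D: "\<And>F. alternating_form (2*m) F \<Longrightarrow> F e = D * F basis_enum" by blast
  have 1: "pf_sum m standard_form = D * top_pf m (omega x)"
    using D[OF pf_sum_alternating[OF smooth_bilinearD(1)[OF omega_smooth_bilinear x]]]
      top_pf_om_adapted[OF x e] by (simp add: top_pf_def)
  then show nz: "top_pf m (omega x) \<noteq> 0"
    using pf_sum_standard_form_pos[of m] by auto
  have "pf_sum m (\<lambda>i j. B (e i) (e j)) = D * top_pf m B"
    using D[OF pf_sum_alternating[OF B]] by (simp add: top_pf_def)
  then show "pf_sum m (\<lambda>i j. B (e i) (e j)) = pf_sum m standard_form * (top_pf m B / top_pf m (omega x))"
    using 1 nz by simp
qed

lemma top_pf_om_nonzero: "x \<in> V \<Longrightarrow> top_pf m (omega x) \<noteq> 0"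
  using adapted_exists[of x m] pf_sum_adapted_frame(1)[OF _ _ smooth_bilinearD(1)[OF omega_smooth_bilinear]]
    dim by auto

text \<open>Up to a constant factor this is the momentum polynomial, written without adapted frames.\<close>

definition P :: "real \<Rightarrow> 'e \<Rightarrow> real" where
  "P t x = top_pf m (\<psi> t x) / top_pf m (omega x)"

lemma P_smooth: "smooth_on V (P t)"
  unfolding P_def[abs_def]
  by (intro smooth_on_divide V top_pf_smooth \<psi>_smooth_bilinear omega_smooth_bilinear top_pf_om_nonzero)

text \<open>Expanding each product over the pairs by the subset of those pairs from which \<open>\<phi>\<close> is chosen exhibits the dependence on
\<open>t\<close>; the summands are indexed by a permutation and such a subset.\<close>

lemma P_coefficients:
  "\<exists>(I :: ((nat \<Rightarrow> nat) \<times> nat set) set) C d. finite I \<and> (\<forall>j. smooth_on V (C j)) \<and>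
     (\<forall>t x. P t x = (\<Sum>j\<in>I. t ^ d j * C j x))"
proof -
  let ?b = "basis_enum :: nat \<Rightarrow> 'e"
  define I where "I = {\<pi>. \<pi> permutes {..<2*m}} \<times> Pow {..<m}"
  define d where "d = (\<lambda>j :: (nat \<Rightarrow> nat) \<times> nat set. card ({..<m} - snd j))"
  define a where "a = (\<lambda>x (\<pi> :: nat \<Rightarrow> nat) i. \<phi> x (?b (\<pi> (2*i))) (?b (\<pi> (2*i+1))))"
  define o' where "o' = (\<lambda>x (\<pi> :: nat \<Rightarrow> nat) i. - omega x (?b (\<pi> (2*i))) (?b (\<pi> (2*i+1))))"
  define C where "C = (\<lambda>(\<pi>, X) x. (1 / 2 ^ m * of_int (sign \<pi>)) *
     ((\<Prod>i\<in>X. a x \<pi> i) * (\<Prod>i\<in>{..<m} - X. o' x \<pi> i)) / top_pf m (omega x))"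
  have "finite I" by (simp add: I_def finite_permutations)
  moreover have "smooth_on V (C j)" for j
  proof -
    have "smooth_on V (\<lambda>x. a x \<pi> i)" "smooth_on V (\<lambda>x. o' x \<pi> i)" for \<pi> i
      unfolding a_def o'_def
      by (intro smooth_on_minus V smooth_bilinearD(2)[OF \<phi>] smooth_bilinearD(2)[OF omega_smooth_bilinear])+
    then have "smooth_on V (\<lambda>x. (1 / 2 ^ m * of_int (sign \<pi>)) *
     ((\<Prod>i\<in>X. a x \<pi> i) * (\<Prod>i\<in>{..<m} - X. o' x \<pi> i)) / top_pf m (omega x))" for \<pi> X
      by (intro smooth_on_divide smooth_on_mult smooth_on_prod smooth_on_const V top_pf_smooth
          omega_smooth_bilinear top_pf_om_nonzero)
    then show ?thesis by (cases j) (simp add: C_def)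
  qed
  moreover have "P t x = (\<Sum>j\<in>I. t ^ d j * C j x)" for t x
  proof -
    have expand: "(\<Prod>i<m. \<psi> t x (?b (\<pi> (2*i))) (?b (\<pi> (2*i+1))))
        = (\<Sum>X\<in>Pow {..<m}. t ^ card ({..<m} - X) * ((\<Prod>i\<in>X. a x \<pi> i) * (\<Prod>i\<in>{..<m} - X. o' x \<pi> i)))" for \<pi>
    proof -
      have "(\<Prod>i<m. \<psi> t x (?b (\<pi> (2*i))) (?b (\<pi> (2*i+1)))) = (\<Prod>i<m. a x \<pi> i + t * o' x \<pi> i)"
        by (simp add: a_def o'_def \<psi>_def)
      also have "\<dots> = (\<Sum>X\<in>Pow {..<m}. (\<Prod>i\<in>X. a x \<pi> i) * (\<Prod>i\<in>{..<m} - X. t * o' x \<pi> i))"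
        by (rule prod_add) simp
      finally show ?thesis by (simp add: prod.distrib mult_ac)
    qed
    have "P t x = (\<Sum>\<pi> | \<pi> permutes {..<2*m}. \<Sum>X\<in>Pow {..<m}. t ^ d (\<pi>, X) * C (\<pi>, X) x)"
      unfolding P_def top_pf_def pf_sum_def expand
      by (simp add: C_def d_def top_pf_def pf_sum_def sum_distrib_left sum_distrib_right sum_divide_distrib mult_ac)
    also have "\<dots> = (\<Sum>j\<in>I. t ^ d j * C j x)"
      unfolding I_def by (simp add: sum.cartesian_product case_prod_beta)
    finally show ?thesis .
  qed
  ultimately show ?thesis by blast
qed

definition \<eta> where "\<eta> t = gradient (P t)"

lemma \<eta>_smooth: "smooth_on V (\<eta> t)" and G_\<eta>: "x \<in> V \<Longrightarrow> G x (\<eta> t x) u = fder (P t) x u"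
  unfolding \<eta>_def using gradient[OF P_smooth] by auto

lemma \<eta>_differentiable: "x \<in> V \<Longrightarrow> \<eta> t differentiable (at x)"
  by (rule smooth_on_differentiable[OF \<eta>_smooth])

lemma \<eta>_polynomial:
  assumes x: "x \<in> V"
  shows "real_polynomial_function (\<lambda>t. P t x)"
    and "real_polynomial_function (\<lambda>t. G x (\<eta> t x) v)"
    and "real_polynomial_function (\<lambda>t. G x (cov_deriv (\<eta> t) x w) v)"
proof -
  obtain I :: "((nat \<Rightarrow> nat) \<times> nat set) set" and C d where
    C: "finite I" "\<And>j. smooth_on V (C j)" "\<And>t x. P t x = (\<Sum>j\<in>I. t ^ d j * C j x)"
    using P_coefficients by auto
  show "real_polynomial_function (\<lambda>t. P t x)"
    unfolding C(3) by (intro real_polynomial_function_sum C(1) real_polynomial_monomial)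
  have \<eta>: "\<eta> t y = (\<Sum>j\<in>I. t ^ d j *\<^sub>R gradient (C j) y)" if y: "y \<in> V" for y t
  proof (rule G_eqI[OF y])
    fix v
    have "(P t has_derivative (\<lambda>v. \<Sum>j\<in>I. t ^ d j * fder (C j) y v)) (at y)"
      unfolding C(3)[abs_def]
      by (intro has_derivative_sum has_derivative_mult_right smooth_on_has_derivative[OF C(2) y])
    from fun_cong[OF fder_eq[OF this], of v]
    have "fder (P t) y v = (\<Sum>j\<in>I. t ^ d j * fder (C j) y v)" .
    moreover have "G y (\<Sum>j\<in>I. t ^ d j *\<^sub>R gradient (C j) y) v = (\<Sum>j\<in>I. t ^ d j * fder (C j) y v)"
      by (simp add: linear_sum[OF G_left_linear[OF y]] G_lin[OF y] G_grd[OF C(2) y])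
    ultimately show "G y (\<eta> t y) v = G y (\<Sum>j\<in>I. t ^ d j *\<^sub>R gradient (C j) y) v"
      using G_\<eta>[OF y] by simp
  qed
  have G_sum: "G x (\<Sum>j\<in>I. t ^ d j *\<^sub>R a j) v = (\<Sum>j\<in>I. t ^ d j * G x (a j) v)" for a t v
    by (simp add: linear_sum[OF G_left_linear[OF x]] G_lin[OF x])
  show "real_polynomial_function (\<lambda>t. G x (\<eta> t x) v)"
    unfolding \<eta>[OF x] G_sum by (intro real_polynomial_function_sum C(1) real_polynomial_monomial)
  have "cov_deriv (\<eta> t) x w = (\<Sum>j\<in>I. t ^ d j *\<^sub>R cov_deriv (gradient (C j)) x w)" for t
  proof -
    have "((\<lambda>y. \<Sum>j\<in>I. t ^ d j *\<^sub>R gradient (C j) y) has_derivative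
        (\<lambda>w. \<Sum>j\<in>I. t ^ d j *\<^sub>R fder (gradient (C j)) x w)) (at x)"
      by (intro has_derivative_sum has_derivative_scaleR_right
          smooth_on_has_derivative[OF grd_smooth[OF C(2)] x])
    from fun_cong[OF fder_eq[OF this], of w]
    have "fder (\<eta> t) x w = (\<Sum>j\<in>I. t ^ d j *\<^sub>R fder (gradient (C j)) x w)"
      by (subst fder_cong[OF V x, of "\<eta> t", OF \<eta>])
    moreover have "\<Gamma> x w (\<Sum>j\<in>I. t ^ d j *\<^sub>R gradient (C j) x) = (\<Sum>j\<in>I. t ^ d j *\<^sub>R \<Gamma> x w (gradient (C j) x))"
    proof -
      have "linear (\<Gamma> x w)" using \<Gamma>_bilinear[OF x] by (simp add: bilinear_def)
      then show ?thesis by (simp add: linear_sum linear_scale)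
    qed
    ultimately show ?thesis
      by (simp add: cov_deriv_def \<eta>[OF x] sum.distrib scaleR_add_right)
  qed
  then show "real_polynomial_function (\<lambda>t. G x (cov_deriv (\<eta> t) x w) v)"
    by (simp only: G_sum) (intro real_polynomial_function_sum C(1) real_polynomial_monomial)
qed

lemma \<psi>_\<Phi>:
  assumes x: "x \<in> V"
  shows "\<psi> t x u v = G x (J (\<Phi> x u - t *\<^sub>R u)) v"
  using \<phi>_J_left[OF x, of u v]
  by (simp add: \<psi>_def omega_def J_lin G_lin[OF x] G_J_left[OF x] G_\<Phi>[OF x] J_J \<phi>_lin[OF x])

lemma fder_omega: "x \<in> V \<Longrightarrow> fder (\<lambda>y. omega y u v) x w = omega x (\<Gamma> x w u) v + omega x u (\<Gamma> x w v)"
  by (simp add: omega_def fder_G \<Gamma>_J_right)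

definition resolvent :: "'e \<Rightarrow> real \<Rightarrow> ('e \<Rightarrow> 'e) \<Rightarrow> bool" where
  "resolvent x t R \<longleftrightarrow> (\<forall>u. \<Phi> x (R u) - t *\<^sub>R R u = u) \<and> (\<forall>u. R (\<Phi> x u - t *\<^sub>R u) = u)"

lemma resolventD:
  assumes "resolvent x t R"
  shows "\<Phi> x (R u) - t *\<^sub>R R u = u" "R (\<Phi> x u - t *\<^sub>R u) = u"
  using assms by (auto simp: resolvent_def)

text \<open>Here \<open>R\<close> is the resolvent \<open>(\<Phi> - t)\<inverse>\<close>. The derivative of \<open>\<psi> t\<close> is the derivation of \<open>\<psi> t\<close> by
the Christoffel symbols plus \<open>S\<close>, where \<open>S\<close> is half of \<open>R\<close> composed with the covariant derivative of \<open>\<Phi>\<close>; that of \<open>\<omega>\<close> comes from the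
Christoffel symbols alone. So in the quotient only the trace of \<open>S\<close> is left, a sum of four
equal traces of endomorphisms of rank one.\<close>

lemma fder_P_resolvent:
  assumes x: "x \<in> V" and R: "resolvent x t R"
  shows "fder (P t) x w = P t x * G x (R (\<xi> x)) w"
proof -
  have R_sym: "G x (R a) b = G x a (R b)" for a b
  proof -
    have "G x (R a) (\<Phi> x (R b) - t *\<^sub>R R b) = G x (\<Phi> x (R a) - t *\<^sub>R R a) (R b)"
      using \<Phi>_symmetric[OF x, of "R a" "R b"] G_sym[OF x, of "R a" "\<Phi> x (R b)"] by (simp add: G_lin[OF x])
    then show ?thesis by (simp add: resolventD(1)[OF R])
  qed
  have R_J: "R (J a) = J (R a)" for a
  proof -
    have "\<Phi> x (J (R a)) - t *\<^sub>R J (R a) = J a"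
      using arg_cong[OF resolventD(1)[OF R, of a], of J] by (simp add: \<Phi>_J[OF x] J_lin)
    then show ?thesis using resolventD(2)[OF R, of "J (R a)"] by simp
  qed
  \<comment> \<open>With this \<open>S\<close>, twice \<open>\<psi> t x (S u) v\<close> is the covariant derivative of \<open>\<phi>\<close> in the direction \<open>w\<close>.\<close>
  define S where "S = (\<lambda>u. (1/4) *\<^sub>R (G x (\<xi> x) u *\<^sub>R R w + G x w u *\<^sub>R R (\<xi> x)
      + G x (J w) u *\<^sub>R R (J (\<xi> x)) + G x (J (\<xi> x)) u *\<^sub>R R (J w)))"
  have R_lin: "\<psi> t x (R a) b = G x (J a) b" for a b
    by (simp add: \<psi>_\<Phi>[OF x] resolventD(1)[OF R])
  have \<psi>_bl: "bilinear (\<psi> t x)" by (rule smooth_bilinearD(1)[OF \<psi>_smooth_bilinear x])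
  have \<psi>_S: "\<psi> t x (S u) v = 1/4 * (G x (\<xi> x) u * G x (J w) v + G x w u * G x (J (\<xi> x)) v
      - G x (J w) u * G x (\<xi> x) v - G x (J (\<xi> x)) u * G x w v)" for u v
    by (simp add: S_def bilinear_ladd[OF \<psi>_bl] bilinear_lmul[OF \<psi>_bl] R_lin J_J G_lin[OF x])
  have \<psi>_skew: "\<psi> t x u v = - \<psi> t x v u" for u v
    using \<phi>_skew[OF x, of u v] G_J_left[OF x, of u v] G_sym[OF x, of u "J v"] by (simp add: \<psi>_def omega_def)
  have d\<psi>: "fder (\<lambda>y. \<psi> t y u v) x w = \<psi> t x (\<Gamma> x w u + S u) v + \<psi> t x u (\<Gamma> x w v + S v)" for u v
  proof -
    have "fder (\<lambda>y. \<psi> t y u v) x w = fder (\<lambda>y. \<phi> y u v) x w - t * fder (\<lambda>y. omega y u v) x w"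
      unfolding \<psi>_def
      by (subst fder_eq[OF has_derivative_diff[OF smooth_on_has_derivative[OF smooth_bilinearD(2)[OF \<phi>] x]
            has_derivative_mult_right[OF smooth_on_has_derivative[OF smooth_bilinearD(2)[OF omega_smooth_bilinear] x]]]])
        simp
    also have "\<dots> = \<psi> t x (\<Gamma> x w u) v + \<psi> t x u (\<Gamma> x w v) + 1/2 * (G x (\<xi> x) u * G x (J w) v - G x (\<xi> x) v * G x (J w) u
      + G x (\<xi> x) (J u) * G x w v - G x (\<xi> x) (J v) * G x w u)"
      by (simp add: fder_\<phi>[OF x] fder_omega[OF x] \<psi>_def algebra_simps)
    also have "\<dots> = \<psi> t x (\<Gamma> x w u) v + \<psi> t x u (\<Gamma> x w v) + (\<psi> t x (S u) v - \<psi> t x (S v) u)"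
      unfolding \<psi>_S by (simp add: G_J_left[OF x] algebra_simps)
    finally show ?thesis
      using \<psi>_skew[of u "S v"] by (simp add: bilinear_ladd[OF \<psi>_bl] bilinear_radd[OF \<psi>_bl])
  qed
  have trace_add: "linear_trace (\<lambda>u. \<Gamma> x w u + S u) = linear_trace (\<Gamma> x w) + linear_trace S"
    by (simp add: linear_trace_def inner_add_left sum.distrib)
  have rank_one: "(\<Sum>i\<in>Basis. G x c i * (e \<bullet> i)) = G x c e" for c e
    using linear_Basis_expand[OF G_linear[OF x], of c e] by (simp add: mult.commute)
  have "linear_trace S = 1/4 * (G x (\<xi> x) (R w) + G x w (R (\<xi> x)) + G x (J w) (R (J (\<xi> x))) + G x (J (\<xi> x)) (R (J w)))"
    unfolding linear_trace_def S_def
    by (simp add: inner_add_left sum.distrib rank_one flip: sum_divide_distrib)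
  also have "\<dots> = G x (R (\<xi> x)) w"
    using R_sym[of "\<xi> x" w] G_sym[OF x, of w "R (\<xi> x)"] by (simp add: R_J G_J_J[OF x])
  finally have trace_S: "linear_trace S = G x (R (\<xi> x)) w" .
  have N: "fder (\<lambda>y. top_pf m (\<psi> t y)) x w = (linear_trace (\<Gamma> x w) + linear_trace S) * top_pf m (\<psi> t x)"
    using fder_top_pf[OF dim \<psi>_smooth_bilinear x, of t w "\<lambda>u. \<Gamma> x w u + S u"] d\<psi> trace_add by simp
  have O: "fder (\<lambda>y. top_pf m (omega y)) x w = linear_trace (\<Gamma> x w) * top_pf m (omega x)"
    by (rule fder_top_pf[OF dim omega_smooth_bilinear x]) (rule fder_omega[OF x])
  have "(P t has_derivative (\<lambda>w. - top_pf m (\<psi> t x) * (inverse (top_pf m (omega x)) *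
      fder (\<lambda>y. top_pf m (omega y)) x w * inverse (top_pf m (omega x)))
      + fder (\<lambda>y. top_pf m (\<psi> t y)) x w / top_pf m (omega x))) (at x)"
    unfolding P_def[abs_def]
    by (rule has_derivative_divide[OF smooth_on_has_derivative[OF top_pf_smooth[OF V \<psi>_smooth_bilinear] x]
          smooth_on_has_derivative[OF top_pf_smooth[OF V omega_smooth_bilinear] x] top_pf_om_nonzero[OF x]])
  from fun_cong[OF fder_eq[OF this], of w]
  have "fder (P t) x w = - top_pf m (\<psi> t x) * (inverse (top_pf m (omega x)) *
      (linear_trace (\<Gamma> x w) * top_pf m (omega x)) * inverse (top_pf m (omega x)))
      + (linear_trace (\<Gamma> x w) + linear_trace S) * top_pf m (\<psi> t x) / top_pf m (omega x)"
    unfolding N O .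
  then show ?thesis
    unfolding P_def[of t x] trace_S using top_pf_om_nonzero[OF x] by (simp add: field_simps)
qed

lemma resolvent_exists:
  assumes x: "x \<in> V"
  shows "\<exists>c. \<forall>t>c. \<exists>R. resolvent x t R"
proof -
  obtain c where c: "\<And>t. t > c \<Longrightarrow> inj (\<lambda>u. \<Phi> x u - t *\<^sub>R u)"
    using eventually_not_eigenvalue[OF \<Phi>_linear[OF x]] by blast
  have "\<exists>R. resolvent x t R" if "t > c" for t
  proof -
    have "linear (\<lambda>u. \<Phi> x u - t *\<^sub>R u)"
      by (intro linear_compose_sub linear_scale_self \<Phi>_linear[OF x])
    from linear_injective_isomorphism[OF this c[OF that]] show ?thesis unfolding resolvent_def by blast
  qed
  then show ?thesis by blast
qed

lemma \<eta>_resolvent: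
  assumes x: "x \<in> V" and R: "resolvent x t R"
  shows "\<eta> t x = P t x *\<^sub>R R (\<xi> x)"
  by (rule G_eqI[OF x]) (simp add: G_\<eta>[OF x] fder_P_resolvent[OF x R] G_lin[OF x])

lemma \<Phi>_\<eta>:
  assumes x: "x \<in> V"
  shows "\<Phi> x (\<eta> t x) - t *\<^sub>R \<eta> t x = P t x *\<^sub>R \<xi> x"
proof (rule G_eqI[OF x])
  fix v
  let ?f = "\<lambda>t. G x (\<eta> t x) (\<Phi> x v) - t * G x (\<eta> t x) v - P t x * G x (\<xi> x) v"
  obtain c where c: "\<And>t. t > c \<Longrightarrow> \<exists>R. resolvent x t R"
    using resolvent_exists[OF x] by blast
  have f: "?f t = G x (\<Phi> x (\<eta> t x) - t *\<^sub>R \<eta> t x) v - G x (P t x *\<^sub>R \<xi> x) v" for t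
    using \<Phi>_symmetric[OF x, of "\<eta> t x" v] G_sym[OF x, of "\<Phi> x v" "\<eta> t x"] by (simp add: G_lin[OF x])
  have "?f t = 0"
  proof (rule real_polynomial_zero[of ?f c])
    show "real_polynomial_function ?f"
      by (intro real_polynomial_function_diff real_polynomial_function.intros(4) \<eta>_polynomial[OF x]
          real_polynomial_function.intros(2) real_polynomial_function.intros(1) bounded_linear_ident)
    fix t assume "t > c"
    then obtain R where R: "resolvent x t R"
      using c by blast
    have "\<Phi> x (\<eta> t x) - t *\<^sub>R \<eta> t x = P t x *\<^sub>R (\<Phi> x (R (\<xi> x)) - t *\<^sub>R R (\<xi> x))"
      unfolding \<eta>_resolvent[OF x R] by (simp add: linear_scale[OF \<Phi>_linear[OF x]] scaleR_diff_right)
    then show "?f t = 0" unfolding f resolventD(1)[OF R] by simp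
  qed
  then show "G x (\<Phi> x (\<eta> t x) - t *\<^sub>R \<eta> t x) v = G x (P t x *\<^sub>R \<xi> x) v" unfolding f by simp
qed

lemma G_\<Phi>_J_self: "x \<in> V \<Longrightarrow> G x (\<Phi> x u) (J u) = 0"
  using \<Phi>_symmetric[of x u "J u"] G_J_left[of x "\<Phi> x u" u] by (simp add: \<Phi>_J)

text \<open>For large \<open>s\<close> and \<open>t\<close> put \<open>z = (\<Phi> - s)\<inverse> (\<Phi> - t)\<inverse> \<xi>\<close>. Then the two gradients are multiples of
\<open>(\<Phi> - s) z\<close> and \<open>(\<Phi> - t) z\<close>, and \<open>J\<close> times a polynomial in \<open>\<Phi>\<close> is skew. The identity extends first to
all \<open>t\<close>, then to all \<open>s\<close>.\<close>

lemma \<eta>_J_\<eta>: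
  assumes x: "x \<in> V"
  shows "G x (\<eta> t x) (J (\<eta> s x)) = 0"
proof -
  obtain c where c: "\<And>t. t > c \<Longrightarrow> \<exists>R. resolvent x t R"
    using resolvent_exists[OF x] by blast
  note \<Phi>_l = linear_diff[OF \<Phi>_linear[OF x]] linear_scale[OF \<Phi>_linear[OF x]]
  have 1: "G x (\<eta> t x) (J (\<eta> s x)) = 0" if "t > c" "s > c" for t s
  proof -
    obtain R where R: "resolvent x t R"
      using c \<open>t > c\<close> by blast
    obtain Q where Q: "resolvent x s Q"
      using c \<open>s > c\<close> by blast
    define z where "z = Q (R (\<xi> x))"
    have Rz: "R (\<xi> x) = \<Phi> x z - s *\<^sub>R z" by (simp add: z_def resolventD(1)[OF Q])
    have "\<xi> x = \<Phi> x (R (\<xi> x)) - t *\<^sub>R R (\<xi> x)" by (simp add: resolventD(1)[OF R])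
    also have "\<dots> = \<Phi> x (\<Phi> x z - t *\<^sub>R z) - s *\<^sub>R (\<Phi> x z - t *\<^sub>R z)"
      unfolding Rz \<Phi>_l by (simp add: algebra_simps)
    finally have Qz: "Q (\<xi> x) = \<Phi> x z - t *\<^sub>R z" using resolventD(2)[OF Q] by metis
    have "G x (\<Phi> x z - s *\<^sub>R z) (J (\<Phi> x z - t *\<^sub>R z)) = 0"
      using G_\<Phi>_J_self[OF x, of z] G_J_self[OF x, of z] G_J_self[OF x, of "\<Phi> x z"]
        G_J_left[OF x, of z "\<Phi> x z"] G_sym[OF x, of "J z" "\<Phi> x z"]
      by (simp add: G_lin[OF x] J_lin)
    then show ?thesis
      unfolding \<eta>_resolvent[OF x R] \<eta>_resolvent[OF x Q] Rz Qz by (simp add: J_lin(5) G_lin[OF x])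
  qed
  have 2: "G x (\<eta> t x) (J (\<eta> s x)) = 0" if "s > c" for t s
    by (rule real_polynomial_zero[OF \<eta>_polynomial(2)[OF x]]) (rule 1[OF _ that])
  have "G x (\<eta> s x) (J (\<eta> t x)) = 0"
  proof (rule real_polynomial_zero[OF \<eta>_polynomial(2)[OF x]])
    show "G x (\<eta> s x) (J (\<eta> t x)) = 0" if "s > c" for s
      using 2[OF that, of t] G_J_left[OF x, of "\<eta> s x" "\<eta> t x"] G_sym[OF x, of "J (\<eta> s x)" "\<eta> t x"] by simp
  qed
  then show ?thesis
    using G_J_left[OF x, of "\<eta> s x" "\<eta> t x"] G_sym[OF x, of "J (\<eta> s x)" "\<eta> t x"] by simp
qed

lemma \<xi>_J_\<eta>:
  assumes x: "x \<in> V"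
  shows "G x (\<xi> x) (J (\<eta> t x)) = 0"
proof -
  obtain c where c: "\<And>t. t > c \<Longrightarrow> \<exists>R. resolvent x t R"
    using resolvent_exists[OF x] by blast
  have "G x (\<eta> t x) (J (\<xi> x)) = 0"
  proof (rule real_polynomial_zero[OF \<eta>_polynomial(2)[OF x]])
    fix t assume "t > c"
    then obtain R where R: "resolvent x t R"
      using c by blast
    have "G x (R (\<xi> x)) (J (\<Phi> x (R (\<xi> x)) - t *\<^sub>R R (\<xi> x))) = 0"
      using G_\<Phi>_J_self[OF x, of "R (\<xi> x)"] G_J_self[OF x, of "R (\<xi> x)"]
        G_J_left[OF x, of "R (\<xi> x)" "\<Phi> x (R (\<xi> x))"] G_sym[OF x, of "J (R (\<xi> x))" "\<Phi> x (R (\<xi> x))"]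
      by (simp add: G_lin[OF x] J_lin)
    then show "G x (\<eta> t x) (J (\<xi> x)) = 0"
      unfolding resolventD(1)[OF R] \<eta>_resolvent[OF x R] by (simp add: G_lin[OF x])
  qed
  then show ?thesis
    using G_J_left[OF x, of "\<xi> x" "\<eta> t x"] G_sym[OF x, of "J (\<xi> x)" "\<eta> t x"] by simp
qed

text \<open>The covariant derivative of \<open>\<Phi>_\<eta>\<close> in the direction \<open>w\<close>, paired with \<open>v\<close>.\<close>

lemma \<Phi>_hessian_\<eta>:
  assumes x: "x \<in> V"
  shows "G x (\<Phi> x (cov_deriv (\<eta> t) x w) - t *\<^sub>R cov_deriv (\<eta> t) x w) v
    = 1/2 * (G x (\<eta> t x) w * G x (\<xi> x) v + G x (\<xi> x) (J v) * G x (J w) (\<eta> t x) - G x (\<xi> x) (\<eta> t x) * G x w v)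
      + P t x * G x (cov_deriv \<xi> x w) v"
proof -
  note d\<eta> = \<eta>_differentiable[OF x] and d\<xi> = \<xi>_differentiable[OF x]
  let ?A = "\<lambda>y. \<phi> y (\<eta> t y) (J v)" and ?B = "\<lambda>y. G y (\<eta> t y) v" and ?C = "\<lambda>y. G y (\<xi> y) v"
  have eq: "?A y - t * ?B y = P t y * ?C y" if "y \<in> V" for y
    using arg_cong[OF \<Phi>_\<eta>[OF that, of t], of "\<lambda>a. G y a v"] by (simp add: G_lin[OF that] G_\<Phi>[OF that])
  have A: "(?A has_derivative (\<lambda>w. fder (\<lambda>y. \<phi> y (\<eta> t x) (J v)) x w + \<phi> x (fder (\<eta> t) x w) (J v)
       + \<phi> x (\<eta> t x) (fder (\<lambda>y. J v) x w))) (at x)"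
    by (rule fder_smooth_bilinear[OF V \<phi> x d\<eta>]) simp
  have B: "(?B has_derivative fder ?B x) (at x)" "(?C has_derivative fder ?C x) (at x)"
    by (rule smooth_on_has_derivative[OF smooth_bilinear_apply[OF V G] x]; intro \<eta>_smooth \<xi>_smooth smooth_on_const)+
  have B': "fder ?B x w = G x (cov_deriv (\<eta> t) x w) v + G x (\<eta> t x) (\<Gamma> x w v)"
    using fder_pairing[OF x d\<eta>, where b = "\<lambda>y. v" and w = w] by (simp add: cov_deriv_def)
  have C': "fder ?C x w = G x (cov_deriv \<xi> x w) v + G x (\<xi> x) (\<Gamma> x w v)"
    using fder_pairing[OF x d\<xi>, where b = "\<lambda>y. v" and w = w] by (simp add: cov_deriv_def)
  have "fder (\<lambda>y. ?A y - t * ?B y) x w = fder (\<lambda>y. P t y * ?C y) x w"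
    using fder_cong[OF V x eq] by simp
  moreover have "fder (\<lambda>y. ?A y - t * ?B y) x w
      = fder (\<lambda>y. \<phi> y (\<eta> t x) (J v)) x w + \<phi> x (fder (\<eta> t) x w) (J v) - t * fder ?B x w"
    by (subst fder_eq[OF has_derivative_diff[OF A has_derivative_mult_right[OF B(1)]]]) (simp add: \<phi>_lin[OF x] bilinear_rzero[OF \<phi>_bilinear[OF x]])
  moreover have "fder (\<lambda>y. P t y * ?C y) x w = P t x * fder ?C x w + G x (\<eta> t x) w * ?C x"
    by (subst fder_eq[OF has_derivative_mult[OF smooth_on_has_derivative[OF P_smooth x] B(2)]])
      (simp add: G_\<eta>[OF x])
  moreover have "\<phi> x (\<eta> t x) (J (\<Gamma> x w v)) - t * G x (\<eta> t x) (\<Gamma> x w v) = P t x * G x (\<xi> x) (\<Gamma> x w v)"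
    using arg_cong[OF \<Phi>_\<eta>[OF x, of t], of "\<lambda>a. G x a (\<Gamma> x w v)"] by (simp add: G_lin[OF x] G_\<Phi>[OF x])
  ultimately have "\<phi> x (cov_deriv (\<eta> t) x w) (J v) - t * G x (cov_deriv (\<eta> t) x w) v
     = G x (\<eta> t x) w * G x (\<xi> x) v + P t x * G x (cov_deriv \<xi> x w) v
      - 1/2 * (G x (\<xi> x) (\<eta> t x) * G x w v - G x (\<xi> x) (J v) * G x (J w) (\<eta> t x) + G x (\<xi> x) v * G x w (\<eta> t x))"
    unfolding B' C' fder_\<phi>[OF x]
    using \<xi>_J_\<eta>[OF x, of t]
    by (simp add: cov_deriv_def \<Gamma>_J_right[OF x] \<phi>_lin[OF x] G_lin[OF x] G_J_J[OF x] J_J algebra_simps)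
  then show ?thesis
    using G_sym[OF x, of w "\<eta> t x"] by (simp add: G_lin[OF x] G_\<Phi>[OF x] algebra_simps)
qed

text \<open>In \<open>\<Phi>_hessian_\<eta>\<close> all terms but the last are complex linear in \<open>w\<close>, and the last is so because \<open>\<xi>\<close> is holomorphic. For large
\<open>t\<close> the injective map \<open>\<Phi> - t\<close> can be cancelled.\<close>

lemma \<eta>_holomorphic:
  assumes x: "x \<in> V"
  shows "cov_deriv (\<eta> t) x (J w) = J (cov_deriv (\<eta> t) x w)"
proof (rule G_eqI[OF x])
  fix v
  obtain c where c: "\<And>t. t > c \<Longrightarrow> inj (\<lambda>u. \<Phi> x u - t *\<^sub>R u)"
    using eventually_not_eigenvalue[OF \<Phi>_linear[OF x]] by blast
  let ?f = "\<lambda>t. G x (cov_deriv (\<eta> t) x (J w)) v + G x (cov_deriv (\<eta> t) x w) (J v)"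
  have "?f t = 0"
  proof (rule real_polynomial_zero[of ?f c])
    show "real_polynomial_function ?f"
      by (intro real_polynomial_function.intros(3) \<eta>_polynomial(3)[OF x])
    fix t assume "t > c"
    let ?S = "cov_deriv (\<eta> t) x"
    have "\<Phi> x (?S (J w)) - t *\<^sub>R ?S (J w) = \<Phi> x (J (?S w)) - t *\<^sub>R J (?S w)"
    proof (rule G_eqI[OF x])
      fix v
      have "\<Phi> x (J (?S w)) - t *\<^sub>R J (?S w) = J (\<Phi> x (?S w) - t *\<^sub>R ?S w)"
        by (simp add: \<Phi>_J[OF x] J_lin)
      then have "G x (\<Phi> x (J (?S w)) - t *\<^sub>R J (?S w)) v = - G x (\<Phi> x (?S w) - t *\<^sub>R ?S w) (J v)"
        by (simp add: G_J_left[OF x])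
      then show "G x (\<Phi> x (?S (J w)) - t *\<^sub>R ?S (J w)) v = G x (\<Phi> x (J (?S w)) - t *\<^sub>R J (?S w)) v"
        unfolding \<Phi>_hessian_\<eta>[OF x] \<xi>_holomorphic[OF x]
        using G_J_left[OF x, of w "\<eta> t x"] G_sym[OF x, of w "\<eta> t x"] G_sym[OF x, of w "J (\<eta> t x)"]
          G_J_left[OF x, of "\<eta> t x" w]
        by (simp add: J_J G_lin[OF x] G_J_left[OF x] algebra_simps)
    qed
    then have "?S (J w) = J (?S w)"
      using injD[OF c[OF \<open>t > c\<close>]] by blast
    then show "?f t = 0" by (simp add: G_J_left[OF x])
  qed
  then show "G x (cov_deriv (\<eta> t) x (J w)) v = G x (J (cov_deriv (\<eta> t) x w)) v"
    by (simp add: G_J_left[OF x])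
qed

theorem momentum_killing: "x \<in> V \<Longrightarrow> lie_form (\<lambda>y. J (\<eta> t y)) G x u v = 0"
  using killing_iff[OF P_smooth] \<eta>_holomorphic unfolding \<eta>_def by blast

text \<open>The Lie derivative consists of the covariant derivative of \<open>\<phi>\<close> along \<open>J \<eta>\<close> and of the commutator of
\<open>\<Phi>\<close> with the Hessian of \<open>P t\<close>. The latter is the part of \<open>\<Phi>_hessian_\<eta>\<close> that is skew in \<open>u\<close> and \<open>v\<close>; the
terms with the Hessian of \<open>\<sigma>\<close> are symmetric and cancel.\<close>

theorem momentum_preserves:
  assumes x: "x \<in> V"
  shows "lie_form (\<lambda>y. J (\<eta> t y)) \<phi> x u v = 0"
proof -
  let ?S = "cov_deriv (\<eta> t) x"
  have sym: "G x (?S a) b = G x (?S b) a" for a b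
    unfolding \<eta>_def by (rule hessian_symmetric[OF P_smooth x])
  have sym\<xi>: "G x (cov_deriv \<xi> x a) b = G x (cov_deriv \<xi> x b) a" for a b
    by (rule hessian_symmetric[OF \<sigma> x])
  have "\<phi> x u (J (?S v)) = \<phi> x (?S v) (J u)"
    using \<phi>_skew[OF x, of u "J (?S v)"] \<phi>_J_left[OF x, of "?S v" u] by simp
  then have "lie_form (\<lambda>y. J (\<eta> t y)) \<phi> x u v = \<phi> x (?S v) (J u) - \<phi> x (?S u) (J v)
      + 1/2 * (- G x (\<xi> x) u * G x (\<eta> t x) v + G x (\<xi> x) v * G x (\<eta> t x) u
      + G x (\<xi> x) (J u) * G x (J (\<eta> t x)) v - G x (\<xi> x) (J v) * G x (J (\<eta> t x)) u)"
    using \<Gamma>_sym[OF x, of "\<eta> t x"] \<phi>_J_left[OF x, of "?S u" v]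
    by (simp add: lie_form_def fder_\<phi>[OF x] fder_J[OF \<eta>_differentiable[OF x]] cov_deriv_def \<Gamma>_J_left[OF x] J_lin
        G_lin[OF x] \<phi>_lin[OF x] algebra_simps)
  moreover have "\<phi> x (?S v) (J u) - \<phi> x (?S u) (J v)
      = G x (\<Phi> x (?S v) - t *\<^sub>R ?S v) u - G x (\<Phi> x (?S u) - t *\<^sub>R ?S u) v"
    using sym[of u v] by (simp add: G_lin[OF x] G_\<Phi>[OF x])
  ultimately show ?thesis
    unfolding \<Phi>_hessian_\<eta>[OF x]
    using sym\<xi>[of u v] G_sym[OF x, of u v] G_J_left[OF x, of u "\<eta> t x"] G_J_left[OF x, of v "\<eta> t x"]
      G_sym[OF x, of u "J (\<eta> t x)"] G_sym[OF x, of v "J (\<eta> t x)"]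
    by (simp add: algebra_simps)
qed

text \<open>The derivative of \<open>\<eta>_J_\<eta>\<close> in the direction \<open>v\<close>, with the symmetry of the two Hessians, says that the Hessian of \<open>P t\<close> on \<open>J \<eta>(s)\<close> equals
the Hessian of \<open>P s\<close> on \<open>J \<eta>(t)\<close>; the Christoffel terms agree because \<open>\<Gamma>\<close> is symmetric and complex
bilinear.\<close>

theorem momentum_commute:
  assumes x: "x \<in> V"
  shows "fder (\<lambda>y. J (\<eta> t y)) x (J (\<eta> s x)) = fder (\<lambda>y. J (\<eta> s y)) x (J (\<eta> t x))"
proof -
  note d = \<eta>_differentiable[OF x]
  have sym: "G x (cov_deriv (\<eta> r) x a) b = G x (cov_deriv (\<eta> r) x b) a" for a b r
    unfolding \<eta>_def by (rule hessian_symmetric[OF P_smooth x])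
  have "cov_deriv (\<eta> t) x (J (\<eta> s x)) = cov_deriv (\<eta> s) x (J (\<eta> t x))"
  proof (rule G_eqI[OF x])
    fix v
    have "fder (\<lambda>y. G y (\<eta> t y) (J (\<eta> s y))) x v = 0"
      using fder_cong[OF V x, of "\<lambda>y. G y (\<eta> t y) (J (\<eta> s y))" "\<lambda>y. 0"] \<eta>_J_\<eta> by simp
    then have "G x (cov_deriv (\<eta> t) x v) (J (\<eta> s x)) + G x (\<eta> t x) (J (cov_deriv (\<eta> s) x v)) = 0"
      using fder_pairing[OF x d[of t] differentiable_J[OF d[of s]], of v] by (simp add: cov_deriv_J[OF x d])
    then show "G x (cov_deriv (\<eta> t) x (J (\<eta> s x))) v = G x (cov_deriv (\<eta> s) x (J (\<eta> t x))) v"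
      using sym[of t v "J (\<eta> s x)"] sym[of s v "J (\<eta> t x)"] G_J_left[OF x, of "\<eta> t x" "cov_deriv (\<eta> s) x v"]
        G_sym[OF x, of "J (\<eta> t x)" "cov_deriv (\<eta> s) x v"] by simp
  qed
  then have "fder (\<eta> t) x (J (\<eta> s x)) = fder (\<eta> s) x (J (\<eta> t x))"
    using \<Gamma>_sym[OF x, of "\<eta> s x" "\<eta> t x"] by (simp add: cov_deriv_def \<Gamma>_J_left[OF x])
  then show ?thesis by (simp add: fder_J[OF d])
qed

end

section \<open>Manifolds in charts\<close>

locale manifold =
  fixes M :: "'a topology" and A :: "('a, 'e::euclidean_space) chart set"
  assumes manifold: "smooth_manifold M A"
begin

lemma is_chart: "c \<in> A \<Longrightarrow> is_chart M c"
  using manifold by (simp add: smooth_manifold_def)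

lemma openin_cdom: "c \<in> A \<Longrightarrow> openin M (cdom c)"
  using is_chart by (simp add: is_chart_def)

lemma cdom_subset: "c \<in> A \<Longrightarrow> cdom c \<subseteq> topspace M"
  using openin_cdom openin_subset by blast

lemma open_coord_image:
  assumes c: "c \<in> A" and U: "openin M U"
  shows "open (coord c ` (cdom c \<inter> U))"
proof -
  have "homeomorphic_map (subtopology M (cdom c)) (top_of_set (coord c ` cdom c)) (coord c)"
    using is_chart[OF c] by (simp add: is_chart_def)
  then have "open_map (subtopology M (cdom c)) (top_of_set (coord c ` cdom c)) (coord c)"
    by (rule homeomorphic_imp_open_map)
  moreover have "openin (subtopology M (cdom c)) (cdom c \<inter> U)"
    using U by (auto simp: openin_subtopology)
  ultimately have "openin (top_of_set (coord c ` cdom c)) (coord c ` (cdom c \<inter> U))"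
    by (simp add: open_map_def)
  moreover have "open (coord c ` cdom c)"
    using is_chart[OF c] by (simp add: is_chart_def)
  ultimately show ?thesis
    using openin_open_eq by blast
qed

lemma coord_inj: "c \<in> A \<Longrightarrow> inj_on (coord c) (cdom c)"
proof -
  assume c: "c \<in> A"
  have "homeomorphic_map (subtopology M (cdom c)) (top_of_set (coord c ` cdom c)) (coord c)"
    using is_chart[OF c] by (simp add: is_chart_def)
  then have "inj_on (coord c) (topspace (subtopology M (cdom c)))"
    by (rule homeomorphic_imp_injective_map)
  then show ?thesis using cdom_subset[OF c] by (simp add: inf.absorb2)
qed

lemma cinv_coord: "c \<in> A \<Longrightarrow> p \<in> cdom c \<Longrightarrow> cinv c (coord c p) = p"
  by (rule inv_into_f_f[OF coord_inj])

lemma coord_cinv: "x \<in> coord c ` cdom c \<Longrightarrow> coord c (cinv c x) = x"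
  by (rule f_inv_into_f)

lemma cinv_in: "c \<in> A \<Longrightarrow> x \<in> coord c ` (cdom c \<inter> U) \<Longrightarrow> cinv c x \<in> cdom c \<inter> U"
  using cinv_coord by fastforce

lemma smooth_transition:
  assumes "c \<in> A" "d \<in> A"
  shows "smooth_on (coord c ` (cdom c \<inter> cdom d)) (\<lambda>x. coord d (cinv c x))"
  using manifold assms by (auto simp: smooth_manifold_def compatible_def o_def)

abbreviation transition :: "('a, 'e) chart \<Rightarrow> ('a, 'e) chart \<Rightarrow> 'e \<Rightarrow> 'e" where
  "transition c d \<equiv> (\<lambda>x. coord d (cinv c x))"

lemma transition_differentiable:
  assumes "c \<in> A" "d \<in> A" "p \<in> cdom c" "p \<in> cdom d"
  shows "transition c d differentiable (at (coord c p))"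
  by (rule smooth_on_differentiable[OF smooth_transition]) (use assms in auto)

text \<open>The chain rule for a change of charts.\<close>

lemma fder_via_chart:
  fixes f :: "'a \<Rightarrow> 'f::real_normed_vector"
  assumes c: "c \<in> A" "p \<in> cdom c" and d: "d \<in> A" "p \<in> cdom d"
    and f: "(\<lambda>x. f (cinv d x)) differentiable (at (coord d p))"
  shows "fder (\<lambda>x. f (cinv c x)) (coord c p) u = fder (\<lambda>x. f (cinv d x)) (coord d p) (fder (transition c d) (coord c p) u)"
proof -
  have p: "transition c d (coord c p) = coord d p" using c by (simp add: cinv_coord)
  have "fder (\<lambda>x. f (cinv c x)) (coord c p) = fder (\<lambda>x. f (cinv d (transition c d x))) (coord c p)"
  proof (rule fder_cong[OF open_coord_image[OF c(1) openin_cdom[OF d(1)]]])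
    show "coord c p \<in> coord c ` (cdom c \<inter> cdom d)" using c d by auto
    show "f (cinv c y) = f (cinv d (transition c d y))" if "y \<in> coord c ` (cdom c \<inter> cdom d)" for y
      using cinv_in[OF c(1) that] cinv_coord[OF d(1), of "cinv c y"] by simp
  qed
  also have "\<dots> = (\<lambda>u. fder (\<lambda>x. f (cinv d x)) (coord d p) (fder (transition c d) (coord c p) u))"
    using fder_eq[OF diff_chain_at[OF fder_has[OF transition_differentiable[OF c(1) d(1) c(2) d(2)]], of "\<lambda>x. f (cinv d x)"]]
      fder_has[OF f] by (simp add: o_def p)
  finally show ?thesis by simp
qed

lemma fder_transition_self:
  assumes "c \<in> A" "p \<in> cdom c"
  shows "fder (transition c c) (coord c p) u = u"
proof -
  have "fder (transition c c) (coord c p) = fder (\<lambda>x. x) (coord c p)"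
    using open_coord_image[OF assms(1) openin_cdom[OF assms(1)]] assms
    by (intro fder_cong[of "coord c ` cdom c"]) (auto simp: coord_cinv)
  then show ?thesis by simp
qed

text \<open>The tangent vector at \<open>p\<close> with the component \<open>u\<close> in the chart \<open>c\<close>.\<close>

definition chart_vector :: "('a, 'e) chart \<Rightarrow> 'a \<Rightarrow> 'e \<Rightarrow> ('a, 'e) tvec" where
  "chart_vector c p u = (\<lambda>d. if d \<in> A \<and> p \<in> cdom d then fder (transition c d) (coord c p) u else 0)"

lemma ext_tangent:
  assumes c: "c \<in> A" "p \<in> cdom c"
  shows "chart_vector c p u \<in> tangent_space A p" and "chart_vector c p u c = u"
proof -
  show "chart_vector c p u c = u" using assms by (simp add: chart_vector_def fder_transition_self)
  show "chart_vector c p u \<in> tangent_space A p"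
    unfolding tangent_space_def mem_Collect_eq
  proof (intro conjI ballI allI impI)
    fix d e assume d: "d \<in> A" "e \<in> A" "p \<in> cdom d \<and> p \<in> cdom e"
    have "fder (transition c e) (coord c p) u = fder (transition d e) (coord d p) (fder (transition c d) (coord c p) u)"
      by (rule fder_via_chart[OF c]) (use d transition_differentiable in auto)
    then show "chart_vector c p u e = frechet_derivative (coord e \<circ> cinv d) (at (coord d p)) (chart_vector c p u d)"
      using d by (simp add: chart_vector_def o_def)
  qed (auto simp: chart_vector_def)
qed

lemma tangent_component:
  assumes "v \<in> tangent_space A p" "c \<in> A" "p \<in> cdom c" "d \<in> A" "p \<in> cdom d"
  shows "v d = fder (transition c d) (coord c p) (v c)"
proof -
  have "v d = frechet_derivative (coord d \<circ> cinv c) (at (coord c p)) (v c)"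
    using assms unfolding tangent_space_def by blast
  then show ?thesis by (simp only: o_def)
qed

lemma tangent_outside: "v \<in> tangent_space A p \<Longrightarrow> d \<notin> A \<or> p \<notin> cdom d \<Longrightarrow> v d = 0"
  unfolding tangent_space_def by blast

lemma tangent_ext:
  assumes "c \<in> A" "p \<in> cdom c" "v \<in> tangent_space A p"
  shows "chart_vector c p (v c) = v"
proof
  fix d show "chart_vector c p (v c) d = v d"
    using tangent_component[OF assms(3,1,2), of d] tangent_outside[OF assms(3), of d]
    by (simp add: chart_vector_def)
qed

lemma tangent_eqI:
  assumes "c \<in> A" "p \<in> cdom c" "v \<in> tangent_space A p" "w \<in> tangent_space A p" "v c = w c"
  shows "v = w"
  using assms tangent_ext by metis

lemma tangent_tlin:
  assumes "u \<in> tangent_space A p" "v \<in> tangent_space A p"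
  shows "tlin a u b v \<in> tangent_space A p"
  unfolding tangent_space_def mem_Collect_eq
proof (intro conjI ballI allI impI)
  fix c d assume c: "c \<in> A" "d \<in> A" "p \<in> cdom c \<and> p \<in> cdom d"
  then have lin: "linear (fder (coord d \<circ> cinv c) (coord c p))"
    unfolding o_def by (intro fder_linear transition_differentiable) (use c in auto)
  have "u d = fder (coord d \<circ> cinv c) (coord c p) (u c)" "v d = fder (coord d \<circ> cinv c) (coord c p) (v c)"
    using c assms unfolding tangent_space_def by blast+
  then show "tlin a u b v d = fder (coord d \<circ> cinv c) (coord c p) (tlin a u b v c)"
    by (simp add: tlin_def linear_add[OF lin] linear_scale[OF lin])
next
  fix c assume "c \<notin> A \<or> p \<notin> cdom c"
  then show "tlin a u b v c = 0" using tangent_outside[OF assms(1), of c] tangent_outside[OF assms(2), of c] by (simp add: tlin_def)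
qed

lemma ext_tlin:
  assumes "c \<in> A" "p \<in> cdom c"
  shows "chart_vector c p (a *\<^sub>R u + b *\<^sub>R v) = tlin a (chart_vector c p u) b (chart_vector c p v)"
proof (rule tangent_eqI[OF assms ext_tangent(1)[OF assms]])
  show "tlin a (chart_vector c p u) b (chart_vector c p v) \<in> tangent_space A p"
    by (rule tangent_tlin) (rule ext_tangent(1)[OF assms])+
qed (simp add: ext_tangent(2)[OF assms] tlin_def)

lemma dfun_chart:
  assumes c: "c \<in> A" "p \<in> cdom c" and v: "v \<in> tangent_space A p"
    and f: "(\<lambda>x. f (cinv c x)) differentiable (at (coord c p))"
  shows "dfun A f p v = fder (\<lambda>x. f (cinv c x)) (coord c p) (v c)"
proof -
  define d where "d = (SOME c. c \<in> A \<and> p \<in> cdom c)"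
  have d: "d \<in> A" "p \<in> cdom d"
    using someI[of "\<lambda>c. c \<in> A \<and> p \<in> cdom c" c] c by (auto simp: d_def)
  have "dfun A f p v = fder (\<lambda>x. f (cinv d x)) (coord d p) (v d)"
    unfolding dfun_def Let_def d_def o_def by (rule refl)
  also have "\<dots> = fder (\<lambda>x. f (cinv c x)) (coord c p) (fder (transition d c) (coord d p) (v d))"
    by (rule fder_via_chart[OF d c f])
  also have "fder (transition d c) (coord d p) (v d) = v c"
    by (rule tangent_component[OF v d c, symmetric])
  finally show ?thesis .
qed

lemma smooth_functionD:
  assumes "smooth_function A U f" "c \<in> A"
  shows "smooth_on (coord c ` (cdom c \<inter> U)) (\<lambda>x. f (cinv c x))"
  using assms by (auto simp: smooth_function_def o_def)

lemma vector_fieldD: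
  assumes "vector_field A U X"
  shows "p \<in> U \<Longrightarrow> X p \<in> tangent_space A p"
    and "c \<in> A \<Longrightarrow> smooth_on (coord c ` (cdom c \<inter> U)) (\<lambda>x. X (cinv c x) c)"
  using assms by (auto simp: vector_field_def)

lemma vector_field_subset: "vector_field A U X \<Longrightarrow> W \<subseteq> U \<Longrightarrow> vector_field A W X"
  unfolding vector_field_def by (blast intro: smooth_on_subset image_mono)

lemma smooth_in_all_charts:
  fixes f :: "'a \<Rightarrow> 'f::real_normed_vector"
  assumes c: "c \<in> A" and d: "d \<in> A" and U: "openin M U" "U \<subseteq> cdom c"
    and f: "smooth_on (coord c ` U) (\<lambda>x. f (cinv c x))"
  shows "smooth_on (coord d ` (cdom d \<inter> U)) (\<lambda>x. f (cinv d x))"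
proof -
  have op: "open (coord d ` (cdom d \<inter> U))" by (rule open_coord_image[OF d U(1)])
  have opc: "open (coord c ` U)" using open_coord_image[OF c U(1)] U(2) by (simp add: inf.absorb2)
  have in_U: "cinv d x \<in> cdom d \<inter> U" if "x \<in> coord d ` (cdom d \<inter> U)" for x
    using cinv_in[OF d that] .
  have "smooth_on (coord d ` (cdom d \<inter> U)) (\<lambda>x. f (cinv c (transition d c x)))"
  proof (rule smooth_on_compose[OF op opc _ f])
    show "transition d c ` (coord d ` (cdom d \<inter> U)) \<subseteq> coord c ` U"
      using in_U by auto
    show "smooth_on (coord d ` (cdom d \<inter> U)) (transition d c)"
      by (rule smooth_on_subset[OF smooth_transition[OF d c]]) (use U(2) in auto)
  qed
  then show ?thesis
    by (rule smooth_on_cong[OF op, THEN iffD1, rotated])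
      (use in_U U(2) cinv_coord[OF c] in \<open>auto simp: subset_iff\<close>)
qed

lemma smooth_function_local:
  assumes "\<And>p. p \<in> U \<Longrightarrow> \<exists>c W. c \<in> A \<and> p \<in> W \<and> openin M W \<and> W \<subseteq> cdom c
      \<and> smooth_on (coord c ` W) (\<lambda>x. f (cinv c x))"
  shows "smooth_function A U f"
  unfolding smooth_function_def o_def
proof (intro ballI smooth_on_local)
  fix d x assume d: "d \<in> A" and "x \<in> coord d ` (cdom d \<inter> U)"
  then obtain p where p: "p \<in> U" "p \<in> cdom d" "x = coord d p" by auto
  then obtain c W where "c \<in> A" "p \<in> W" "openin M W" "W \<subseteq> cdom c" "smooth_on (coord c ` W) (\<lambda>x. f (cinv c x))"
    using assms by blast
  then show "\<exists>T. open T \<and> x \<in> T \<and> smooth_on T (\<lambda>x. f (cinv d x))"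
    using smooth_in_all_charts[of c d W f] open_coord_image[OF d, of W] p d
    by (intro exI[of _ "coord d ` (cdom d \<inter> W)"]) auto
qed

text \<open>It suffices to know the components in one chart around each point: those in another chart \<open>d\<close> arise by
the derivative of the coordinate change, expanded in the standard basis.\<close>

lemma vector_field_local:
  assumes "\<And>p. p \<in> U \<Longrightarrow> X p \<in> tangent_space A p"
    and "\<And>p. p \<in> U \<Longrightarrow> \<exists>c W. c \<in> A \<and> p \<in> W \<and> openin M W \<and> W \<subseteq> cdom c \<and> W \<subseteq> U
      \<and> smooth_on (coord c ` W) (\<lambda>x. X (cinv c x) c)"
  shows "vector_field A U X"
  unfolding vector_field_def
proof (intro conjI ballI smooth_on_local)
  fix d x assume d: "d \<in> A" and "x \<in> coord d ` (cdom d \<inter> U)"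
  then obtain p where p: "p \<in> U" "p \<in> cdom d" "x = coord d p" by auto
  then obtain c W where c: "c \<in> A" "p \<in> W" "openin M W" "W \<subseteq> cdom c" "W \<subseteq> U"
    and X: "smooth_on (coord c ` W) (\<lambda>x. X (cinv c x) c)"
    using assms(2) by blast
  let ?T = "coord d ` (cdom d \<inter> W)"
  have op: "open ?T" by (rule open_coord_image[OF d c(3)])
  have in_W: "cinv d x \<in> cdom d \<inter> W" if "x \<in> ?T" for x
    using cinv_in[OF d that] .
  have opc: "open (coord c ` (cdom c \<inter> cdom d))" by (rule open_coord_image[OF c(1) openin_cdom[OF d]])
  have sm: "smooth_on ?T (\<lambda>x. \<Sum>i\<in>Basis. (X (cinv d x) c \<bullet> i) *\<^sub>R fder (transition c d) (transition d c x) i)"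
  proof (intro smooth_on_sum[OF op] smooth_on_scaleR[OF op] smooth_on_inner[OF op])
    show "smooth_on ?T (\<lambda>x. X (cinv d x) c)"
      by (rule smooth_in_all_charts[OF c(1) d c(3,4), of "\<lambda>q. X q c", OF X])
    fix i :: 'e
    show "smooth_on ?T (\<lambda>x. fder (transition c d) (transition d c x) i)"
    proof (rule smooth_on_compose[OF op opc _ smooth_on_fder[OF smooth_transition[OF c(1) d]]])
      show "transition d c ` ?T \<subseteq> coord c ` (cdom c \<inter> cdom d)" using in_W c(4) by auto
      show "smooth_on ?T (transition d c)"
        by (rule smooth_on_subset[OF smooth_transition[OF d c(1)]]) (use c(4) in auto)
    qed
  qed
  have "smooth_on ?T (\<lambda>x. X (cinv d x) d)"
  proof (rule smooth_on_cong[OF op, THEN iffD1, OF _ sm])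
    fix y assume "y \<in> ?T"
    then have q: "cinv d y \<in> cdom d" "cinv d y \<in> W" "cinv d y \<in> cdom c" using in_W c(4) by auto
    have "X (cinv d y) d = fder (transition c d) (transition d c y) (X (cinv d y) c)"
      by (rule tangent_component[OF assms(1)]) (use q c d in auto)
    also have "\<dots> = (\<Sum>i\<in>Basis. (X (cinv d y) c \<bullet> i) *\<^sub>R fder (transition c d) (transition d c y) i)"
      by (rule linear_Basis_expand[OF fder_linear[OF transition_differentiable[OF c(1) d q(3,1)]]])
    finally show "(\<Sum>i\<in>Basis. (X (cinv d y) c \<bullet> i) *\<^sub>R fder (transition c d) (transition d c y) i) = X (cinv d y) d"
      by simp
  qed
  then show "\<exists>T. open T \<and> x \<in> T \<and> smooth_on T (\<lambda>x. X (cinv d x) d)"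
    using op p c by (intro exI[of _ ?T]) auto
qed (use assms(1) in auto)

lemma vector_field_ext:
  assumes c: "c \<in> A" and U: "openin M U" "U \<subseteq> cdom c"
  shows "vector_field A U (\<lambda>q. chart_vector c q u)"
proof (rule vector_field_local)
  show "chart_vector c p u \<in> tangent_space A p" if "p \<in> U" for p
    by (rule ext_tangent) (use c U that in auto)
  have op: "open (coord c ` U)" using open_coord_image[OF c U(1)] U(2) by (simp add: inf.absorb2)
  have "smooth_on (coord c ` U) (\<lambda>x. chart_vector c (cinv c x) u c)"
  proof (rule smooth_on_cong[OF op, THEN iffD1])
    show "smooth_on (coord c ` U) (\<lambda>x. u)" by (rule smooth_on_const)
    show "u = chart_vector c (cinv c y) u c" if y: "y \<in> coord c ` U" for y
    proof -
      obtain q where "q \<in> U" "y = coord c q" using y by auto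
      then show ?thesis using ext_tangent(2)[OF c, of q] cinv_coord[OF c, of q] U(2) by auto
    qed
  qed
  then show "\<exists>c' W. c' \<in> A \<and> p \<in> W \<and> openin M W \<and> W \<subseteq> cdom c' \<and> W \<subseteq> U
      \<and> smooth_on (coord c' ` W) (\<lambda>x. chart_vector c (cinv c' x) u c')" if "p \<in> U" for p
    using that c U by blast
qed

text \<open>The components of \<open>B\<close> in the chart \<open>c\<close>, as a field of bilinear forms on the image of \<open>c\<close>.\<close>

definition local_form :: "('a, 'e) chart \<Rightarrow> ('a \<Rightarrow> ('a, 'e) tvec \<Rightarrow> ('a, 'e) tvec \<Rightarrow> real) \<Rightarrow> 'e \<Rightarrow> 'e \<Rightarrow> 'e \<Rightarrow> real" where
  "local_form c B x u v = B (cinv c x) (chart_vector c (cinv c x) u) (chart_vector c (cinv c x) v)"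

lemma loc_eq:
  assumes "c \<in> A" "p \<in> cdom c" "u \<in> tangent_space A p" "v \<in> tangent_space A p"
  shows "local_form c B (coord c p) (u c) (v c) = B p u v"
  using assms by (simp add: local_form_def cinv_coord tangent_ext)

lemma loc_smooth_bilinear:
  assumes B: "tensor2 M A B" and c: "c \<in> A"
  shows "smooth_bilinear (coord c ` cdom c) (local_form c B)"
  unfolding smooth_bilinear_def
proof (intro conjI ballI allI)
  fix x assume "x \<in> coord c ` cdom c"
  then obtain p where p: "p \<in> cdom c" "x = coord c p" by auto
  have pM: "p \<in> topspace M" using cdom_subset[OF c] p by auto
  note t = ext_tangent(1)[OF c p(1)]
  have l: "B p (chart_vector c p (a *\<^sub>R u + b *\<^sub>R v)) (chart_vector c p w) = a * B p (chart_vector c p u) (chart_vector c p w) + b * B p (chart_vector c p v) (chart_vector c p w)"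
    "B p (chart_vector c p w) (chart_vector c p (a *\<^sub>R u + b *\<^sub>R v)) = a * B p (chart_vector c p w) (chart_vector c p u) + b * B p (chart_vector c p w) (chart_vector c p v)" for a b u v w
    using B pM t unfolding ext_tlin[OF c p(1)] tensor2_def by blast+
  show "bilinear (local_form c B x)"
    unfolding bilinear_def linear_iff
    using l[where a = 1 and b = 1] l[where b = 0] by (auto simp: local_form_def p cinv_coord[OF c])
next
  fix u v
  have "smooth_function A (cdom c) (\<lambda>p. B p (chart_vector c p u) (chart_vector c p v))"
    using B vector_field_ext[OF c openin_cdom[OF c] order_refl] openin_cdom[OF c] unfolding tensor2_def by blast
  from smooth_functionD[OF this c] show "smooth_on (coord c ` cdom c) (\<lambda>x. local_form c B x u v)"
    by (simp add: local_form_def)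
qed

end

section \<open>Hamiltonian 2-forms on manifolds\<close>

locale hamiltonian_manifold = manifold M A
  for M :: "'a topology" and A :: "('a, 'e::euclidean_space) chart set" +
  fixes g \<phi> :: "'a \<Rightarrow> ('a, 'e) tvec \<Rightarrow> ('a, 'e) tvec \<Rightarrow> real"
    and J :: "'a \<Rightarrow> ('a, 'e) tvec \<Rightarrow> ('a, 'e) tvec"
    and nabla :: "('a \<Rightarrow> ('a, 'e) tvec) \<Rightarrow> ('a \<Rightarrow> ('a, 'e) tvec) \<Rightarrow> 'a \<Rightarrow> ('a, 'e) tvec"
    and m :: nat and \<sigma> :: "'a \<Rightarrow> real"
  assumes dim: "DIM('e) = 2 * m"
    and kaehler: "kaehler_manifold M A g J"
    and levi_civita: "levi_civita M A g nabla"
    and \<phi>: "two_form M A \<phi>" "J_invariant M A J \<phi>"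
    and \<sigma>: "smooth_function A (topspace M) \<sigma>"
    and hamiltonian: "\<And>U X Y Z p. openin M U \<Longrightarrow> vector_field A U X \<Longrightarrow> vector_field A U Y \<Longrightarrow> vector_field A U Z \<Longrightarrow> p \<in> U \<Longrightarrow>
      cov_derivative A nabla X \<phi> Y Z p =
              (1/2) * (wedge (dfun A \<sigma> p) (flat g p (J p (X p))) (Y p) (Z p)
                     - wedge (dcfun A J \<sigma> p) (flat g p (X p)) (Y p) (Z p))"
    and killing_potential: "m = 1 \<Longrightarrow> killing_field M A g (J_grad A g J \<sigma>)"
begin

lemma g_tensor: "tensor2 M A g" and \<phi>_tensor: "tensor2 M A \<phi>"
  and endo: "endomorphism_field M A J"
  using kaehler \<phi> by (auto simp: kaehler_manifold_def riemannian_metric_def two_form_def complex_structure_def)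

text \<open>That the bracket transforms as a vector follows from the connection being torsion-free, without differentiating the
coordinate changes twice.\<close>

lemma lie_bracket_tangent:
  assumes U: "openin M U" and X: "vector_field A U X" and Y: "vector_field A U Y" and p: "p \<in> U"
  shows "lie_bracket A X Y p \<in> tangent_space A p"
proof -
  have sm: "smooth_function A U (\<lambda>_. 0)"
    by (simp add: smooth_function_def o_def smooth_on_const)
  have "vector_field A U (nabla X Y)" "vector_field A U (nabla Y X)"
    using levi_civita U X Y sm unfolding levi_civita_def affine_connection_def by blast+
  then have "tlin 1 (nabla X Y p) (-1) (nabla Y X p) \<in> tangent_space A p"
    using p by (intro tangent_tlin vector_fieldD(1))
  moreover have "tlin 1 (nabla X Y p) (-1) (nabla Y X p) = lie_bracket A X Y p"
    using levi_civita U X Y p unfolding levi_civita_def by blast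
  ultimately show ?thesis by simp
qed

lemma nabla_tangent:
  assumes U: "openin M U" and X: "vector_field A U X" and Y: "vector_field A U Y" and p: "p \<in> U"
  shows "nabla X Y p \<in> tangent_space A p"
proof -
  have sm: "smooth_function A U (\<lambda>_. 0)"
    by (simp add: smooth_function_def o_def smooth_on_const)
  have "vector_field A U (nabla X Y)"
    using levi_civita U X Y sm unfolding levi_civita_def affine_connection_def by blast
  then show ?thesis using p by (rule vector_fieldD(1))
qed

lemma pairing_in_chart:
  assumes B: "tensor2 M A B" and c: "c \<in> A" and U: "openin M U" and Y: "vector_field A U Y" and Z: "vector_field A U Z"
    and p: "p \<in> U" "p \<in> cdom c" and v: "v \<in> tangent_space A p"
  shows "dfun A (\<lambda>q. B q (Y q) (Z q)) p v = fder (\<lambda>x. local_form c B x (Y (cinv c x) c) (Z (cinv c x) c)) (coord c p) (v c)"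
proof -
  let ?S = "coord c ` (cdom c \<inter> U)"
  have op: "open ?S" by (rule open_coord_image[OF c U])
  have "smooth_function A U (\<lambda>q. B q (Y q) (Z q))"
    using B U Y Z unfolding tensor2_def by blast
  from smooth_functionD[OF this c] have "(\<lambda>x. B (cinv c x) (Y (cinv c x)) (Z (cinv c x))) differentiable (at (coord c p))"
    by (rule smooth_on_differentiable) (use p in auto)
  then have "dfun A (\<lambda>q. B q (Y q) (Z q)) p v = fder (\<lambda>x. B (cinv c x) (Y (cinv c x)) (Z (cinv c x))) (coord c p) (v c)"
    by (rule dfun_chart[OF c p(2) v])
  also have "fder (\<lambda>x. B (cinv c x) (Y (cinv c x)) (Z (cinv c x))) (coord c p)
      = fder (\<lambda>x. local_form c B x (Y (cinv c x) c) (Z (cinv c x) c)) (coord c p)"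
  proof (rule fder_cong[OF op])
    show "coord c p \<in> ?S" using p by auto
    fix y assume "y \<in> ?S"
    then obtain q where q: "q \<in> cdom c" "q \<in> U" "y = coord c q" by auto
    then show "B (cinv c y) (Y (cinv c y)) (Z (cinv c y)) = local_form c B y (Y (cinv c y) c) (Z (cinv c y) c)"
      using loc_eq[OF c q(1) vector_fieldD(1)[OF Y q(2)] vector_fieldD(1)[OF Z q(2)], of B]
      by (simp add: cinv_coord[OF c])
  qed
  finally show ?thesis .
qed

lemma lie_bracket_chart:
  assumes "c \<in> A" "p \<in> cdom c"
  shows "lie_bracket A X Y p c = fder (\<lambda>x. Y (cinv c x) c) (coord c p) (X p c) - fder (\<lambda>x. X (cinv c x) c) (coord c p) (Y p c)"
  using assms by (simp add: lie_bracket_def)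

lemma ext_component_const:
  assumes "c \<in> A" "p \<in> cdom c"
  shows "fder (\<lambda>x. chart_vector c (cinv c x) u c) (coord c p) = (\<lambda>_. 0)"
proof -
  have "fder (\<lambda>x. chart_vector c (cinv c x) u c) (coord c p) = fder (\<lambda>x. u) (coord c p)"
  proof (rule fder_cong[of "coord c ` cdom c"])
    show "open (coord c ` cdom c)" using open_coord_image[OF assms(1) openin_cdom[OF assms(1)]] by simp
    show "chart_vector c (cinv c y) u c = u" if y: "y \<in> coord c ` cdom c" for y
    proof -
      obtain q where "q \<in> cdom c" "y = coord c q" using y by blast
      then show ?thesis using ext_tangent(2)[OF assms(1)] cinv_coord[OF assms(1)] by simp
    qed
  qed (use assms in auto)
  then show ?thesis by simp
qed

lemma lie_bracket_ext:
  assumes "c \<in> A" "p \<in> cdom c"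
  shows "lie_bracket A (\<lambda>q. chart_vector c q u) (\<lambda>q. chart_vector c q v) p c = 0"
  by (simp add: lie_bracket_chart[OF assms] ext_component_const[OF assms])

end

text \<open>In the chart \<open>c\<close> the complex structure is the constant map \<open>J0\<close>.\<close>

locale holomorphic_chart = hamiltonian_manifold M A g \<phi> J nabla m \<sigma>
  for M :: "'a topology" and A :: "('a, 'e::euclidean_space) chart set" and g \<phi> J nabla m \<sigma> +
  fixes c :: "('a, 'e) chart" and J0 :: "'e \<Rightarrow> 'e"
  assumes c: "c \<in> A" and nonempty: "cdom c \<noteq> {}"
    and J0: "\<And>q u. q \<in> cdom c \<Longrightarrow> u \<in> tangent_space A q \<Longrightarrow> J q u c = J0 (u c)"
begin

abbreviation "V \<equiv> coord c ` cdom c"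
abbreviation "chart_field u \<equiv> (\<lambda>q. chart_vector c q u)"

lemma open_V: "open V"
  using open_coord_image[OF c openin_cdom[OF c]] by simp

lemma chart_field: "vector_field A (cdom c) (chart_field u)"
  by (rule vector_field_ext[OF c openin_cdom[OF c] order_refl])

lemma fld_val: "p \<in> cdom c \<Longrightarrow> chart_vector c p u c = u" "p \<in> cdom c \<Longrightarrow> chart_vector c p u \<in> tangent_space A p"
  using ext_tangent[OF c] by auto

lemma in_M: "p \<in> cdom c \<Longrightarrow> p \<in> topspace M"
  using cdom_subset[OF c] by auto

lemma J_tangent: "p \<in> cdom c \<Longrightarrow> u \<in> tangent_space A p \<Longrightarrow> J p u \<in> tangent_space A p"
  using endo in_M unfolding endomorphism_field_def by blast

lemma J_ext: "p \<in> cdom c \<Longrightarrow> J p (chart_vector c p u) = chart_vector c p (J0 u)"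
  by (rule tangent_eqI[OF c]) (auto simp: J_tangent fld_val J0)

definition \<Gamma> :: "'e \<Rightarrow> 'e \<Rightarrow> 'e \<Rightarrow> 'e" where
  "\<Gamma> x u v = nabla (chart_field u) (chart_field v) (cinv c x) c"

lemma nabla_fld:
  assumes "p \<in> cdom c"
  shows "nabla (chart_field u) (chart_field v) p = chart_vector c p (\<Gamma> (coord c p) u v)"
  using tangent_ext[OF c assms nabla_tangent[OF openin_cdom[OF c] chart_field chart_field assms]] cinv_coord[OF c assms]
  by (simp add: \<Gamma>_def)

lemma loc_at: "p \<in> cdom c \<Longrightarrow> local_form c B (coord c p) u v = B p (chart_vector c p u) (chart_vector c p v)"
  by (simp add: local_form_def cinv_coord[OF c])

lemma fder_loc:
  assumes B: "tensor2 M A B" and p: "p \<in> cdom c"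
  shows "dfun A (\<lambda>q. B q (chart_vector c q u) (chart_vector c q v)) p (chart_vector c p w) = fder (\<lambda>x. local_form c B x u v) (coord c p) w"
proof -
  have "dfun A (\<lambda>q. B q (chart_vector c q u) (chart_vector c q v)) p (chart_vector c p w)
      = fder (\<lambda>x. local_form c B x (chart_vector c (cinv c x) u c) (chart_vector c (cinv c x) v c)) (coord c p) (chart_vector c p w c)"
    by (rule pairing_in_chart[OF B c openin_cdom[OF c] chart_field chart_field p p fld_val(2)[OF p]])
  also have "fder (\<lambda>x. local_form c B x (chart_vector c (cinv c x) u c) (chart_vector c (cinv c x) v c)) (coord c p) = fder (\<lambda>x. local_form c B x u v) (coord c p)"
    by (rule fder_cong[OF open_V]) (use p fld_val cinv_coord[OF c] in auto)
  finally show ?thesis by (simp add: fld_val(1)[OF p])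
qed

lemma J0_linear: "linear J0"
proof -
  obtain p where p: "p \<in> cdom c" using nonempty by auto
  have l: "J0 (a *\<^sub>R u + b *\<^sub>R v) = a *\<^sub>R J0 u + b *\<^sub>R J0 v" for a b u v
  proof -
    have "J p (tlin a (chart_vector c p u) b (chart_vector c p v)) = tlin a (J p (chart_vector c p u)) b (J p (chart_vector c p v))"
      using endo in_M[OF p] fld_val(2)[OF p] unfolding endomorphism_field_def by blast
    then have "chart_vector c p (J0 (a *\<^sub>R u + b *\<^sub>R v)) = tlin a (chart_vector c p (J0 u)) b (chart_vector c p (J0 v))"
      by (simp add: J_ext[OF p] flip: ext_tlin[OF c p])
    from fun_cong[OF this, of c] show ?thesis by (simp add: tlin_def fld_val[OF p])
  qed
  show ?thesis
    by (rule linearI) (use l[of 1 _ 1] l[of _ _ 0] in auto)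
qed

lemma J0_J0: "J0 (J0 u) = - u"
proof -
  obtain p where p: "p \<in> cdom c" using nonempty by auto
  have "J p (J p (chart_vector c p u)) = (\<lambda>d. - chart_vector c p u d)"
    using kaehler in_M[OF p] fld_val(2)[OF p] unfolding kaehler_manifold_def complex_structure_def by blast
  from fun_cong[OF this, of c] show ?thesis by (simp add: J_ext[OF p] fld_val[OF p])
qed

lemma \<Gamma>_sym: "p \<in> cdom c \<Longrightarrow> \<Gamma> (coord c p) u v = \<Gamma> (coord c p) v u"
proof -
  assume p: "p \<in> cdom c"
  have "tlin 1 (nabla (chart_field u) (chart_field v) p) (-1) (nabla (chart_field v) (chart_field u) p) = lie_bracket A (chart_field u) (chart_field v) p"
    using levi_civita openin_cdom[OF c] chart_field p unfolding levi_civita_def by blast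
  from fun_cong[OF this, of c] show ?thesis
    by (simp add: lie_bracket_ext[OF c p] tlin_def nabla_fld[OF p] fld_val[OF p])
qed

text \<open>Linearity in the first argument is tensoriality of the connection; in the second it follows from the symmetry.\<close>

lemma \<Gamma>_bilinear:
  assumes p: "p \<in> cdom c"
  shows "bilinear (\<Gamma> (coord c p))"
proof -
  have const: "smooth_function A (cdom c) (\<lambda>_. a)" for a
    by (simp add: smooth_function_def o_def smooth_on_const)
  have l: "\<Gamma> (coord c p) (a *\<^sub>R u + b *\<^sub>R v) w = a *\<^sub>R \<Gamma> (coord c p) u w + b *\<^sub>R \<Gamma> (coord c p) v w" for a b u v w
  proof -
    have "nabla (\<lambda>q. tlin a (chart_vector c q u) b (chart_vector c q v)) (chart_field w) p = tlin a (nabla (chart_field u) (chart_field w) p) b (nabla (chart_field v) (chart_field w) p)"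
      using levi_civita openin_cdom[OF c] chart_field[of u] chart_field[of v] chart_field[of w] const[of a] const[of b] p
      unfolding levi_civita_def affine_connection_def by blast
    moreover have "nabla (\<lambda>q. tlin a (chart_vector c q u) b (chart_vector c q v)) (chart_field w) p = nabla (chart_field (a *\<^sub>R u + b *\<^sub>R v)) (chart_field w) p"
    proof -
      have e: "\<forall>q\<in>cdom c. tlin a (chart_vector c q u) b (chart_vector c q v) = chart_vector c q (a *\<^sub>R u + b *\<^sub>R v)"
        using ext_tlin[OF c] by simp
      have vf: "vector_field A (cdom c) (\<lambda>q. tlin a (chart_vector c q u) b (chart_vector c q v))"
      proof (rule vector_field_local)
        show "tlin a (chart_vector c q u) b (chart_vector c q v) \<in> tangent_space A q" if "q \<in> cdom c" for q
          using that by (intro tangent_tlin fld_val)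
        have "smooth_on V (\<lambda>x. tlin a (chart_vector c (cinv c x) u) b (chart_vector c (cinv c x) v) c)"
        proof (rule smooth_on_cong[OF open_V, THEN iffD1])
          show "smooth_on V (\<lambda>x. a *\<^sub>R u + b *\<^sub>R v)" by (rule smooth_on_const)
          show "a *\<^sub>R u + b *\<^sub>R v = tlin a (chart_vector c (cinv c y) u) b (chart_vector c (cinv c y) v) c" if "y \<in> V" for y
            using that cinv_coord[OF c] fld_val by (auto simp: tlin_def)
        qed
        then show "\<exists>d W. d \<in> A \<and> q \<in> W \<and> openin M W \<and> W \<subseteq> cdom d \<and> W \<subseteq> cdom c
          \<and> smooth_on (coord d ` W) (\<lambda>x. tlin a (chart_vector c (cinv d x) u) b (chart_vector c (cinv d x) v) d)" if "q \<in> cdom c" for q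
          using that c openin_cdom[OF c] by blast
      qed
      have "\<forall>X X' Y Y'. vector_field A (cdom c) X \<and> vector_field A (cdom c) X' \<and> vector_field A (cdom c) Y \<and> vector_field A (cdom c) Y' \<longrightarrow>
          (\<forall>p\<in>cdom c. X p = X' p \<and> Y p = Y' p) \<longrightarrow> (\<forall>p\<in>cdom c. nabla X Y p = nabla X' Y' p)"
        using levi_civita openin_cdom[OF c] const[of 0] unfolding levi_civita_def affine_connection_def by blast
      from this[rule_format, of "\<lambda>q. tlin a (chart_vector c q u) b (chart_vector c q v)" "chart_field (a *\<^sub>R u + b *\<^sub>R v)" "chart_field w" "chart_field w" p]
      show ?thesis using vf chart_field e p by simp
    qed
    ultimately have "chart_vector c p (\<Gamma> (coord c p) (a *\<^sub>R u + b *\<^sub>R v) w) =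
        tlin a (chart_vector c p (\<Gamma> (coord c p) u w)) b (chart_vector c p (\<Gamma> (coord c p) v w))"
      by (simp add: nabla_fld[OF p])
    from fun_cong[OF this, of c] show ?thesis by (simp add: tlin_def fld_val[OF p])
  qed
  have left: "linear (\<lambda>u. \<Gamma> (coord c p) u w)" for w
    by (rule linearI) (use l[where a = 1 and b = 1] l[where b = 0] in auto)
  have flip: "\<Gamma> (coord c p) u = (\<lambda>v. \<Gamma> (coord c p) v u)" for u
    by (rule HOL.ext) (rule \<Gamma>_sym[OF p])
  have "linear (\<Gamma> (coord c p) u)" for u
    by (subst flip) (rule left)
  with left show ?thesis
    unfolding bilinear_def by blast
qed

text \<open>All conditions are read off from constant coordinate fields, whose brackets vanish.\<close>

lemma metric_chart: "kaehler_chart V (local_form c g) J0 \<Gamma>"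
proof (rule kaehler_chart.intro)
  show "open V" by (rule open_V)
  show "smooth_bilinear V (local_form c g)" by (rule loc_smooth_bilinear[OF g_tensor c])
  show "linear J0" by (rule J0_linear)
  show "J0 (J0 u) = - u" for u by (rule J0_J0)
  fix x assume "x \<in> V"
  then obtain p where p: "p \<in> cdom c" and x: "x = coord c p" by auto
  note pM = in_M[OF p] and t = fld_val(2)[OF p] and l = loc_at[OF p]
  show "local_form c g x u v = local_form c g x v u" for u v
    using kaehler pM t unfolding x l kaehler_manifold_def riemannian_metric_def by blast
  show "local_form c g x u u > 0" if "u \<noteq> 0" for u
  proof -
    have "chart_vector c p u \<noteq> (\<lambda>_. 0)" using fld_val(1)[OF p, of u] that by metis
    then show ?thesis
      using kaehler pM t unfolding x l kaehler_manifold_def riemannian_metric_def by blast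
  qed
  show "local_form c g x (J0 u) (J0 v) = local_form c g x u v" for u v
    using kaehler pM t unfolding x l J_ext[OF p, symmetric] kaehler_manifold_def J_invariant_def by blast
  show "bilinear (\<Gamma> x)" unfolding x by (rule \<Gamma>_bilinear[OF p])
  show "\<Gamma> x u v = \<Gamma> x v u" for u v unfolding x by (rule \<Gamma>_sym[OF p])
  show "fder (\<lambda>y. local_form c g y u v) x w = local_form c g x (\<Gamma> x w u) v + local_form c g x u (\<Gamma> x w v)" for u v w
  proof -
    have "dfun A (\<lambda>q. g q (chart_vector c q u) (chart_vector c q v)) p (chart_vector c p w)
            = g p (nabla (chart_field w) (chart_field u) p) (chart_vector c p v) + g p (chart_vector c p u) (nabla (chart_field w) (chart_field v) p)"
      using levi_civita openin_cdom[OF c] chart_field p unfolding levi_civita_def by blast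
    then show ?thesis
      unfolding fder_loc[OF g_tensor p] nabla_fld[OF p] x l .
  qed
  show "fder (\<lambda>y. local_form c g y (J0 u) v) x w + fder (\<lambda>y. local_form c g y (J0 v) w) x u + fder (\<lambda>y. local_form c g y (J0 w) u) x v = 0" for u v w
  proof -
    let ?\<omega> = "kaehler_form g J"
    have \<omega>: "closed_two_form M A ?\<omega>" using kaehler by (simp add: kaehler_manifold_def)
    then have \<omega>_tensor: "tensor2 M A ?\<omega>" by (simp add: closed_two_form_def two_form_def)
    have loc_\<omega>: "fder (\<lambda>y. local_form c ?\<omega> y a b) x = fder (\<lambda>y. local_form c g y (J0 a) b) x" for a b
    proof (rule fder_cong[OF open_V])
      show "x \<in> V" using p x by auto
      fix y assume "y \<in> V"
      then obtain q where q: "q \<in> cdom c" "y = coord c q" by auto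
      then show "local_form c ?\<omega> y a b = local_form c g y (J0 a) b"
        by (simp add: loc_at kaehler_form_def J_ext)
    qed
    have bracket: "?\<omega> p (lie_bracket A (chart_field a) (chart_field b) p) (chart_vector c p d) = 0" for a b d
    proof -
      have "local_form c ?\<omega> (coord c p) (lie_bracket A (chart_field a) (chart_field b) p c) (chart_vector c p d c)
          = ?\<omega> p (lie_bracket A (chart_field a) (chart_field b) p) (chart_vector c p d)"
        by (rule loc_eq[OF c p lie_bracket_tangent[OF openin_cdom[OF c] chart_field chart_field p] t])
      then show ?thesis
        unfolding lie_bracket_ext[OF c p]
        using bilinear_lzero[OF smooth_bilinearD(1)[OF loc_smooth_bilinear[OF \<omega>_tensor c]], of "coord c p"] p by simp
    qed
    have "d2form A ?\<omega> (chart_field w) (chart_field u) (chart_field v) p = 0"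
      using \<omega> openin_cdom[OF c] chart_field p unfolding closed_two_form_def by blast
    then show ?thesis
      unfolding d2form_def bracket fder_loc[OF \<omega>_tensor p] x[symmetric] loc_\<omega> by simp
  qed
qed

sublocale kaehler_chart V "local_form c g" J0 \<Gamma>
  by (rule metric_chart)

lemma smooth_chart_function:
  assumes "smooth_function A (topspace M) f"
  shows "smooth_on V (\<lambda>x. f (cinv c x))"
  using smooth_functionD[OF assms c] cdom_subset[OF c] by (simp add: inf.absorb1)

lemma dfun_ext:
  assumes "smooth_function A (topspace M) f" "p \<in> cdom c" "v \<in> tangent_space A p"
  shows "dfun A f p v = fder (\<lambda>x. f (cinv c x)) (coord c p) (v c)"
  by (rule dfun_chart[OF c assms(2,3) smooth_on_differentiable[OF smooth_chart_function[OF assms(1)]]])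
    (use assms(2) in auto)

lemma metric_nondegenerate:
  assumes p: "p \<in> cdom c" and v: "v \<in> tangent_space A p" and w: "w \<in> tangent_space A p"
    and eq: "\<And>u. u \<in> tangent_space A p \<Longrightarrow> g p v u = g p w u"
  shows "v = w"
proof (rule tangent_eqI[OF c p v w])
  show "v c = w c"
  proof (rule G_eqI)
    show "coord c p \<in> V" using p by auto
    fix u
    show "local_form c g (coord c p) (v c) u = local_form c g (coord c p) (w c) u"
      using loc_eq[OF c p v fld_val(2)[OF p, of u], of g] loc_eq[OF c p w fld_val(2)[OF p, of u], of g]
        eq[OF fld_val(2)[OF p, of u]] by (simp add: fld_val(1)[OF p])
  qed
qed

lemma grad_chart:
  assumes f: "smooth_function A (topspace M) f" and p: "p \<in> cdom c"
  shows "grad A g f p = chart_vector c p (gradient (\<lambda>x. f (cinv c x)) (coord c p))"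
    and "w \<in> tangent_space A p \<Longrightarrow> g p (grad A g f p) w = dfun A f p w"
proof -
  let ?v = "chart_vector c p (gradient (\<lambda>x. f (cinv c x)) (coord c p))"
  have pV: "coord c p \<in> V" using p by auto
  have v: "g p ?v w = dfun A f p w" if w: "w \<in> tangent_space A p" for w
    using loc_eq[OF c p fld_val(2)[OF p, of "gradient (\<lambda>x. f (cinv c x)) (coord c p)"] w, of g]
    unfolding dfun_ext[OF f p w] fld_val(1)[OF p] G_grd[OF smooth_chart_function[OF f] pV] by simp
  show e: "grad A g f p = ?v"
    unfolding grad_def
  proof (rule the_equality)
    show "?v \<in> tangent_space A p \<and> (\<forall>w\<in>tangent_space A p. g p ?v w = dfun A f p w)"
      using v fld_val(2)[OF p] by blast
    show "z = ?v" if "z \<in> tangent_space A p \<and> (\<forall>w\<in>tangent_space A p. g p z w = dfun A f p w)" for z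
      by (rule metric_nondegenerate[OF p]) (use that v fld_val(2)[OF p] in auto)
  qed
  show "g p (grad A g f p) w = dfun A f p w" if "w \<in> tangent_space A p"
    unfolding e by (rule v[OF that])
qed

lemma J_grad_chart:
  assumes f: "smooth_function A (topspace M) f" and p: "p \<in> cdom c"
  shows "J_grad A g J f p = chart_vector c p (J0 (gradient (\<lambda>x. f (cinv c x)) (coord c p)))"
  by (simp add: J_grad_def grad_chart(1)[OF f p] J_ext[OF p])

text \<open>The derivatives of \<open>Y\<close> and \<open>Z\<close> along \<open>X\<close> cancel against those in the brackets, so that only the values of
\<open>Y\<close> and \<open>Z\<close> at \<open>p\<close> matter.\<close>

lemma lie_derivative_chart:
  assumes B: "tensor2 M A B" and U: "openin M U" and X: "vector_field A U X"
    and Y: "vector_field A U Y" and Z: "vector_field A U Z" and p: "p \<in> U" "p \<in> cdom c"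
  shows "lie_derivative A X B Y Z p = lie_form (\<lambda>x. X (cinv c x) c) (local_form c B) (coord c p) (Y p c) (Z p c)"
proof -
  let ?Y = "\<lambda>x. Y (cinv c x) c" and ?Z = "\<lambda>x. Z (cinv c x) c" and ?x = "coord c p"
  note sB = loc_smooth_bilinear[OF B c]
  have xV: "?x \<in> V" and xU: "?x \<in> coord c ` (cdom c \<inter> U)" using p by auto
  have d: "?Y differentiable (at ?x)" "?Z differentiable (at ?x)"
    using smooth_on_differentiable[OF vector_fieldD(2)[OF Y c] xU]
      smooth_on_differentiable[OF vector_fieldD(2)[OF Z c] xU] by auto
  have val: "?Y ?x = Y p c" "?Z ?x = Z p c" "X (cinv c ?x) c = X p c"
    by (simp_all add: cinv_coord[OF c p(2)])
  have "dfun A (\<lambda>q. B q (Y q) (Z q)) p (X p) = fder (\<lambda>x. local_form c B x (?Y x) (?Z x)) ?x (X p c)"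
    by (rule pairing_in_chart[OF B c U Y Z p vector_fieldD(1)[OF X p(1)]])
  also have "\<dots> = fder (\<lambda>x. local_form c B x (Y p c) (Z p c)) ?x (X p c)
      + local_form c B ?x (fder ?Y ?x (X p c)) (Z p c) + local_form c B ?x (Y p c) (fder ?Z ?x (X p c))"
    by (subst fder_eq[OF fder_smooth_bilinear[OF open_V sB xV d]]) (simp add: val)
  finally have 1: "dfun A (\<lambda>q. B q (Y q) (Z q)) p (X p) = \<dots>" .
  have 2: "B p (lie_bracket A X Y p) (Z p) = local_form c B ?x (fder ?Y ?x (X p c) - fder (\<lambda>x. X (cinv c x) c) ?x (Y p c)) (Z p c)"
    using loc_eq[OF c p(2) lie_bracket_tangent[OF U X Y p(1)] vector_fieldD(1)[OF Z p(1)], of B]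
    by (simp add: lie_bracket_chart[OF c p(2)])
  have 3: "B p (Y p) (lie_bracket A X Z p) = local_form c B ?x (Y p c) (fder ?Z ?x (X p c) - fder (\<lambda>x. X (cinv c x) c) ?x (Z p c))"
    using loc_eq[OF c p(2) vector_fieldD(1)[OF Y p(1)] lie_bracket_tangent[OF U X Z p(1)], of B]
    by (simp add: lie_bracket_chart[OF c p(2)])
  show ?thesis
    unfolding lie_derivative_def 1 2 3 lie_form_def val
    by (simp add: bilinear_lsub[OF smooth_bilinearD(1)[OF sB xV]] bilinear_rsub[OF smooth_bilinearD(1)[OF sB xV]])
qed

lemma lie_cong:
  assumes "x \<in> V" "\<And>y. y \<in> V \<Longrightarrow> X y = X' y"
  shows "lie_form X B x u v = lie_form X' B x u v"
  using fder_cong[OF open_V assms] assms by (simp add: lie_form_def)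

abbreviation "\<sigma>c \<equiv> (\<lambda>x. \<sigma> (cinv c x))"

lemma hamiltonian_form_chart: "hamiltonian_chart V (local_form c g) J0 \<Gamma> (local_form c \<phi>) \<sigma>c m"
proof (intro hamiltonian_chart.intro hamiltonian_chart_axioms.intro metric_chart)
  show "smooth_bilinear V (local_form c \<phi>)" by (rule loc_smooth_bilinear[OF \<phi>_tensor c])
  show "smooth_on V \<sigma>c" by (rule smooth_chart_function[OF \<sigma>])
  show "DIM('e) = 2 * m" by (rule dim)
  fix x assume xV: "x \<in> V"
  then obtain p where p: "p \<in> cdom c" and x: "x = coord c p" by auto
  note pM = in_M[OF p] and t = fld_val(2)[OF p] and l = loc_at[OF p]
  show "local_form c \<phi> x u v = - local_form c \<phi> x v u" for u v
    using \<phi>(1) pM t unfolding x l two_form_def by blast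
  show "local_form c \<phi> x (J0 u) (J0 v) = local_form c \<phi> x u v" for u v
    using \<phi>(2) pM t unfolding x l J_ext[OF p, symmetric] J_invariant_def by blast
  show "fder (\<lambda>y. local_form c \<phi> y u v) x w - local_form c \<phi> x (\<Gamma> x w u) v - local_form c \<phi> x u (\<Gamma> x w v) =
        1/2 * ((fder \<sigma>c x u * local_form c g x (J0 w) v - fder \<sigma>c x v * local_form c g x (J0 w) u)
             - (- fder \<sigma>c x (J0 u) * local_form c g x w v + fder \<sigma>c x (J0 v) * local_form c g x w u))" for u v w
  proof -
    have "cov_derivative A nabla (chart_field w) \<phi> (chart_field u) (chart_field v) p =
              (1/2) * (wedge (dfun A \<sigma> p) (flat g p (J p (chart_vector c p w))) (chart_vector c p u) (chart_vector c p v)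
                     - wedge (dcfun A J \<sigma> p) (flat g p (chart_vector c p w)) (chart_vector c p u) (chart_vector c p v))"
      by (rule hamiltonian[OF openin_cdom[OF c] chart_field chart_field chart_field p])
    then show ?thesis
      unfolding cov_derivative_def fder_loc[OF \<phi>_tensor p] nabla_fld[OF p] wedge_def flat_def dcfun_def
        J_oneform_def J_ext[OF p] dfun_ext[OF \<sigma> p t] fld_val(1)[OF p] x l
      by simp
  qed
  show "lie_form (\<lambda>y. J0 (gradient \<sigma>c y)) (local_form c g) x u v = 0" if m: "m = 1" for u v
  proof -
    let ?X = "J_grad A g J \<sigma>"
    have X: "vector_field A (topspace M) ?X" "preserves M A ?X g"
      using killing_potential[OF m] by (auto simp: killing_field_def)
    have "lie_derivative A ?X g (chart_field u) (chart_field v) p = 0"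
      using X(2) openin_cdom[OF c] chart_field p unfolding preserves_def by blast
    moreover have "lie_derivative A ?X g (chart_field u) (chart_field v) p = lie_form (\<lambda>x. ?X (cinv c x) c) (local_form c g) x u v"
      using lie_derivative_chart[OF g_tensor openin_cdom[OF c] vector_field_subset[OF X(1) cdom_subset[OF c]] chart_field chart_field p p]
      by (simp add: fld_val(1)[OF p] x)
    moreover have "lie_form (\<lambda>x. ?X (cinv c x) c) (local_form c g) x u v = lie_form (\<lambda>y. J0 (gradient \<sigma>c y)) (local_form c g) x u v"
    proof (rule lie_cong[OF xV])
      fix y assume "y \<in> V"
      then obtain q where "q \<in> cdom c" "y = coord c q" by auto
      then show "?X (cinv c y) c = J0 (gradient \<sigma>c y)"
        using J_grad_chart[OF \<sigma>, of q] fld_val(1)[of q] by (simp add: cinv_coord[OF c])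
    qed
    ultimately show ?thesis by simp
  qed
qed

sublocale hamiltonian_chart V "local_form c g" J0 \<Gamma> "local_form c \<phi>" \<sigma>c m
  by (rule hamiltonian_form_chart)

end

context hamiltonian_manifold
begin

abbreviation "momentum \<equiv> momentum_polynomial A g J m \<phi>"
abbreviation "K t \<equiv> J_grad A g J (momentum t)"

text \<open>The factor between the momentum polynomial and \<open>P\<close>. The last factor is the value of the
\<open>m\<close>-th power of \<open>\<omega>\<close> on an adapted frame.\<close>

definition frame_constant :: real where
  "frame_constant = (-1) ^ m * (1 / fact m) * pf_sum m standard_form"

lemma holomorphic_chart_exists:
  assumes "p \<in> topspace M"
  shows "\<exists>c J0. holomorphic_chart M A g \<phi> J nabla m \<sigma> c J0 \<and> p \<in> cdom c"
proof -
  have "complex_structure M A J" using kaehler by (simp add: kaehler_manifold_def)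
  then obtain c J0 where "c \<in> A" "p \<in> cdom c" "\<forall>q\<in>cdom c. \<forall>u\<in>tangent_space A q. J q u c = J0 (u c)"
    using assms unfolding complex_structure_def by blast
  then have "holomorphic_chart M A g \<phi> J nabla m \<sigma> c J0"
    by (intro holomorphic_chart.intro hamiltonian_manifold_axioms holomorphic_chart_axioms.intro) auto
  with \<open>p \<in> cdom c\<close> show ?thesis by blast
qed

end

context holomorphic_chart
begin

lemma in_V: "p \<in> cdom c \<Longrightarrow> coord c p \<in> V"
  by simp

lemma adapted_frame_chart:
  assumes p: "p \<in> cdom c"
  shows "adapted_frame A g J m p e \<Longrightarrow> adapted m (coord c p) (\<lambda>i. e i c)"
    and "adapted m (coord c p) f \<Longrightarrow> adapted_frame A g J m p (\<lambda>i. chart_vector c p (f i))"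
proof -
  show "adapted m (coord c p) (\<lambda>i. e i c)" if e: "adapted_frame A g J m p e"
    unfolding adapted_def
  proof (intro conjI allI impI)
    fix i j assume "i < 2 * m" "j < 2 * m"
    then show "local_form c g (coord c p) (e i c) (e j c) = (if i = j then 1 else 0)"
      using loc_eq[OF c p, of "e i" "e j" g] e by (simp add: adapted_frame_def)
  next
    fix i assume i: "i < m"
    then have "e (2*i) \<in> tangent_space A p" "e (2*i+1) = J p (e (2*i))"
      using e by (auto simp: adapted_frame_def)
    then show "e (2*i+1) c = J0 (e (2*i) c)" using J0[OF p] by simp
  qed
  show "adapted_frame A g J m p (\<lambda>i. chart_vector c p (f i))" if "adapted m (coord c p) f"
    using that by (simp add: adapted_frame_def adapted_def fld_val[OF p] J_ext[OF p] loc_at[OF p])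
qed

text \<open>The adapted frame picked by the Hodge star is arbitrary, but \<open>pf_sum_adapted_frame\<close> expresses the result in
the coordinate frame.\<close>

lemma momentum_chart:
  assumes p: "p \<in> cdom c"
  shows "momentum t p = frame_constant * P t (coord c p)"
proof -
  let ?x = "coord c p"
  define e where "e = (SOME e. adapted_frame A g J m p e)"
  have "adapted_frame A g J m p e"
    unfolding e_def using adapted_exists[OF in_V[OF p], of m] dim adapted_frame_chart(2)[OF p] by (metis order_refl someI_ex)
  then have et: "\<And>i. i < 2*m \<Longrightarrow> e i \<in> tangent_space A p" and e: "adapted m ?x (\<lambda>i. e i c)"
    using adapted_frame_chart(1)[OF p] by (auto simp: adapted_frame_def)
  let ?\<psi> = "\<lambda>u v. \<phi> p u v - t * kaehler_form g J p u v"
  have "wedge_power m ?\<psi> e = pf_sum m (\<lambda>i j. ?\<psi> (e i) (e j))" by (rule wedge_power_pf_sum)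
  also have "\<dots> = pf_sum m (\<lambda>i j. \<psi> t ?x (e i c) (e j c))"
  proof (rule pf_sum_cong)
    fix i j assume ij: "i < 2*m" "j < 2*m"
    have "local_form c g ?x (J p (e i) c) (e j c) = g p (J p (e i)) (e j)"
      using loc_eq[OF c p J_tangent[OF p et[OF ij(1)]] et[OF ij(2)], of g] .
    then show "?\<psi> (e i) (e j) = \<psi> t ?x (e i c) (e j c)"
      using loc_eq[OF c p et[OF ij(1)] et[OF ij(2)], of \<phi>] J0[OF p et[OF ij(1)]]
      by (simp add: \<psi>_def omega_def kaehler_form_def)
  qed
  also have "\<dots> = pf_sum m standard_form * P t ?x"
    unfolding P_def
    by (rule pf_sum_adapted_frame(2)[OF in_V[OF p] e smooth_bilinearD(1)[OF \<psi>_smooth_bilinear in_V[OF p]]])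
  finally show ?thesis
    unfolding momentum_polynomial_def pfaffian_def hodge_star_top_def frame_constant_def e_def[symmetric] by simp
qed

lemma momentum_cinv: "x \<in> V \<Longrightarrow> momentum t (cinv c x) = frame_constant * P t x"
  using momentum_chart[of "cinv c x"] cinv_in[OF c, of x "cdom c"] coord_cinv[of x c] by simp

lemma momentum_smooth_chart: "smooth_on V (\<lambda>x. momentum t (cinv c x))"
proof (rule smooth_on_cong[OF open_V, THEN iffD1])
  show "smooth_on V (\<lambda>x. frame_constant * P t x)"
    by (rule smooth_on_mult[OF open_V smooth_on_const P_smooth])
  show "frame_constant * P t y = momentum t (cinv c y)" if "y \<in> V" for y
    using momentum_cinv[OF that] by simp
qed

end

context hamiltonian_manifold
begin

lemma momentum_smooth: "smooth_function A (topspace M) (momentum t)"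
proof (rule smooth_function_local)
  fix p assume "p \<in> topspace M"
  then obtain c J0 where hc: "holomorphic_chart M A g \<phi> J nabla m \<sigma> c J0" and p: "p \<in> cdom c"
    using holomorphic_chart_exists by blast
  then show "\<exists>c W. c \<in> A \<and> p \<in> W \<and> openin M W \<and> W \<subseteq> cdom c \<and> smooth_on (coord c ` W) (\<lambda>x. momentum t (cinv c x))"
    using holomorphic_chart.momentum_smooth_chart[OF hc] holomorphic_chart.c[OF hc] openin_cdom by blast
qed

end

context holomorphic_chart
begin

lemma grd_momentum:
  assumes x: "x \<in> V"
  shows "gradient (\<lambda>x. momentum t (cinv c x)) x = frame_constant *\<^sub>R \<eta> t x"
  unfolding gradient_def
proof (rule raise_eqI[OF x])
  fix v
  have "fder (\<lambda>x. momentum t (cinv c x)) x = fder (\<lambda>x. frame_constant * P t x) x"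
    by (rule fder_cong[OF open_V x]) (rule momentum_cinv)
  also have "\<dots> = (\<lambda>v. frame_constant * fder (P t) x v)"
    by (rule fder_eq) (rule has_derivative_mult_right[OF smooth_on_has_derivative[OF P_smooth x]])
  finally show "local_form c g x (frame_constant *\<^sub>R \<eta> t x) v = fder (\<lambda>x. momentum t (cinv c x)) x v"
    by (simp add: G_\<eta>[OF x] G_lin[OF x])
qed

lemma K_chart: "p \<in> cdom c \<Longrightarrow> K t p = chart_vector c p (frame_constant *\<^sub>R J0 (\<eta> t (coord c p)))"
  using J_grad_chart[OF momentum_smooth] by (simp add: grd_momentum J_lin)

lemma K_tangent: "p \<in> cdom c \<Longrightarrow> K t p \<in> tangent_space A p"
  by (simp add: K_chart fld_val)

lemma K_component: "p \<in> cdom c \<Longrightarrow> K t p c = frame_constant *\<^sub>R J0 (\<eta> t (coord c p))"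
  by (simp add: K_chart fld_val)

lemma K_cinv: "x \<in> V \<Longrightarrow> K t (cinv c x) c = frame_constant *\<^sub>R J0 (\<eta> t x)"
  using K_component[of "cinv c x"] cinv_in[OF c, of x "cdom c"] coord_cinv[of x c] by simp

lemma K_smooth_chart: "smooth_on V (\<lambda>x. K t (cinv c x) c)"
proof (rule smooth_on_cong[OF open_V, THEN iffD1])
  show "smooth_on V (\<lambda>x. frame_constant *\<^sub>R J0 (\<eta> t x))"
    by (intro smooth_on_scaleR[OF open_V] smooth_on_const smooth_on_linear[OF open_V J_linear] \<eta>_smooth)
  show "frame_constant *\<^sub>R J0 (\<eta> t y) = K t (cinv c y) c" if "y \<in> V" for y
    using K_cinv[OF that] by simp
qed

end

context hamiltonian_manifold
begin

lemma K_vector_field: "vector_field A (topspace M) (K t)"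
proof (rule vector_field_local)
  fix p assume "p \<in> topspace M"
  then obtain c J0 where hc: "holomorphic_chart M A g \<phi> J nabla m \<sigma> c J0" and p: "p \<in> cdom c"
    using holomorphic_chart_exists by blast
  show "K t p \<in> tangent_space A p"
    by (rule holomorphic_chart.K_tangent[OF hc p])
  show "\<exists>c W. c \<in> A \<and> p \<in> W \<and> openin M W \<and> W \<subseteq> cdom c \<and> W \<subseteq> topspace M
      \<and> smooth_on (coord c ` W) (\<lambda>x. K t (cinv c x) c)"
    using holomorphic_chart.K_smooth_chart[OF hc] holomorphic_chart.c[OF hc] openin_cdom cdom_subset p by blast
qed

end

context holomorphic_chart
begin

lemma lie_K:
  assumes x: "x \<in> V" and B: "bilinear (B x)" "\<And>u v. (\<lambda>y. B y u v) differentiable (at x)"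
  shows "lie_form (\<lambda>x. K t (cinv c x) c) B x u v = frame_constant * lie_form (\<lambda>y. J0 (\<eta> t y)) B x u v"
proof -
  have "fder (\<lambda>y. frame_constant *\<^sub>R J0 (\<eta> t y)) x = (\<lambda>w. frame_constant *\<^sub>R fder (\<lambda>y. J0 (\<eta> t y)) x w)"
    by (rule fder_eq) (rule has_derivative_scaleR_right[OF fder_has[OF differentiable_J[OF \<eta>_differentiable[OF x]]]])
  moreover have "lie_form (\<lambda>x. K t (cinv c x) c) B x u v = lie_form (\<lambda>y. frame_constant *\<^sub>R J0 (\<eta> t y)) B x u v"
    by (rule lie_cong[OF x K_cinv])
  ultimately show ?thesis
    by (simp add: lie_form_def bilinear_lmul[OF B(1)] bilinear_rmul[OF B(1)]
        linear_scale[OF fder_linear[OF B(2)]] algebra_simps)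
qed

lemma K_lie_derivative:
  assumes B: "tensor2 M A B" and inv: "\<And>u v. lie_form (\<lambda>y. J0 (\<eta> t y)) (local_form c B) (coord c p) u v = 0"
    and U: "openin M U" "vector_field A U Y" "vector_field A U Z" and p: "p \<in> U" "p \<in> cdom c"
  shows "lie_derivative A (K t) B Y Z p = 0"
proof -
  note sB = loc_smooth_bilinear[OF B c]
  have "lie_derivative A (K t) B Y Z p = lie_form (\<lambda>x. K t (cinv c x) c) (local_form c B) (coord c p) (Y p c) (Z p c)"
    by (rule lie_derivative_chart[OF B U(1) vector_field_subset[OF K_vector_field openin_subset[OF U(1)]] U(2,3) p])
  also have "\<dots> = frame_constant * lie_form (\<lambda>y. J0 (\<eta> t y)) (local_form c B) (coord c p) (Y p c) (Z p c)"
    by (rule lie_K[OF in_V[OF p(2)] smooth_bilinearD(1)[OF sB in_V[OF p(2)]]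
          smooth_on_differentiable[OF smooth_bilinearD(2)[OF sB] in_V[OF p(2)]]])
  finally show ?thesis by (simp add: inv)
qed

lemma K_invariance:
  assumes U: "openin M U" "vector_field A U Y" "vector_field A U Z" and p: "p \<in> U" "p \<in> cdom c"
  shows "lie_derivative A (K t) g Y Z p = 0" "lie_derivative A (K t) \<phi> Y Z p = 0"
  using K_lie_derivative[OF g_tensor momentum_killing[OF in_V[OF p(2)]] U p]
    K_lie_derivative[OF \<phi>_tensor momentum_preserves[OF in_V[OF p(2)]] U p] by auto

lemma K_hamiltonian:
  assumes p: "p \<in> cdom c" and w: "w \<in> tangent_space A p"
  shows "kaehler_form g J p (K t p) w = - dfun A (momentum t) p w"
proof -
  have g: "grad A g (momentum t) p \<in> tangent_space A p"
    unfolding grad_chart(1)[OF momentum_smooth p] by (rule fld_val(2)[OF p])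
  have "J p (J p (grad A g (momentum t) p)) = tlin (-1) (grad A g (momentum t) p) 0 (grad A g (momentum t) p)"
    using kaehler in_M[OF p] g unfolding kaehler_manifold_def complex_structure_def by (simp add: tlin_def)
  moreover have "g p (tlin (-1) (grad A g (momentum t) p) 0 (grad A g (momentum t) p)) w = - 1 * g p (grad A g (momentum t) p) w + 0 * g p (grad A g (momentum t) p) w"
    using g_tensor in_M[OF p] g w unfolding tensor2_def by blast
  ultimately show ?thesis
    by (simp add: kaehler_form_def J_grad_def grad_chart(2)[OF momentum_smooth p w])
qed

lemma hamiltonian_vector_momentum:
  assumes p: "p \<in> cdom c"
  shows "hamiltonian_vector A (kaehler_form g J) (momentum t) p = K t p"
  unfolding hamiltonian_vector_def
proof (rule the_equality)
  show "K t p \<in> tangent_space A p \<and> (\<forall>w\<in>tangent_space A p. kaehler_form g J p (K t p) w = - dfun A (momentum t) p w)"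
    using K_tangent[OF p] K_hamiltonian[OF p] by blast
  fix v assume v: "v \<in> tangent_space A p \<and> (\<forall>w\<in>tangent_space A p. kaehler_form g J p v w = - dfun A (momentum t) p w)"
  have "J p v = J p (K t p)"
    by (rule metric_nondegenerate[OF p])
      (use v K_tangent[OF p] K_hamiltonian[OF p] J_tangent[OF p] in \<open>auto simp: kaehler_form_def\<close>)
  then have "J0 (J0 (v c)) = J0 (J0 (K t p c))"
    using J0[OF p] v K_tangent[OF p] by metis
  then have "v c = K t p c" by (simp add: J0_J0)
  then show "v = K t p" using tangent_eqI[OF c p] v K_tangent[OF p] by blast
qed

lemma momentum_poisson:
  assumes p: "p \<in> cdom c"
  shows "poisson_bracket A (kaehler_form g J) (momentum s) (momentum t) p = 0"
proof -
  note x = in_V[OF p]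
  have "poisson_bracket A (kaehler_form g J) (momentum s) (momentum t) p = g p (J p (K s p)) (K t p)"
    by (simp add: poisson_bracket_def hamiltonian_vector_momentum[OF p] kaehler_form_def)
  also have "\<dots> = local_form c g (coord c p) (J0 (K s p c)) (K t p c)"
    using loc_eq[OF c p J_tangent[OF p K_tangent[OF p]] K_tangent[OF p], of g s t] J0[OF p K_tangent[OF p]] by simp
  also have "\<dots> = 0"
    using \<eta>_J_\<eta>[OF x, of s t] by (simp add: K_component[OF p] J_lin G_lin[OF x])
  finally show ?thesis .
qed

lemma K_commute:
  assumes p: "p \<in> cdom c"
  shows "lie_bracket A (K s) (K t) p = (\<lambda>_. 0)"
proof -
  note x = in_V[OF p]
  have d: "fder (\<lambda>x. K t (cinv c x) c) (coord c p) w = frame_constant *\<^sub>R fder (\<lambda>y. J0 (\<eta> t y)) (coord c p) w" for t w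
  proof -
    have "fder (\<lambda>x. K t (cinv c x) c) (coord c p) = fder (\<lambda>y. frame_constant *\<^sub>R J0 (\<eta> t y)) (coord c p)"
      by (rule fder_cong[OF open_V x]) (rule K_cinv)
    also have "\<dots> = (\<lambda>w. frame_constant *\<^sub>R fder (\<lambda>y. J0 (\<eta> t y)) (coord c p) w)"
      by (rule fder_eq) (rule has_derivative_scaleR_right[OF fder_has[OF differentiable_J[OF \<eta>_differentiable[OF x]]]])
    finally show ?thesis by simp
  qed
  have lin: "linear (fder (\<lambda>y. J0 (\<eta> t y)) (coord c p))" for t
    by (rule fder_linear[OF differentiable_J[OF \<eta>_differentiable[OF x]]])
  have "lie_bracket A (K s) (K t) p c = 0"
    unfolding lie_bracket_chart[OF c p] d K_component[OF p] linear_scale[OF lin]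
    using momentum_commute[OF x, of t s] by simp
  moreover have "lie_bracket A (K s) (K t) p \<in> tangent_space A p"
    by (rule lie_bracket_tangent[OF openin_topspace K_vector_field K_vector_field in_M[OF p]])
  ultimately have "lie_bracket A (K s) (K t) p = chart_vector c p 0"
    using tangent_ext[OF c p] by metis
  also have "\<dots> = (\<lambda>_. 0)"
    using ext_tlin[OF c p, of 0 0 0 0] by (simp add: tlin_def)
  finally show ?thesis .
qed

end

theorem proposition3:
  fixes M :: "'a topology"
    and A :: "('a, 'e::euclidean_space) chart set"
    and g :: "'a \<Rightarrow> ('a, 'e) tvec \<Rightarrow> ('a, 'e) tvec \<Rightarrow> real"
    and J :: "'a \<Rightarrow> ('a, 'e) tvec \<Rightarrow> ('a, 'e) tvec"
    and \<omega> :: "'a \<Rightarrow> ('a, 'e) tvec \<Rightarrow> ('a, 'e) tvec \<Rightarrow> real"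
    and nabla :: "('a \<Rightarrow> ('a, 'e) tvec) \<Rightarrow> ('a \<Rightarrow> ('a, 'e) tvec) \<Rightarrow> 'a \<Rightarrow> ('a, 'e) tvec"
    and \<phi> :: "'a \<Rightarrow> ('a, 'e) tvec \<Rightarrow> ('a, 'e) tvec \<Rightarrow> real"
    and m :: nat
    and P :: "real \<Rightarrow> 'a \<Rightarrow> real"
    and K :: "real \<Rightarrow> 'a \<Rightarrow> ('a, 'e) tvec"
  assumes "DIM('e) = 2 * m"
    and "kaehler_manifold M A g J"
    and "\<omega> = kaehler_form g J"
    and "levi_civita M A g nabla"
    and "hamiltonian_two_form M A g J nabla m \<phi>"
    and "P = momentum_polynomial A g J m \<phi>"
    and "K = (\<lambda>t. J_grad A g J (P t))"
  shows "(\<forall>s t. \<forall>p\<in>topspace M. poisson_bracket A \<omega> (P s) (P t) p = 0) \<and>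
    (\<forall>t. hamiltonian_for M A \<omega> (P t) (K t) \<and> killing_field M A g (K t) \<and> preserves M A (K t) \<phi>) \<and>
    (\<forall>s t. \<forall>p\<in>topspace M. lie_bracket A (K s) (K t) p = (\<lambda>_. 0))"
proof -
  obtain \<sigma> where \<sigma>: "smooth_function A (topspace M) \<sigma>"
    "\<forall>U X Y Z. openin M U \<and> vector_field A U X \<and> vector_field A U Y \<and> vector_field A U Z \<longrightarrow>
           (\<forall>p\<in>U. cov_derivative A nabla X \<phi> Y Z p =
              (1/2) * (wedge (dfun A \<sigma> p) (flat g p (J p (X p))) (Y p) (Z p)
                     - wedge (dcfun A J \<sigma> p) (flat g p (X p)) (Y p) (Z p)))"
    "m = 1 \<longrightarrow> killing_field M A g (J_grad A g J \<sigma>)"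
    using assms(5) unfolding hamiltonian_two_form_def by blast
  interpret hamiltonian_manifold M A g \<phi> J nabla m \<sigma>
  proof (intro hamiltonian_manifold.intro hamiltonian_manifold_axioms.intro manifold.intro)
    show "smooth_manifold M A" using assms(2) by (simp add: kaehler_manifold_def)
    show "two_form M A \<phi>" "J_invariant M A J \<phi>" using assms(5) by (auto simp: hamiltonian_two_form_def)
  qed (use assms \<sigma> in blast)+
  have "poisson_bracket A (kaehler_form g J) (momentum s) (momentum t) p = 0
      \<and> lie_bracket A (J_grad A g J (momentum s)) (J_grad A g J (momentum t)) p = (\<lambda>_. 0)"
    if p: "p \<in> topspace M" for s t p
  proof -
    obtain c J0 where "holomorphic_chart M A g \<phi> J nabla m \<sigma> c J0" "p \<in> cdom c"
      using holomorphic_chart_exists[OF p] by blast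
    then show ?thesis
      using holomorphic_chart.momentum_poisson holomorphic_chart.K_commute by metis
  qed
  moreover have "hamiltonian_for M A (kaehler_form g J) (momentum t) (J_grad A g J (momentum t))" for t
    unfolding hamiltonian_for_def
  proof (intro conjI momentum_smooth K_vector_field ballI)
    fix p w assume p: "p \<in> topspace M" and w: "w \<in> tangent_space A p"
    obtain c J0 where "holomorphic_chart M A g \<phi> J nabla m \<sigma> c J0" "p \<in> cdom c"
      using holomorphic_chart_exists[OF p] by blast
    then show "kaehler_form g J p (J_grad A g J (momentum t) p) w = - dfun A (momentum t) p w"
      using w by (rule holomorphic_chart.K_hamiltonian)
  qed
  moreover have "preserves M A (J_grad A g J (momentum t)) g \<and> preserves M A (J_grad A g J (momentum t)) \<phi>" for t
  proof -
    have "lie_derivative A (J_grad A g J (momentum t)) g Y Z p = 0 \<and> lie_derivative A (J_grad A g J (momentum t)) \<phi> Y Z p = 0"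
      if U: "openin M U" "vector_field A U Y" "vector_field A U Z" and p: "p \<in> U" for U Y Z p
    proof -
      have "p \<in> topspace M" using openin_subset[OF U(1)] p by blast
      then obtain c J0 where hc: "holomorphic_chart M A g \<phi> J nabla m \<sigma> c J0" and pc: "p \<in> cdom c"
        using holomorphic_chart_exists by blast
      show ?thesis
        using holomorphic_chart.K_invariance[OF hc U p pc] by blast
    qed
    then show ?thesis unfolding preserves_def by blast
  qed
  ultimately show ?thesis
    unfolding assms(3,6,7) killing_field_def using K_vector_field by blast
qed

end
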